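(* Let $0<\alpha<0.3$. For every $\varepsilon>0$, the interval $CI_{z,\alpha}$ (constructed in the context) is a $(1-\alpha)$-level confidence interval for the minimizer, i.e. $\mathbb P_f(Z(f)\in CI_{z,\alpha})\ge1-\alpha$ for all $f\in\mathcal F$, and its expected length satisfies $$\mathbb E_fL(CI_{z,\alpha})\le(24\times2^{K_\alpha}-3)\times17.5\times\rho_z(\varepsilon;f)\le C_{z,\alpha}\,L_{z,\alpha}(\varepsilon;f)\qquad\text{for all } f\in\mathcal F,$$ where $K_\alpha=\lceil\log\alpha/\log\Phi(-2)\rceil$ and $C_{z,\alpha}$ is a constant depending on $\alpha$ only.
   Context: $\Phi$ is the standard normal cdf. $\mathcal F$ is the collection of convex functions $f:[0,1]\to\mathbb R$ with a unique minimizer $Z(f)=\arg\min_{0\le t\le1}f(t)$; $M(f)=f(Z(f))$. One observes the white noise model $dY(t)=f(t)\,dt+\varepsilon\,dW(t)$, $0\le t\le1$, $W$ a standard Brownian motion, $\varepsilon>0$; $\mathbb P_f,\mathbb E_f$ are probability and expectation under drift $f$ (including auxiliary randomness). $L(CI)$ is the length of an interval $CI$. Benchmark: $L_{z,\alpha}(\varepsilon;f)=\sup_{g\in\mathcal F}\inf_{CI\in\mathcal I_{z,\alpha}(\{f,g\})}\mathbb E_fL(CI)$, where $\mathcal I_{z,\alpha}(\{f,g\})$ is the collection of confidence intervals based on $Y$ that contain $Z(h)$ with probability at least $1-\alpha$ under drift $h$, for both $h=f$ and $h=g$. Geometric quantities: with $f_u(t)=\max\{f(t),u\}$ and $\|\cdot\|_2$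 the $L_2[0,1]$ norm, $\rho_m(\varepsilon;f)=\sup\{u-M(f):\|f-f_u\|_2\le\varepsilon\}$ and $\rho_z(\varepsilon;f)=\sup\{|t-Z(f)|: f(t)\le\rho_m(\varepsilon;f)+M(f),\ t\in[0,1]\}$. Construction of $CI_{z,\alpha}$. Sample splitting: let $B_1,B_2$ be independent standard Brownian motions, independent of $Y$, and set $Y_l=Y+\frac{\sqrt2}{2}\varepsilon B_1+\frac{\sqrt6}{2}\varepsilon B_2$, $Y_s=Y+\frac{\sqrt2}{2}\varepsilon B_1-\frac{\sqrt6}{2}\varepsilon B_2$, $Y_e=Y-\sqrt2\,\varepsilon B_1$. Localization: $m_j=2^{-j}$, $t_{j,i}=i\,m_j$. For $j\ge0$, $1\le i\le2^j$ let $X_{j,i}=\int_{t_{j,i-1}}^{t_{j,i}}dY_l(t)$ and $\tilde X_{j,i}=\int_{t_{j,i-1}}^{t_{j,i}}dY_s(t)$; for integers $i\notin\{1,\dots,2^j\}$ set $X_{j,i}=\tilde X_{j,i}=+\infty$. Let $\hat i_0=1$ and, for $j\ge1$, $\hat i_j=\arg\min_{2\hat i_{j-1}-2\le i\le2\hat i_{j-1}+1}X_{j,i}$. Stopping: $T_j=\min\{\tilde X_{j,\hat i_j+6}-\tilde X_{j,\hat i_j+5},\ \tilde X_{j,\hat i_j-6}-\tilde X_{j,\hat i_j-5}\}$, with the convention $+\infty-x=+\infty$ and $\min\{+\infty,x\}=x$ for all $-\infty\le x\le\infty$. Let $\sigma_j^2=6m_j\varepsilon^2$ and $\hat j=\min\{j:T_j/\sigma_j\le2\}$.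 Confidence interval: $L=\max\{0,\hat i_{\hat j}-12\times2^{K_\alpha}+1\}$, $U=\min\{2^{\hat j},\hat i_{\hat j}+12\times2^{K_\alpha}-2\}$, and $CI_{z,\alpha}=[t_{\hat j,L},t_{\hat j,U}]$. *)

theory Defs
  imports "HOL-Probability.Probability"
begin

section \<open>Convex functions with a unique minimizer\<close>

text \<open>Functions on the unit interval are total functions on the reals of which only the values
  on the unit interval are used.\<close>

definition convex_class :: "(real \<Rightarrow> real) set" where
  "convex_class = {f. convex_on {0..1} f \<and> (\<exists>!z. is_arg_min f (\<lambda>t. t \<in> {0..1}) z)}"

definition minimizer :: "(real \<Rightarrow> real) \<Rightarrow> real" where
  "minimizer f = arg_min_on f {0..1}"

definition minimum :: "(real \<Rightarrow> real) \<Rightarrow> real" where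
  "minimum f = f (minimizer f)"

definition L2_norm :: "(real \<Rightarrow> real) \<Rightarrow> real" where
  "L2_norm h = sqrt (LINT t:{0..1}|lborel. (h t)\<^sup>2)"

definition rho_m :: "real \<Rightarrow> (real \<Rightarrow> real) \<Rightarrow> real" where
  "rho_m \<epsilon> f = Sup {u - minimum f | u. L2_norm (\<lambda>t. f t - max (f t) u) \<le> \<epsilon>}"

definition rho_z :: "real \<Rightarrow> (real \<Rightarrow> real) \<Rightarrow> real" where
  "rho_z \<epsilon> f = Sup {\<bar>t - minimizer f\<bar> | t. f t \<le> rho_m \<epsilon> f + minimum f \<and> t \<in> {0..1}}"


section \<open>Brownian motion on the unit interval and the white noise model\<close>

definition brownian_motion :: "'a measure \<Rightarrow> (real \<Rightarrow> 'a \<Rightarrow> real) \<Rightarrow> bool" where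
  "brownian_motion M W \<longleftrightarrow>
     prob_space M \<and>
     (\<forall>t\<in>{0..1}. W t \<in> borel_measurable M) \<and>
     (AE \<omega> in M. W 0 \<omega> = 0) \<and>
     (AE \<omega> in M. continuous_on {0..1} (\<lambda>t. W t \<omega>)) \<and>
     (\<forall>s t. 0 \<le> s \<and> s < t \<and> t \<le> 1 \<longrightarrow>
        distributed M lborel (\<lambda>\<omega>. W t \<omega> - W s \<omega>) (normal_density 0 (sqrt (t - s)))) \<and>
     (\<forall>(n::nat) \<tau>. (\<forall>k\<le>n. \<tau> k \<in> {0..1}) \<and> (\<forall>k<n. \<tau> k \<le> \<tau> (Suc k)) \<longrightarrow>
        prob_space.indep_vars M (\<lambda>_. borel) (\<lambda>k \<omega>. W (\<tau> (Suc k)) \<omega> - W (\<tau> k) \<omega>) {..<n})"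

definition independent_brownian_motions ::
    "'a measure \<Rightarrow> (real \<Rightarrow> 'a \<Rightarrow> real) list \<Rightarrow> bool" where
  "independent_brownian_motions M Ws \<longleftrightarrow>
     (\<forall>W\<in>set Ws. brownian_motion M W) \<and>
     prob_space.indep_vars M (\<lambda>_. \<Pi>\<^sub>M t\<in>{0..1}. borel)
       (\<lambda>k \<omega>. \<lambda>t\<in>{0..1}. (Ws ! k) t \<omega>) {..<length Ws}"

text \<open>The continuous paths on the unit interval, with the sigma-algebra generated by the
  evaluation maps (which is also the Borel sigma-algebra of the uniform topology).\<close>

definition path_space :: "(real \<Rightarrow> real) measure" where
  "path_space = restrict_space (\<Pi>\<^sub>M t\<in>{0..1}. borel) {w. continuous_on {0..1} w}"

text \<open>There is exactly one measure with this property, so the choice is immaterial.\<close>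

definition wiener_measure :: "(real \<Rightarrow> real) measure" where
  "wiener_measure =
     (SOME P. sets P = sets path_space \<and> brownian_motion P (\<lambda>t w. w t))"

text \<open>The path \<open>Y\<close> that solves \<open>dY(t) = f(t) dt + \<epsilon> dW(t)\<close>, \<open>Y(0) = 0\<close>, when \<open>w\<close> is the
  path of \<open>W\<close>.\<close>

definition white_noise :: "real \<Rightarrow> (real \<Rightarrow> real) \<Rightarrow> (real \<Rightarrow> real) \<Rightarrow> real \<Rightarrow> real" where
  "white_noise \<epsilon> f w t = (LINT s:{0..t}|lborel. f s) + \<epsilon> * w t"

text \<open>The law of the observation under drift \<open>f\<close> together with an independent uniform random
  variable, which provides auxiliary randomness.\<close>

definition noise_experiment :: "real \<Rightarrow> (real \<Rightarrow> real) \<Rightarrow> ((real \<Rightarrow> real) \<times> real) measure" where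
  "noise_experiment \<epsilon> f =
     distr wiener_measure path_space (\<lambda>w. \<lambda>t\<in>{0..1}. white_noise \<epsilon> f w t)
       \<Otimes>\<^sub>M uniform_measure lborel {0..1}"


section \<open>Confidence intervals and the benchmark\<close>

text \<open>A random interval is given by its endpoints.  Since measure zero is assigned to
  non-measurable sets, coverage below includes measurability of the coverage event.\<close>

definition confidence_interval ::
    "'a measure \<Rightarrow> real \<Rightarrow> real \<Rightarrow> ('a \<Rightarrow> real) \<Rightarrow> ('a \<Rightarrow> real) \<Rightarrow> bool" where
  "confidence_interval P \<alpha> z lo hi \<longleftrightarrow>
     lo \<in> borel_measurable P \<and> hi \<in> borel_measurable P \<and>
     (\<forall>\<omega>\<in>space P. lo \<omega> \<le> hi \<omega>) \<and>
     measure P {\<omega> \<in> space P. z \<in> {lo \<omega>..hi \<omega>}} \<ge> 1 - \<alpha>"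

definition expected_length :: "'a measure \<Rightarrow> ('a \<Rightarrow> real) \<Rightarrow> ('a \<Rightarrow> real) \<Rightarrow> ennreal" where
  "expected_length P lo hi = (\<integral>\<^sup>+ \<omega>. ennreal (hi \<omega> - lo \<omega>) \<partial>P)"

definition CI_collection ::
    "real \<Rightarrow> real \<Rightarrow> (real \<Rightarrow> real) set \<Rightarrow>
       (((real \<Rightarrow> real) \<times> real \<Rightarrow> real) \<times> ((real \<Rightarrow> real) \<times> real \<Rightarrow> real)) set" where
  "CI_collection \<alpha> \<epsilon> H =
     {(lo, hi). \<forall>h\<in>H. confidence_interval (noise_experiment \<epsilon> h) \<alpha> (minimizer h) lo hi}"

definition benchmark :: "real \<Rightarrow> real \<Rightarrow> (real \<Rightarrow> real) \<Rightarrow> ennreal" where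
  "benchmark \<alpha> \<epsilon> f =
     (SUP g\<in>convex_class. INF (lo, hi)\<in>CI_collection \<alpha> \<epsilon> {f, g}.
        expected_length (noise_experiment \<epsilon> f) lo hi)"


section \<open>The adaptive confidence interval\<close>

text \<open>The paths of \<open>Y\<^sub>l\<close> and \<open>Y\<^sub>s\<close>, given the paths of \<open>Y\<close>, \<open>B\<^sub>1\<close> and \<open>B\<^sub>2\<close>.\<close>

definition split_l ::
    "real \<Rightarrow> (real \<Rightarrow> real) \<Rightarrow> (real \<Rightarrow> real) \<Rightarrow> (real \<Rightarrow> real) \<Rightarrow> real \<Rightarrow> real" where
  "split_l \<epsilon> y b1 b2 t = y t + sqrt 2 / 2 * \<epsilon> * b1 t + sqrt 6 / 2 * \<epsilon> * b2 t"

definition split_s ::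
    "real \<Rightarrow> (real \<Rightarrow> real) \<Rightarrow> (real \<Rightarrow> real) \<Rightarrow> (real \<Rightarrow> real) \<Rightarrow> real \<Rightarrow> real" where
  "split_s \<epsilon> y b1 b2 t = y t + sqrt 2 / 2 * \<epsilon> * b1 t - sqrt 6 / 2 * \<epsilon> * b2 t"

definition mesh :: "nat \<Rightarrow> real" where
  "mesh j = 1 / 2 ^ j"

definition grid :: "nat \<Rightarrow> int \<Rightarrow> real" where
  "grid j i = of_int i * mesh j"

definition increment :: "(real \<Rightarrow> real) \<Rightarrow> nat \<Rightarrow> int \<Rightarrow> ereal" where
  "increment y j i =
     (if i \<in> {1..2 ^ j} then ereal (y (grid j i) - y (grid j (i - 1))) else \<infinity>)"

text \<open>Almost surely there are no ties, so the way \<^const>\<open>arg_min_on\<close> resolves them is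
  immaterial.\<close>

primrec hat_i :: "(real \<Rightarrow> real) \<Rightarrow> nat \<Rightarrow> int" where
  "hat_i yl 0 = 1"
| "hat_i yl (Suc j) =
     arg_min_on (increment yl (Suc j)) {2 * hat_i yl j - 2..2 * hat_i yl j + 1}"

text \<open>Subtraction on \<^typ>\<open>ereal\<close> satisfies \<open>\<infinity> - x = \<infinity>\<close> for every \<open>x\<close>, including \<open>x = \<infinity>\<close>, as
  the procedure requires.\<close>

definition stop_stat :: "(real \<Rightarrow> real) \<Rightarrow> (real \<Rightarrow> real) \<Rightarrow> nat \<Rightarrow> ereal" where
  "stop_stat yl ys j =
     min (increment ys j (hat_i yl j + 6) - increment ys j (hat_i yl j + 5))
         (increment ys j (hat_i yl j - 6) - increment ys j (hat_i yl j - 5))"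

definition noise_sd :: "real \<Rightarrow> nat \<Rightarrow> real" where
  "noise_sd \<epsilon> j = sqrt (6 * mesh j * \<epsilon>\<^sup>2)"

definition hat_j :: "real \<Rightarrow> (real \<Rightarrow> real) \<Rightarrow> (real \<Rightarrow> real) \<Rightarrow> nat" where
  "hat_j \<epsilon> yl ys = (LEAST j. stop_stat yl ys j / ereal (noise_sd \<epsilon> j) \<le> 2)"

definition Phi :: "real \<Rightarrow> real" where
  "Phi = cdf std_normal_distribution"

text \<open>The quotient is positive for \<open>0 < \<alpha> < 1\<close>, so \<^const>\<open>nat\<close> does not truncate.\<close>

definition K :: "real \<Rightarrow> nat" where
  "K \<alpha> = nat \<lceil>ln \<alpha> / ln (Phi (-2))\<rceil>"

definition CI_lower :: "real \<Rightarrow> real \<Rightarrow> (real \<Rightarrow> real) \<Rightarrow> (real \<Rightarrow> real) \<Rightarrow> real" where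
  "CI_lower \<alpha> \<epsilon> yl ys =
     (let j = hat_j \<epsilon> yl ys in grid j (max 0 (hat_i yl j - 12 * 2 ^ K \<alpha> + 1)))"

definition CI_upper :: "real \<Rightarrow> real \<Rightarrow> (real \<Rightarrow> real) \<Rightarrow> (real \<Rightarrow> real) \<Rightarrow> real" where
  "CI_upper \<alpha> \<epsilon> yl ys =
     (let j = hat_j \<epsilon> yl ys in grid j (min (2 ^ j) (hat_i yl j + 12 * 2 ^ K \<alpha> - 2)))"

end

(* Localization, coverage and length are read off the independent increments of Y_l and Y_s: conditionally
   on Y_l, the statistics of Y_s on one side of the selected block are independent over the levels, because
   they live on disjoint blocks. If the localization drifts away from the minimizer by seven blocks, all later
   statistics on the inner side have nonpositive mean, so K further levels without stopping have probability at
   most Phi(-2)^K <= alpha; until then the selected index is within 8 * 2^K of the minimizer's block.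
   At a level whose mesh m exceeds 8 rho_z, the slope of f makes every relevant mean exceed (m / rho_z)^(3/2) / 4
   standard deviations, so Chebyshev's inequality already gives E m_(hat j) <= 17.5 rho_z.
   For the benchmark, f is raised to a tilted line near its minimum; the alternative has its minimizer at distance
   at least rho_z / 40 but is within epsilon / 5 of f in L_2, so no test separates the two laws. *)

theory Submission
  imports Defs
begin

section \<open>Convex functions with a unique minimizer\<close>

text \<open>The split paths are independent because of their weights: per unit time,
  \<open>W + sqrt 2 / 2 * B1\<close> and \<open>sqrt 6 / 2 * B2\<close> both have variance 3/2, and
  sum and difference of independent centred normals of equal variance are independent. Conditioning
  on \<open>Y_l\<close> is carried out without conditional laws: up to a level \<open>J\<close>
  everything is a function of finitely many increments of mesh \<open>2^-J\<close>, the selected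
  indices form one of finitely many paths, and each path is a separate event. Each independence
  argument therefore sees finitely many levels only; a countable sum gives coverage, a limit gives
  almost sure stopping. Coverage holds whether or not a level stops, whereas the length bound needs
  a stop. The factor 17.5 is 8 for levels of mesh at most \<open>8 * rz\<close>, plus 9.5, more than
  the coarse levels require. In the benchmark, likelihood ratios are explicit only for finitely many
  times, so the comparison of the two laws is proved on cylinders, in a form linear in the
  probability under \<open>f\<close>, and then extended to all events. The final constant contains
  400 = 40 * 10: distance \<open>rz / 40\<close>, joint coverage of probability at least
  1/10.\<close>

definition drift :: "(real \<Rightarrow> real) \<Rightarrow> real \<Rightarrow> real" where
  "drift f t = (LINT s:{0..t}|lborel. f s)"

lemma set_integrable_const_interval:
  shows "set_integrable lborel {a<..b} (\<lambda>t :: real. c :: real)" "set_integrable lborel {a..b} (\<lambda>t :: real. c :: real)"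
proof -
  have "set_integrable lborel A (\<lambda>t. c :: real)" if "A \<in> sets borel" "emeasure lborel A < \<infinity>" for A :: "real set"
    using that unfolding set_integrable_def real_scaleR_def
    by (intro integrable_mult_left integrable_real_indicator) auto
  moreover have "emeasure lborel {a<..b} < \<infinity>" "emeasure lborel {a..b} < \<infinity>" for a b :: real
    by (cases "a \<le> b"; simp add: emeasure_lborel_Icc_eq)+
  ultimately show "set_integrable lborel {a<..b} (\<lambda>t :: real. c :: real)" "set_integrable lborel {a..b} (\<lambda>t :: real. c :: real)"
    by (auto simp: less_top)
qed

text \<open>A variance is nonnegative: the integral of \<open>(h t - c)^2\<close> is expanded, with
  \<open>c\<close> the mean value of \<open>h\<close> on the interval. It converts integrated drift
  differences into \<open>L_2\<close> energy.\<close>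

lemma set_integral_Cauchy_Schwarz:
  fixes h :: "real \<Rightarrow> real"
  assumes "a < b" and h: "set_integrable lborel {a<..b} h"
    and h2: "set_integrable lborel {a<..b} (\<lambda>t. (h t)\<^sup>2)"
  shows "(LINT t:{a<..b}|lborel. h t)\<^sup>2 \<le> (b - a) * (LINT t:{a<..b}|lborel. (h t)\<^sup>2)"
proof -
  define I where "I = (LINT t:{a<..b}|lborel. h t)"
  define c where "c = I / (b - a)"
  note k = set_integrable_const_interval
  have i: "(LINT t:{a<..b}|lborel. d) = (b - a) * d" for d :: real
    using \<open>a < b\<close> by (simp add: set_lebesgue_integral_def)
  have hc: "set_integrable lborel {a<..b} (\<lambda>t. 2 * c * h t)" using h by simp
  have "0 \<le> (LINT t:{a<..b}|lborel. (h t - c)\<^sup>2)"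
    by (simp add: set_lebesgue_integral_def)
  also have "\<dots> = (LINT t:{a<..b}|lborel. ((h t)\<^sup>2 - 2 * c * h t) + c\<^sup>2)"
    by (simp add: power2_diff algebra_simps)
  also have "\<dots> = (LINT t:{a<..b}|lborel. (h t)\<^sup>2) - 2 * c * I + (b - a) * c\<^sup>2"
    using h h2 hc k by (subst set_integral_add, simp_all add: set_integral_diff I_def i)
  also have "\<dots> = (LINT t:{a<..b}|lborel. (h t)\<^sup>2) - I\<^sup>2 / (b - a)"
  proof -
    have "2 * c * I = 2 * (I\<^sup>2 / (b - a))" by (simp add: c_def power2_eq_square)
    moreover have "(b - a) * c\<^sup>2 = I\<^sup>2 / (b - a)"
      using \<open>a < b\<close> by (simp add: c_def power_divide power2_eq_square)
    ultimately show ?thesis by simp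
  qed
  finally show ?thesis using \<open>a < b\<close> by (simp add: I_def[symmetric] field_simps)
qed

locale convex_signal =
  fixes f :: "real \<Rightarrow> real"
  assumes in_class: "f \<in> convex_class"
begin

abbreviation "Z \<equiv> minimizer f"
abbreviation "mn \<equiv> minimum f"

lemma convex: "convex_on {0..1} f"
  using in_class by (simp add: convex_class_def)

lemma minimizer_is_arg_min: "is_arg_min f (\<lambda>t. t \<in> {0..1}) Z"
  using in_class unfolding convex_class_def minimizer_def arg_min_on_def arg_min_def
  by (auto intro: someI)

lemma minimizer_ge_0: "0 \<le> Z" and minimizer_le_1: "Z \<le> 1"
  using minimizer_is_arg_min by (auto simp: is_arg_min_def)

lemma minimum_le: "t \<in> {0..1} \<Longrightarrow> mn \<le> f t"
  using minimizer_is_arg_min by (auto simp: is_arg_min_def minimum_def not_less)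

lemma minimum_less:
  assumes "t \<in> {0..1}" "t \<noteq> Z" shows "mn < f t"
proof (rule ccontr)
  assume "\<not> mn < f t"
  then have "f t \<le> f Z" by (simp add: minimum_def)
  then have "is_arg_min f (\<lambda>t. t \<in> {0..1}) t"
    using assms minimizer_is_arg_min by (force simp: is_arg_min_def)
  then show False
    using in_class assms(2) minimizer_is_arg_min by (auto simp: convex_class_def)
qed

text \<open>Convexity is mostly used along segments that start at the minimizer; later proofs choose
  \<open>\<theta>\<close> either to reach a given level or to reach a given point.\<close>

lemma towards_minimizer:
  assumes "y \<in> {0..1}" "0 \<le> \<theta>" "\<theta> \<le> 1"
  shows "f (Z + \<theta> * (y - Z)) \<le> mn + \<theta> * (f y - mn)"
proof -
  have "f ((1 - \<theta>) *\<^sub>R Z + \<theta> *\<^sub>R y) \<le> (1 - \<theta>) * f Z + \<theta> * f y"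
    using convex_onD[OF convex] assms minimizer_ge_0 minimizer_le_1 by auto
  then show ?thesis by (simp add: minimum_def algebra_simps)
qed

lemma towards_minimizer_mem:
  assumes "y \<in> {0..1}" "0 \<le> \<theta>" "\<theta> \<le> 1"
  shows "Z + \<theta> * (y - Z) \<in> {0..1}"
proof -
  have "Z + \<theta> * (y - Z) = (1 - \<theta>) * Z + \<theta> * y" by (simp add: algebra_simps)
  moreover have "0 \<le> (1 - \<theta>) * Z + \<theta> * y"
    using assms minimizer_ge_0 by auto
  moreover have "(1 - \<theta>) * Z + \<theta> * y \<le> 1"
    using assms minimizer_le_1 by (intro convex_bound_le) auto
  ultimately show ?thesis by simp
qed

definition "top_value = max (f 0) (f 1)"

lemma le_top_value:
  assumes "t \<in> {0..1}" shows "f t \<le> top_value"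
proof -
  have "f ((1 - t) *\<^sub>R 0 + t *\<^sub>R 1) \<le> (1 - t) * f 0 + t * f 1"
    using assms by (intro convex_onD[OF convex]) auto
  also have "\<dots> \<le> (1 - t) * top_value + t * top_value"
    using assms by (intro add_mono mult_left_mono) (auto simp: top_value_def)
  finally show ?thesis by (simp add: algebra_simps)
qed

text \<open>A convex function on the closed interval is continuous in the open one but may jump at
  the ends, so the values at 0 and 1 are added as separate indicator terms. Outside the interval
  \<open>f\<close> is arbitrary, hence the cut-off.\<close>

lemma borel_measurable_restrict: "(\<lambda>t. indicator {0..1} t * f t) \<in> borel_measurable borel"
proof -
  have "continuous_on {0<..<1} f"
    by (intro convex_on_continuous convex_on_subset[OF convex]) auto
  then have 1: "(\<lambda>t. indicator {0<..<1} t *\<^sub>R f t) \<in> borel_measurable borel"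
    by (intro borel_measurable_continuous_on_indicator) auto
  have "(\<lambda>t. indicator {0..1} t * f t) =
     (\<lambda>t. indicator {0<..<1} t *\<^sub>R f t + indicator {0} t * f 0 + indicator {1} t * f 1)"
    by (auto simp: indicator_def fun_eq_iff)
  with 1 show ?thesis by simp
qed

text \<open>The two-variable form covers integrands that mix \<open>f\<close> with another function
  of \<open>t\<close>, such as a tilted line. Measurability passes through the cut-off version of
  \<open>f\<close>, which agrees with \<open>f\<close> on \<open>A\<close>.\<close>

lemma set_integrable_bounded_fun:
  fixes g :: "real \<Rightarrow> real \<Rightarrow> real"
  assumes A: "A \<subseteq> {0..1}" "A \<in> sets borel"
    and g: "(\<lambda>(x, y). g x y) \<in> borel_measurable (borel \<Otimes>\<^sub>M borel)"
    and bd: "\<And>t. t \<in> A \<Longrightarrow> \<bar>g t (f t)\<bar> \<le> c"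
  shows "set_integrable lborel A (\<lambda>t. g t (f t))"
proof (rule set_integrable_bound)
  show "set_integrable lborel A (\<lambda>t. c)"
  proof -
    show ?thesis by (rule set_integrable_subset[OF set_integrable_const_interval(2)]) (use A in auto)
  qed
  have [measurable]: "A \<in> sets borel" by fact
  have "(\<lambda>t. (\<lambda>(x, y). g x y) (t, indicator {0..1} t * f t)) \<in> borel_measurable borel"
    using borel_measurable_restrict by (intro measurable_compose[OF _ g] measurable_Pair) auto
  then have "(\<lambda>t. indicator A t *\<^sub>R g t (indicator {0..1} t * f t)) \<in> borel_measurable borel"
    by simp
  also have "(\<lambda>t. indicator A t *\<^sub>R g t (indicator {0..1} t * f t)) = (\<lambda>t. indicator A t *\<^sub>R g t (f t))"
    using A by (auto simp: indicator_def fun_eq_iff)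
  finally show "set_borel_measurable lborel A (\<lambda>t. g t (f t))"
    by (simp add: set_borel_measurable_def)
  show "AE x in lborel. x \<in> A \<longrightarrow> norm (g x (f x)) \<le> norm c"
    using bd by force
qed

lemma abs_le_bound: "t \<in> {0..1} \<Longrightarrow> \<bar>f t\<bar> \<le> \<bar>mn\<bar> + \<bar>top_value\<bar>"
  using minimum_le[of t] le_top_value[of t] by linarith

lemma set_integrable_signal:
  assumes "A \<subseteq> {0..1}" "A \<in> sets borel" shows "set_integrable lborel A f"
proof (rule set_integrable_bounded_fun[where g="\<lambda>x y. y", OF assms])
  show "\<bar>f t\<bar> \<le> \<bar>mn\<bar> + \<bar>top_value\<bar>" if "t \<in> A" for t
    using abs_le_bound that assms by blast
qed measurable

lemma drift_diff:
  assumes "0 \<le> a" "a \<le> b" "b \<le> 1"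
  shows "drift f b - drift f a = (LINT s:{a<..b}|lborel. f s)"
proof -
  have "{0..b} = {0..a} \<union> {a<..b}" "{0..a} \<inter> {a<..b} = {}" using assms by auto
  moreover have "set_integrable lborel {0..a} f" "set_integrable lborel {a<..b} f"
    using assms by (auto intro!: set_integrable_signal)
  ultimately show ?thesis unfolding drift_def by (simp add: set_integral_Un)
qed

lemma drift_shift:
  assumes "a \<le> b" "a + h \<in> {0..1}" "b + h \<in> {0..1}"
  shows "drift f (b + h) - drift f (a + h) = (LINT s:{a<..b}|lborel. f (s + h))"
    and "set_integrable lborel {a<..b} (\<lambda>s. f (s + h))"
proof -
  have eq: "(\<lambda>s. indicator {a + h<..b + h} (h + s) *\<^sub>R f (h + s)) = (\<lambda>s. indicator {a<..b} s *\<^sub>R f (s + h))"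
    by (auto simp: indicator_def fun_eq_iff algebra_simps)
  have "drift f (b + h) - drift f (a + h) = (LINT s|lborel. indicator {a + h<..b + h} s *\<^sub>R f s)"
    using assms by (subst drift_diff) (auto simp: set_lebesgue_integral_def)
  also have "\<dots> = (LINT s|lborel. indicator {a + h<..b + h} (h + s) *\<^sub>R f (h + s))"
    by (subst lborel_integral_real_affine[where c=1 and t=h]) auto
  finally show "drift f (b + h) - drift f (a + h) = (LINT s:{a<..b}|lborel. f (s + h))"
    unfolding set_lebesgue_integral_def eq .
  have "set_integrable lborel {a + h<..b + h} f"
    using assms by (intro set_integrable_signal) auto
  then have "integrable lborel (\<lambda>s. indicator {a + h<..b + h} (h + 1 * s) *\<^sub>R f (h + 1 * s))"
    unfolding set_integrable_def by (intro lborel_integrable_real_affine) auto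
  then show "set_integrable lborel {a<..b} (\<lambda>s. f (s + h))"
    unfolding set_integrable_def mult_1 eq .
qed

text \<open>Translation invariance of Lebesgue measure writes a difference of two block integrals as
  one integral of \<open>f (t + h) - f t\<close>, so a pointwise slope bound suffices.\<close>

lemma drift_second_difference:
  assumes "a \<le> b" "a \<in> {0..1}" "b \<in> {0..1}" "a + h \<in> {0..1}" "b + h \<in> {0..1}"
    and c: "\<And>t. t \<in> {a<..b} \<Longrightarrow> c \<le> f (t + h) - f t"
  shows "c * (b - a) \<le> (drift f (b + h) - drift f (a + h)) - (drift f b - drift f a)"
proof -
  have i: "set_integrable lborel {a<..b} f" "set_integrable lborel {a<..b} (\<lambda>s. f (s + h))"
    using assms drift_shift(2)[of a b h] by (auto intro!: set_integrable_signal)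
  have "c * (b - a) = (LINT s:{a<..b}|lborel. c)"
    using \<open>a \<le> b\<close> by (simp add: set_lebesgue_integral_def)
  also have "\<dots> \<le> (LINT s:{a<..b}|lborel. f (s + h) - f s)"
    using i c by (intro set_integral_mono set_integral_diff set_integrable_const_interval) auto
  also have "\<dots> = (drift f (b + h) - drift f (a + h)) - (drift f b - drift f a)"
    using assms i drift_diff[of a b] drift_shift(1)[of a b h] by (simp add: set_integral_diff)
  finally show ?thesis .
qed

lemma drift_increment_bounds:
  assumes "0 \<le> a" "a \<le> b" "b \<le> 1"
  shows "mn * (b - a) \<le> drift f b - drift f a" "drift f b - drift f a \<le> top_value * (b - a)"
proof -
  have i: "set_integrable lborel {a<..b} f" using assms by (auto intro!: set_integrable_signal)
  have "mn * (b - a) = (LINT s:{a<..b}|lborel. mn)" "top_value * (b - a) = (LINT s:{a<..b}|lborel. top_value)"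
    using assms by (auto simp: set_lebesgue_integral_def)
  moreover have "(LINT s:{a<..b}|lborel. mn) \<le> (LINT s:{a<..b}|lborel. f s)"
    "(LINT s:{a<..b}|lborel. f s) \<le> (LINT s:{a<..b}|lborel. top_value)"
    using i assms by (auto intro!: set_integral_mono minimum_le le_top_value set_integrable_const_interval)
  ultimately show "mn * (b - a) \<le> drift f b - drift f a"
    "drift f b - drift f a \<le> top_value * (b - a)"
    using assms by (auto simp: drift_diff)
qed

text \<open>The squared \<open>L_2\<close> distance between \<open>f\<close> and its truncation at
  level \<open>v\<close>; working with the square turns the constraint in \<open>rho_m\<close> into
  \<open>gap2 u \<le> \<epsilon>^2\<close>.\<close>

definition "gap2 v = (LINT t:{0..1}|lborel. (max 0 (v - f t))\<^sup>2)"

lemma set_integrable_gap2: 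
  assumes "A \<subseteq> {0..1}" "A \<in> sets borel"
  shows "set_integrable lborel A (\<lambda>t. (max 0 (v - f t))\<^sup>2)"
proof (rule set_integrable_bounded_fun[where g="\<lambda>x y. (max 0 (v - y))\<^sup>2" and c="(\<bar>v\<bar> + \<bar>mn\<bar>)\<^sup>2", OF assms])
  fix t assume "t \<in> A"
  then have "mn \<le> f t" using minimum_le assms by auto
  then have "(max 0 (v - f t))\<^sup>2 \<le> (\<bar>v\<bar> + \<bar>mn\<bar>)\<^sup>2" by (intro power_mono) auto
  then show "\<bar>(max 0 (v - f t))\<^sup>2\<bar> \<le> (\<bar>v\<bar> + \<bar>mn\<bar>)\<^sup>2" by simp
qed measurable

lemma L2_norm_truncate: "L2_norm (\<lambda>t. f t - max (f t) v) = sqrt (gap2 v)"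
proof -
  have "(f t - max (f t) v)\<^sup>2 = (max 0 (v - f t))\<^sup>2" for t
    by (auto simp: max_def power2_commute)
  then show ?thesis by (simp add: L2_norm_def gap2_def)
qed

lemma rho_m_set: "0 < \<epsilon> \<Longrightarrow>
  {u - minimum f | u. L2_norm (\<lambda>t. f t - max (f t) u) \<le> \<epsilon>} = {u - mn | u. gap2 u \<le> \<epsilon>\<^sup>2}"
  unfolding L2_norm_truncate by (auto simp: real_le_lsqrt real_sqrt_le_iff intro: sqrt_le_D)

lemma unit_integral_const: "(LINT t:{0..1::real}|lborel. c) = (c::real)"
  by (simp add: set_lebesgue_integral_def)

text \<open>A level more than \<open>\<epsilon>\<close> above all values of \<open>f\<close> differs
  from \<open>f\<close> by more than \<open>\<epsilon>\<close> on the whole interval, which has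
  length one. This bounds the set whose supremum is \<open>rho_m\<close>; an unbounded
  \<open>Sup\<close> would be unspecified.\<close>

lemma gap2_le_imp: 
  assumes "0 < \<epsilon>" "gap2 u \<le> \<epsilon>\<^sup>2" shows "u - mn \<le> top_value + \<epsilon> - mn"
proof (rule ccontr)
  assume "\<not> ?thesis"
  then have u: "\<epsilon> < u - top_value" by simp
  have "\<epsilon>\<^sup>2 < (u - top_value)\<^sup>2" using u assms by (intro power_strict_mono) auto
  also have "\<dots> = (LINT t:{0..1::real}|lborel. (u - top_value)\<^sup>2)" by (simp add: unit_integral_const)
  also have "\<dots> \<le> gap2 u" unfolding gap2_def
  proof (rule set_integral_mono)
    fix t :: real assume "t \<in> {0..1}"
    then show "(u - top_value)\<^sup>2 \<le> (max 0 (u - f t))\<^sup>2"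
      using le_top_value[of t] u assms by (intro power_mono) auto
  qed (auto intro: set_integrable_gap2 set_integrable_const_interval)
  finally show False using assms by simp
qed

lemma rho_m_bdd: "0 < \<epsilon> \<Longrightarrow> bdd_above {u - mn | u. gap2 u \<le> \<epsilon>\<^sup>2}"
  by (rule bdd_aboveI[of _ "top_value + \<epsilon> - mn"]) (use gap2_le_imp in auto)

text \<open>The truncation raises \<open>f\<close> by at most \<open>\<epsilon>\<close> on an
  interval of length one. The set in \<open>rho_m\<close> is therefore nonempty, and
  \<open>rho_m\<close> is at least \<open>\<epsilon>\<close>.\<close>

lemma gap2_above_minimum:
  assumes "0 < \<epsilon>" shows "gap2 (mn + \<epsilon>) \<le> \<epsilon>\<^sup>2"
proof -
  have "gap2 (mn + \<epsilon>) \<le> (LINT t:{0..1::real}|lborel. \<epsilon>\<^sup>2)" unfolding gap2_def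
  proof (rule set_integral_mono)
    fix t :: real assume "t \<in> {0..1}"
    then show "(max 0 (mn + \<epsilon> - f t))\<^sup>2 \<le> \<epsilon>\<^sup>2"
      using minimum_le[of t] assms by (intro power_mono) auto
  qed (auto intro: set_integrable_gap2 set_integrable_const_interval)
  then show ?thesis by (simp add: unit_integral_const)
qed

end

section \<open>The moduli \<open>rho_m\<close> and \<open>rho_z\<close> and the growth of
  \<open>f\<close> away from its minimizer\<close>

locale convex_signal_noise = convex_signal +
  fixes \<epsilon> :: real
  assumes eps: "0 < \<epsilon>"
begin

abbreviation "rm \<equiv> rho_m \<epsilon> f"
abbreviation "rz \<equiv> rho_z \<epsilon> f"

lemma rho_m_eq: "rm = Sup {u - mn | u. gap2 u \<le> \<epsilon>\<^sup>2}"
  unfolding rho_m_def rho_m_set[OF eps] ..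

lemma rho_m_ge: "\<epsilon> \<le> rm"
  unfolding rho_m_eq using gap2_above_minimum[OF eps]
  by (intro cSup_upper rho_m_bdd[OF eps]) force

lemma rho_m_pos: "0 < rm" using rho_m_ge eps by linarith

lemma gap2_greater: "mn + rm < v \<Longrightarrow> \<epsilon>\<^sup>2 < gap2 v"
  using cSup_upper[OF _ rho_m_bdd[OF eps], of "v - mn"] unfolding rho_m_eq by fastforce

text \<open>Attainment of the supremum is avoided: a level of more than half the height is enough
  for the alternative in the benchmark.\<close>

lemma ex_gap2_le: "\<exists>u. rm / 2 < u - mn \<and> gap2 u \<le> \<epsilon>\<^sup>2"
proof -
  have "rm / 2 < Sup {u - mn | u. gap2 u \<le> \<epsilon>\<^sup>2}" using rho_m_pos rho_m_eq by simp
  moreover have "{u - mn | u. gap2 u \<le> \<epsilon>\<^sup>2} \<noteq> {}" using gap2_above_minimum[OF eps] by auto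
  ultimately have "\<exists>x\<in>{u - mn | u. gap2 u \<le> \<epsilon>\<^sup>2}. rm / 2 < x"
    using less_cSup_iff[OF _ rho_m_bdd[OF eps]] by blast
  then obtain x u where "rm / 2 < x" "x = u - mn" "gap2 u \<le> \<epsilon>\<^sup>2" by blast
  then show ?thesis by blast
qed

lemma rho_z_bdd: "bdd_above {\<bar>t - Z\<bar> | t. f t \<le> rm + mn \<and> t \<in> {0..1}}"
  by (rule bdd_aboveI[of _ 1]) (use minimizer_ge_0 minimizer_le_1 in auto)

lemma dist_le_rho_z: "t \<in> {0..1} \<Longrightarrow> f t \<le> mn + rm \<Longrightarrow> \<bar>t - Z\<bar> \<le> rz"
  unfolding rho_z_def by (rule cSup_upper[OF _ rho_z_bdd]) (auto simp: add.commute)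

lemma minimizer_in_level: "Z \<in> {0..1}" "f Z \<le> rm + mn"
  using minimizer_ge_0 minimizer_le_1 rho_m_pos by (auto simp: minimum_def)

lemma rho_z_pos: "0 < rz"
proof -
  \<comment> \<open>An endpoint other than \<open>Z\<close>; shrinking it towards \<open>Z\<close>
    by the factor \<open>\<theta>\<close> below brings \<open>f\<close> down to at most
    \<open>mn + rm\<close>.\<close>
  define y :: real where "y = (if Z = 0 then 1 else 0)"
  have y: "y \<in> {0..1}" "y \<noteq> Z" by (auto simp: y_def)
  then have fy: "mn < f y" using minimum_less by auto
  define \<theta> where "\<theta> = min 1 (rm / (f y - mn))"
  have th: "0 < \<theta>" "\<theta> \<le> 1" using fy rho_m_pos by (auto simp: \<theta>_def)
  have "\<theta> * (f y - mn) \<le> rm / (f y - mn) * (f y - mn)"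
    using fy by (intro mult_right_mono) (auto simp: \<theta>_def)
  then have "f (Z + \<theta> * (y - Z)) \<le> mn + rm"
    using towards_minimizer[of y \<theta>] y th fy by auto
  then have "\<bar>Z + \<theta> * (y - Z) - Z\<bar> \<le> rz"
    using towards_minimizer_mem[of y \<theta>] y th by (intro dist_le_rho_z) auto
  moreover have "0 < \<bar>Z + \<theta> * (y - Z) - Z\<bar>" using th y by auto
  ultimately show ?thesis by linarith
qed

text \<open>Shrinking \<open>y\<close> towards \<open>Z\<close> by \<open>rm / (f y - mn)\<close>
  gives, by convexity, a point of the sublevel set that defines \<open>rz\<close>, so that point is
  within \<open>rz\<close> of \<open>Z\<close>. Beyond \<open>rz\<close>, \<open>f\<close> therefore
  lies above a cone of slope \<open>rm / rz\<close>, with no smoothness assumed.\<close>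

lemma linear_growth:
  assumes "y \<in> {0..1}" "rz < \<bar>y - Z\<bar>"
  shows "rm * \<bar>y - Z\<bar> / rz \<le> f y - mn"
proof -
  have far: "mn + rm < f y" using dist_le_rho_z[of y] assms by force
  define \<theta> where "\<theta> = rm / (f y - mn)"
  have th: "0 \<le> \<theta>" "\<theta> \<le> 1" using far rho_m_pos by (auto simp: \<theta>_def)
  have "f (Z + \<theta> * (y - Z)) \<le> mn + rm"
    using towards_minimizer[of y \<theta>] assms th far rho_m_pos by (auto simp: \<theta>_def)
  then have "\<bar>Z + \<theta> * (y - Z) - Z\<bar> \<le> rz"
    using towards_minimizer_mem[of y \<theta>] assms th by (intro dist_le_rho_z) auto
  then have "\<theta> * \<bar>y - Z\<bar> \<le> rz" using th by (simp add: abs_mult)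
  then have "rm * \<bar>y - Z\<bar> \<le> rz * (f y - mn)"
    using far rho_m_pos by (simp add: \<theta>_def field_simps)
  then show ?thesis using rho_z_pos by (simp add: field_simps)
qed

text \<open>The sublevel set at height \<open>mn + 1.1 rm\<close> has length at most \<open>2.2 rz\<close>; the slack \<open>1.1\<close>
  avoids arguing that the supremum defining \<open>rm\<close> is attained.\<close>

lemma rho_product_ge: "3/8 * \<epsilon>\<^sup>2 \<le> rz * rm\<^sup>2"
proof -
  define r where "r = 11/10 * rz"
  define v where "v = 11/10 * rm"
  have r: "0 < r" using rho_z_pos by (simp add: r_def)
  have "\<epsilon>\<^sup>2 < gap2 (mn + v)" using rho_m_pos by (intro gap2_greater) (simp add: v_def)
  also have "gap2 (mn + v) \<le> (LINT t|lborel. indicator {Z - r..Z + r} t *\<^sub>R v\<^sup>2)"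
    unfolding gap2_def set_lebesgue_integral_def
  proof (rule integral_mono)
    show "integrable lborel (\<lambda>t. indicator {0..1} t *\<^sub>R (max 0 (mn + v - f t))\<^sup>2)"
      using set_integrable_gap2[of "{0..1}" "mn + v"] by (simp add: set_integrable_def)
    show "integrable lborel (\<lambda>t. indicator {Z - r..Z + r} t *\<^sub>R v\<^sup>2)"
      using set_integrable_const_interval(2) by (simp add: set_integrable_def)
    fix t :: real
    show "indicator {0..1} t *\<^sub>R (max 0 (mn + v - f t))\<^sup>2 \<le> indicator {Z - r..Z + r} t *\<^sub>R v\<^sup>2"
    proof (cases "t \<in> {0..1}")
      case True
      show ?thesis
      proof (cases "\<bar>t - Z\<bar> \<le> r")
        case near: True
        have "(max 0 (mn + v - f t))\<^sup>2 \<le> v\<^sup>2"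
          using minimum_le[OF True] rho_m_pos by (intro power_mono) (auto simp: v_def max_def)
        then show ?thesis using True near by (auto simp: indicator_def)
      next
        case False
        \<comment> \<open>Beyond distance \<open>r\<close>, \<open>linear_growth\<close> lifts
          \<open>f\<close> to at least \<open>mn + v\<close>, so the left integrand vanishes
          there.\<close>
        then have "rz < \<bar>t - Z\<bar>" using rho_z_pos by (simp add: r_def)
        then have "rm * \<bar>t - Z\<bar> / rz \<le> f t - mn" using True linear_growth by blast
        moreover have "rm * r / rz \<le> rm * \<bar>t - Z\<bar> / rz"
          using False rho_m_pos rho_z_pos by (intro divide_right_mono mult_left_mono) auto
        moreover have "rm * r / rz = v" using rho_z_pos by (simp add: r_def v_def)
        ultimately show ?thesis by (auto simp: indicator_def)
      qed
    qed auto
  qed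
  also have "\<dots> = 2 * r * v\<^sup>2" using r by simp
  \<comment> \<open>The constant is \<open>2 * (11/10)^3 = 1331/500\<close>; its reciprocal still
    exceeds \<open>3/8\<close>.\<close>
  finally have "\<epsilon>\<^sup>2 < 1331/500 * (rz * rm\<^sup>2)"
    by (simp add: r_def v_def power2_eq_square)
  then show ?thesis using zero_le_power2[of \<epsilon>] by linarith
qed

text \<open>The point \<open>t\<close> lies on the segment from \<open>Z\<close> to
  \<open>t + h\<close>, so convexity gives
  \<open>f (t + h) - f t \<ge> (1 - \<theta>) * (f (t + h) - mn)\<close>;
  \<open>linear_growth\<close> applies at \<open>t + h\<close>, which
  \<open>rz < \<bar>h\<bar>\<close> puts beyond \<open>rz\<close>.\<close>

lemma slope_away:
  assumes "t \<in> {0..1}" "t + h \<in> {0..1}" "rz < \<bar>h\<bar>"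
    and "(Z \<le> t \<and> 0 \<le> h) \<or> (t \<le> Z \<and> h \<le> 0)"
  shows "\<bar>h\<bar> * rm / rz \<le> f (t + h) - f t"
proof -
  define r where "r = \<bar>t + h - Z\<bar>"
  have r: "r = \<bar>t - Z\<bar> + \<bar>h\<bar>" using assms(4) by (auto simp: r_def)
  have r0: "0 < r" using r assms(3) rho_z_pos by linarith
  have gr: "rm * r / rz \<le> f (t + h) - mn"
    using linear_growth[of "t + h"] assms r by (simp add: r_def)
  define \<theta> where "\<theta> = \<bar>t - Z\<bar> / r"
  have th: "0 \<le> \<theta>" "\<theta> \<le> 1" using r r0 by (auto simp: \<theta>_def)
  have "Z + \<theta> * (t + h - Z) = t"
    using assms(4) r0 by (auto simp: \<theta>_def r_def field_simps)
  then have "f t \<le> mn + \<theta> * (f (t + h) - mn)"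
    using towards_minimizer[of "t + h" \<theta>] assms(2) th by simp
  then have "(1 - \<theta>) * (f (t + h) - mn) \<le> f (t + h) - f t" by (simp add: algebra_simps)
  moreover have "(1 - \<theta>) * (rm * r / rz) \<le> (1 - \<theta>) * (f (t + h) - mn)"
    using gr th by (intro mult_left_mono) auto
  moreover have "(1 - \<theta>) * (rm * r / rz) = \<bar>h\<bar> * rm / rz"
  proof -
    have "1 - \<theta> = \<bar>h\<bar> / r" using r r0 by (simp add: \<theta>_def field_simps)
    then show ?thesis using r0 by simp
  qed
  ultimately show ?thesis by linarith
qed

text \<open>The alternative is \<open>f\<close> raised to a slightly tilted line through the graph at a point \<open>t2\<close>
  with \<open>f t2\<close> close to \<open>mn\<close>; the tilt makes \<open>t2\<close> the unique minimizer.\<close>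

lemma ex_alternative:
  "\<exists>g\<in>convex_class. rz / 40 \<le> \<bar>minimizer g - Z\<bar> \<and>
     (LINT t:{0..1}|lborel. (g t - f t)\<^sup>2) \<le> \<epsilon>\<^sup>2 / 25"
proof -
  have "rz / 2 < Sup {\<bar>t - Z\<bar> | t. f t \<le> rm + mn \<and> t \<in> {0..1}}"
    using rho_z_pos by (simp add: rho_z_def)
  then have "\<exists>x\<in>{\<bar>t - Z\<bar> | t. f t \<le> rm + mn \<and> t \<in> {0..1}}. rz / 2 < x"
    using less_cSup_iff[OF _ rho_z_bdd] minimizer_in_level by blast
  then obtain t1 where t1: "rz / 2 < \<bar>t1 - Z\<bar>" "f t1 \<le> rm + mn" "t1 \<in> {0..1}" by blast
  obtain u where u: "rm / 2 < u - mn" "gap2 u \<le> \<epsilon>\<^sup>2" using ex_gap2_le by blast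
  define d where "d = u - mn"
  \<comment> \<open>One twentieth of the way from \<open>Z\<close> to \<open>t1\<close>: far enough
    to keep distance \<open>rz / 40\<close>, near enough that \<open>f t2\<close> exceeds
    \<open>mn\<close> by at most \<open>rm / 20 \<le> d / 10\<close>.\<close>
  define t2 where "t2 = Z + 1/20 * (t1 - Z)"
  define \<sigma> where "\<sigma> = sgn (t1 - Z)"
  \<comment> \<open>The line rises from \<open>t2\<close> towards \<open>Z\<close> and falls on the
    far side, where \<open>f\<close> itself increases. With slope \<open>d / 10\<close> it stays
    below \<open>mn + d / 5\<close> on the unit interval.\<close>
  define l where "l t = f t2 + d / 10 * \<sigma> * (t2 - t)" for t
  define g where "g t = max (f t) (l t)" for t
  have d: "0 < d" using u rho_m_pos by (simp add: d_def)
  have t2: "t2 \<in> {0..1}" unfolding t2_def by (rule towards_minimizer_mem) (use t1 in auto)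
  have dist: "\<bar>t2 - Z\<bar> = \<bar>t1 - Z\<bar> / 20" by (simp add: t2_def)
  have "f t2 \<le> mn + 1/20 * (f t1 - mn)" unfolding t2_def by (rule towards_minimizer) (use t1 in auto)
  then have ft2: "f t2 \<le> mn + d / 10" 
  proof -
    have "f t1 - mn \<le> 2 * d" using t1(2) u(1) by (simp add: d_def)
    then have "1/20 * (f t1 - mn) \<le> 1/20 * (2 * d)" by (intro mult_left_mono) auto
    then have "mn + 1/20 * (f t1 - mn) \<le> mn + d / 10" by simp
    with \<open>f t2 \<le> _\<close> show ?thesis by (rule order_trans)
  qed
  have \<sigma>: "\<sigma> = 1 \<or> \<sigma> = -1" using t1 rho_z_pos by (auto simp: \<sigma>_def sgn_if)
  have lle: "l t \<le> mn + d / 5" if "t \<in> {0..1}" for t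
  proof -
    have "\<sigma> * (t2 - t) \<le> 1" using \<sigma> t2 that by auto
    then have "d / 10 * (\<sigma> * (t2 - t)) \<le> d / 10 * 1" using d by (intro mult_left_mono) auto
    then show ?thesis using ft2 by (simp add: l_def)
  qed
  have cg: "convex_on {0..1} g"
  proof (rule convex_onI)
    fix t x y :: real assume t: "0 < t" "t < 1" and xy: "x \<in> {0..1}" "y \<in> {0..1}"
    have "f ((1 - t) *\<^sub>R x + t *\<^sub>R y) \<le> (1 - t) * f x + t * f y"
      using convex_onD[OF convex] t xy by auto
    also have "\<dots> \<le> (1 - t) * g x + t * g y"
      using t by (intro add_mono mult_left_mono) (auto simp: g_def)
    finally have 1: "f ((1 - t) *\<^sub>R x + t *\<^sub>R y) \<le> (1 - t) * g x + t * g y" .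
    have "l ((1 - t) *\<^sub>R x + t *\<^sub>R y) = (1 - t) * l x + t * l y"
      by (simp add: l_def field_simps)
    also have "\<dots> \<le> (1 - t) * g x + t * g y"
      using t by (intro add_mono mult_left_mono) (auto simp: g_def)
    finally show "g ((1 - t) *\<^sub>R x + t *\<^sub>R y) \<le> (1 - t) * g x + t * g y"
      using 1 by (simp add: g_def)
  qed simp
  have gt2: "g t2 = f t2" by (simp add: g_def l_def)
  have larger: "f t2 < g t" if t: "t \<in> {0..1}" "t \<noteq> t2" for t
  proof (cases "0 < \<sigma> * (t2 - t)")
    case True
    then have "0 < d / 10 * (\<sigma> * (t2 - t))" using d by simp
    then show ?thesis by (simp add: g_def l_def)
  next
    case False
    \<comment> \<open>Here \<open>t2\<close> lies strictly between \<open>Z\<close> and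
      \<open>t\<close>, and \<open>\<theta> < 1\<close> is its relative position; uniqueness of the
      minimizer makes the last inequality strict.\<close>
    define \<theta> where "\<theta> = (t2 - Z) / (t - Z)"
    have th: "0 \<le> \<theta>" "\<theta> < 1" "t \<noteq> Z"
      using False \<sigma> t dist t1 rho_z_pos unfolding \<theta>_def \<sigma>_def t2_def
      by (auto simp: sgn_if field_simps split: if_splits)
    then have "Z + \<theta> * (t - Z) = t2" by (simp add: \<theta>_def)
    then have "f t2 \<le> mn + \<theta> * (f t - mn)"
      using towards_minimizer[of t \<theta>] th t by simp
    also have "\<dots> < mn + 1 * (f t - mn)"
      using th minimum_less[OF t(1)] by (intro add_strict_left_mono mult_strict_right_mono) auto
    finally show ?thesis by (simp add: g_def)
  qed
  have amin: "is_arg_min g (\<lambda>t. t \<in> {0..1}) z \<longleftrightarrow> z = t2" for z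
    using larger t2 gt2 by (force simp: is_arg_min_def)
  then have "\<exists>!z. is_arg_min g (\<lambda>t. t \<in> {0..1}) z" by metis
  then have gc: "g \<in> convex_class" using cg by (simp add: convex_class_def)
  have "minimizer g = t2"
    unfolding minimizer_def arg_min_on_def arg_min_def amin by simp
  moreover have "(LINT t:{0..1}|lborel. (g t - f t)\<^sup>2) \<le> \<epsilon>\<^sup>2 / 25"
  proof -
    have "(LINT t:{0..1}|lborel. (g t - f t)\<^sup>2) \<le> (LINT t:{0..1}|lborel. 1/25 * (max 0 (u - f t))\<^sup>2)"
    proof (rule set_integral_mono)
      fix t :: real assume t: "t \<in> {0..1}"
      \<comment> \<open>With \<open>x = f t - mn \<ge> 0\<close>, the raise is positive only if it
        is at most \<open>d / 5 - x \<le> (d - x) / 5\<close>: a fifth of the truncation gap, hence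
        a factor 1/25 after squaring.\<close>
      have "(g t - f t)\<^sup>2 \<le> (1/5 * max 0 (u - f t))\<^sup>2"
        using lle[OF t] minimum_le[OF t] d
        by (intro power_mono) (auto simp: g_def d_def max_def field_simps)
      then show "(g t - f t)\<^sup>2 \<le> 1/25 * (max 0 (u - f t))\<^sup>2" by (simp add: power_mult_distrib power_divide)
      next
      show "set_integrable lborel {0..1} (\<lambda>t. (g t - f t)\<^sup>2)"
      proof (rule set_integrable_bounded_fun[where g="\<lambda>x y. (max y (l x) - y)\<^sup>2" and c="(d/5)\<^sup>2", folded g_def])
        fix t :: real assume t: "t \<in> {0..1}"
        have "(g t - f t)\<^sup>2 \<le> (d/5)\<^sup>2"
          using lle[OF t] minimum_le[OF t] d by (intro power_mono) (auto simp: g_def)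
        then show "\<bar>(g t - f t)\<^sup>2\<bar> \<le> (d/5)\<^sup>2" by simp
      qed (auto simp: l_def)
    qed (use set_integrable_gap2 in auto)
    also have "\<dots> = 1/25 * gap2 u" by (simp only: set_integral_mult_right gap2_def)
    finally show ?thesis using u by simp
  qed
  ultimately show ?thesis using gc dist t1 by (intro bexI[of _ g]) auto
qed

end

text \<open>Cauchy--Schwarz on one increment. Divided by \<open>\<epsilon>^2\<close>, the left side
  is the squared shift of a Gaussian increment over its variance, and the right side adds up over
  adjacent intervals.\<close>

lemma drift_difference_energy:
  assumes "f \<in> convex_class" "g \<in> convex_class" "0 \<le> a" "a < b" "b \<le> 1"
  shows "((drift g b - drift g a) - (drift f b - drift f a))\<^sup>2 / (b - a)
      \<le> (LINT t:{a<..b}|lborel. (g t - f t)\<^sup>2)"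
    and "set_integrable lborel {0..1} (\<lambda>t. (g t - f t)\<^sup>2)"
proof -
  interpret f: convex_signal f by standard fact
  interpret g: convex_signal g by standard fact
  have fg: "set_integrable lborel A (\<lambda>t. (g t - f t)\<^sup>2)" if A: "A \<subseteq> {0..1}" "A \<in> sets borel" for A
  proof -
    define c where "c = (\<bar>g.mn\<bar> + \<bar>g.top_value\<bar> + \<bar>f.mn\<bar> + \<bar>f.top_value\<bar>)\<^sup>2"
    \<comment> \<open>\<open>f\<close> is known to be measurable only after the cut-off to the unit
      interval, so the cut-off version stands in until the integrands are compared on
      \<open>A\<close>.\<close>
    have "set_integrable lborel A (\<lambda>t. (g t - indicator {0..1} t * f t)\<^sup>2)"
    proof (rule g.set_integrable_bounded_fun[where g="\<lambda>x y. (y - indicator {0..1} x * f x)\<^sup>2" and c=c, OF A])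
      note [measurable] = f.borel_measurable_restrict
      show "(\<lambda>(x, y). (y - indicator {0..1} x * f x)\<^sup>2) \<in> borel_measurable (borel \<Otimes>\<^sub>M borel)"
        by measurable
      fix t assume "t \<in> A"
      then have "t \<in> {0..1}" using A by auto
      then have "\<bar>g t - f t\<bar> \<le> \<bar>g.mn\<bar> + \<bar>g.top_value\<bar> + \<bar>f.mn\<bar> + \<bar>f.top_value\<bar>"
        using f.abs_le_bound[of t] g.abs_le_bound[of t] by linarith
      then have "\<bar>g t - f t\<bar>\<^sup>2 \<le> c" unfolding c_def by (intro power_mono) auto
      then show "\<bar>(g t - indicator {0..1} t * f t)\<^sup>2\<bar> \<le> c" using \<open>t \<in> {0..1}\<close> by simp
    qed
    moreover have "indicator A t *\<^sub>R (g t - indicator {0..1} t * f t)\<^sup>2 = indicator A t *\<^sub>R (g t - f t)\<^sup>2" for t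
      using A by (auto simp: indicator_def)
    ultimately show ?thesis by (simp only: set_integrable_def)
  qed
  then show "set_integrable lborel {0..1} (\<lambda>t. (g t - f t)\<^sup>2)" by simp
  have i: "set_integrable lborel {a<..b} f" "set_integrable lborel {a<..b} g"
    using assms by (auto intro!: f.set_integrable_signal g.set_integrable_signal)
  have "(drift g b - drift g a) - (drift f b - drift f a) = (LINT t:{a<..b}|lborel. g t - f t)"
    using assms i by (simp add: f.drift_diff g.drift_diff set_integral_diff)
  moreover have "(LINT t:{a<..b}|lborel. g t - f t)\<^sup>2 \<le> (b - a) * (LINT t:{a<..b}|lborel. (g t - f t)\<^sup>2)"
    using assms i by (intro set_integral_Cauchy_Schwarz set_integral_diff fg) auto
  ultimately show "((drift g b - drift g a) - (drift f b - drift f a))\<^sup>2 / (b - a)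
      \<le> (LINT t:{a<..b}|lborel. (g t - f t)\<^sup>2)"
    using assms by (simp add: divide_le_eq mult.commute)
qed

section \<open>Localization and stopping on a fixed path\<close>

lemma arg_min_on_mem:
  fixes f :: "'a \<Rightarrow> 'b :: linorder"
  assumes "finite S" "S \<noteq> {}"
  shows "arg_min_on f S \<in> S" "k \<in> S \<Longrightarrow> f (arg_min_on f S) \<le> f k"
  using arg_min_if_finite[OF assms, of f] by (auto simp: not_less)

lemma hat_i_candidate: "hat_i y (Suc j) \<in> {2 * hat_i y j - 2..2 * hat_i y j + 1}"
  unfolding hat_i.simps by (rule arg_min_on_mem) auto

lemma hat_i_minimal:
  "k \<in> {2 * hat_i y j - 2..2 * hat_i y j + 1} \<Longrightarrow>
    increment y (Suc j) (hat_i y (Suc j)) \<le> increment y (Suc j) k"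
  unfolding hat_i.simps by (rule arg_min_on_mem) auto

text \<open>The candidate \<open>2 * hat_i y j - 1\<close> is always a genuine block, so its finite
  increment beats the infinite ones outside the range.\<close>

lemma hat_i_range: "hat_i y j \<in> {1..2 ^ j}"
proof (induction j)
  case (Suc j)
  have "increment y (Suc j) (hat_i y (Suc j)) \<le> increment y (Suc j) (2 * hat_i y j - 1)"
    by (rule hat_i_minimal) auto
  moreover have "2 * hat_i y j - 1 \<in> {1..2 ^ Suc j}" using Suc by auto
  ultimately show ?case by (auto simp: increment_def simp del: hat_i.simps split: if_splits)
qed auto

text \<open>Lets the observed path be replaced by one rebuilt from finitely many increments without
  changing the selected indices.\<close>

lemma hat_i_cong:
  assumes "\<And>j i. j \<le> J \<Longrightarrow> increment y j i = increment y' j i" "j \<le> J"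
  shows "hat_i y j = hat_i y' j"
  using assms(2)
proof (induction j)
  case (Suc j)
  then have "increment y (Suc j) = increment y' (Suc j)" using assms(1) by blast
  with Suc show ?case by simp
qed simp

lemma grid_mem: "i \<in> {0..2 ^ j} \<Longrightarrow> grid j i \<in> {0..1}"
  by (simp add: grid_def mesh_def divide_le_eq)

lemma grid_mono: "i \<le> k \<Longrightarrow> grid j i \<le> grid j k"
  by (simp add: grid_def mesh_def divide_right_mono)

lemma mesh_pos: "0 < mesh j"
  by (simp add: mesh_def)

lemma grid_diff: "grid j i - grid j k = of_int (i - k) * mesh j"
  by (simp add: grid_def algebra_simps)

text \<open>\<open>s\<close> is 1 for the right and -1 for the left neighbourhood;
  \<open>stop_stat\<close> is the minimum over the two sides.\<close>

definition side_stat :: "(real \<Rightarrow> real) \<Rightarrow> nat \<Rightarrow> int \<Rightarrow> int \<Rightarrow> ereal" where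
  "side_stat y j i s = increment y j (i + 6 * s) - increment y j (i + 5 * s)"

definition continues :: "real \<Rightarrow> (real \<Rightarrow> real) \<Rightarrow> (real \<Rightarrow> real) \<Rightarrow> nat \<Rightarrow> bool" where
  "continues \<epsilon> yl ys j \<longleftrightarrow> \<not> stop_stat yl ys j / ereal (noise_sd \<epsilon> j) \<le> 2"

definition exceeds :: "real \<Rightarrow> (real \<Rightarrow> real) \<Rightarrow> nat \<Rightarrow> int \<Rightarrow> int \<Rightarrow> bool" where
  "exceeds \<epsilon> y j i s \<longleftrightarrow> ereal (2 * noise_sd \<epsilon> j) < side_stat y j i s"

lemma noise_sd_pos: "0 < \<epsilon> \<Longrightarrow> 0 < noise_sd \<epsilon> j"
  by (simp add: noise_sd_def mesh_pos)

text \<open>Dividing by a positive real preserves the order also at \<open>\<infinity>\<close>, and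
  a minimum exceeds a bound exactly if both entries do. Exceedance on either side alone is thus
  necessary for continuing, which lets the later bounds follow a single side.\<close>

lemma continues_iff:
  assumes "0 < \<epsilon>"
  shows "continues \<epsilon> yl ys j \<longleftrightarrow>
     exceeds \<epsilon> ys j (hat_i yl j) 1 \<and> exceeds \<epsilon> ys j (hat_i yl j) (-1)"
proof -
  have "x / ereal (noise_sd \<epsilon> j) \<le> 2 \<longleftrightarrow> x \<le> ereal (2 * noise_sd \<epsilon> j)" for x
    using noise_sd_pos[OF assms, of j] by (cases x) (auto simp: field_simps)
  then show ?thesis
    by (auto simp: continues_def exceeds_def stop_stat_def side_stat_def not_le min_less_iff_conj)
qed

text \<open>True even if no level stops and \<open>LEAST\<close> is unspecified, so coverage needs
  no almost sure stopping.\<close>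

lemma before_hat_j_continues: "j < hat_j \<epsilon> yl ys \<Longrightarrow> continues \<epsilon> yl ys j"
  unfolding hat_j_def continues_def by (rule not_less_Least)

lemma hat_j_stops: "\<not> continues \<epsilon> yl ys k \<Longrightarrow> \<not> continues \<epsilon> yl ys (hat_j \<epsilon> yl ys)"
  unfolding hat_j_def continues_def by (rule LeastI2) auto

lemma CI_lower_le_upper: "CI_lower \<alpha> \<epsilon> yl ys \<le> CI_upper \<alpha> \<epsilon> yl ys"
proof -
  define j where "j = hat_j \<epsilon> yl ys"
  define q :: int where "q = 2 ^ K \<alpha>"
  have p: "1 \<le> q" by (simp add: q_def)
  show ?thesis using hat_i_range[of yl j] p
    unfolding CI_lower_def CI_upper_def Let_def j_def[symmetric] q_def[symmetric] by (intro grid_mono) auto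
qed

text \<open>The number of meshes is
  \<open>(12 * 2 ^ K \<alpha> - 2) - (1 - 12 * 2 ^ K \<alpha>)\<close>; clipping to the unit
  interval only shortens.\<close>

lemma CI_length:
  "CI_upper \<alpha> \<epsilon> yl ys - CI_lower \<alpha> \<epsilon> yl ys \<le> (24 * 2 ^ K \<alpha> - 3) * mesh (hat_j \<epsilon> yl ys)"
proof -
  define j where "j = hat_j \<epsilon> yl ys"
  have "real_of_int (min (2 ^ j) (hat_i yl j + 12 * 2 ^ K \<alpha> - 2)
       - max 0 (hat_i yl j - 12 * 2 ^ K \<alpha> + 1)) \<le> real_of_int (24 * 2 ^ K \<alpha> - 3)"
    unfolding of_int_le_iff by auto
  then show ?thesis
    unfolding CI_lower_def CI_upper_def Let_def j_def[symmetric] grid_diff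
    by (intro mult_right_mono) (use mesh_pos[of j] in auto)
qed

text \<open>In units of the mesh, the one-based index of the half-open block
  \<open>(i - 1, i]\<close> containing \<open>z\<close>; \<open>max 1\<close> assigns
  \<open>z = 0\<close> to the first block.\<close>

definition block :: "real \<Rightarrow> nat \<Rightarrow> int" where
  "block z j = max 1 \<lceil>z * 2 ^ j\<rceil>"

lemma block_range: "0 \<le> z \<Longrightarrow> z \<le> 1 \<Longrightarrow> block z j \<in> {1..2 ^ j}"
  by (auto simp: block_def ceiling_le_iff)

lemma block_contains: 
  assumes "0 \<le> z" "z \<le> 1" shows "grid j (block z j - 1) \<le> z" "z \<le> grid j (block z j)"
proof -
  have c: "real_of_int \<lceil>z * 2 ^ j\<rceil> - 1 < z * 2 ^ j" "z * 2 ^ j \<le> real_of_int \<lceil>z * 2 ^ j\<rceil>" by linarith+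
  have "real_of_int (block z j - 1) \<le> z * 2 ^ j" "z * 2 ^ j \<le> real_of_int (block z j)"
    using c assms by (auto simp: block_def max_def)
  then show "grid j (block z j - 1) \<le> z" "z \<le> grid j (block z j)"
    by (simp_all add: grid_def mesh_def divide_le_eq le_divide_eq)
qed

lemma block_Suc: 
  assumes "0 \<le> z" shows "block z (Suc j) \<in> {2 * block z j - 1, 2 * block z j}"
proof (cases "z = 0")
  case False
  then have z: "0 < z * 2 ^ j" using assms by simp
  then have "0 < \<lceil>z * 2 ^ j\<rceil>" "0 < \<lceil>2 * (z * 2 ^ j)\<rceil>" by linarith+
  moreover have "\<lceil>2 * (z * 2 ^ j)\<rceil> = 2 * \<lceil>z * 2 ^ j\<rceil> - 1 \<or> \<lceil>2 * (z * 2 ^ j)\<rceil> = 2 * \<lceil>z * 2 ^ j\<rceil>"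
    by linarith
  ultimately show ?thesis by (auto simp: block_def max_def mult.assoc mult.left_commute)
qed (auto simp: block_def)

lemma block_0: "0 \<le> z \<Longrightarrow> z \<le> 1 \<Longrightarrow> block z 0 = 1"
  using block_range[of z 0] by simp

definition offset :: "real \<Rightarrow> (real \<Rightarrow> real) \<Rightarrow> nat \<Rightarrow> int" where
  "offset z y j = hat_i y j - block z j"

lemma offset_Suc:
  assumes "0 \<le> z"
  shows "offset z y (Suc j) \<in> {2 * offset z y j - 2..2 * offset z y j + 2}"
  using hat_i_candidate[of y j] block_Suc[OF assms, of j] by (auto simp: offset_def simp del: hat_i.simps)

lemma offset_0: "0 \<le> z \<Longrightarrow> z \<le> 1 \<Longrightarrow> offset z y 0 = 0"
  by (simp add: offset_def block_0)

text \<open>By \<open>offset_Suc\<close>, the absolute offset plus 2 at most doubles per level, and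
  it starts at no more than \<open>6 + 2 = 8\<close>.\<close>

lemma offset_growth:
  assumes "0 \<le> z" "\<bar>offset z y n\<bar> \<le> 6"
  shows "\<bar>offset z y (n + k)\<bar> \<le> 8 * 2 ^ k - 2"
proof (induction k)
  case (Suc k) then show ?case using offset_Suc[OF assms(1), of y "n + k"] by auto
qed (use assms in simp)

lemma CI_contains:
  assumes z: "0 \<le> z" "z \<le> 1" and "\<bar>offset z yl (hat_j \<epsilon> yl ys)\<bar> \<le> 8 * 2 ^ K \<alpha> - 2"
  shows "z \<in> {CI_lower \<alpha> \<epsilon> yl ys..CI_upper \<alpha> \<epsilon> yl ys}"
proof -
  define j where "j = hat_j \<epsilon> yl ys"
  define q :: int where "q = 2 ^ K \<alpha>"
  have p: "1 \<le> q" by (simp add: q_def)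
  have o: "\<bar>offset z yl j\<bar> \<le> 8 * q - 2" using assms by (simp add: j_def q_def)
  have "grid j (max 0 (hat_i yl j - 12 * q + 1)) \<le> grid j (block z j - 1)"
    using block_range[OF z, of j] o p by (intro grid_mono) (auto simp: offset_def)
  moreover have "grid j (block z j) \<le> grid j (min (2 ^ j) (hat_i yl j + 12 * q - 2))"
    using block_range[OF z, of j] o p by (intro grid_mono) (auto simp: offset_def)
  ultimately show ?thesis using block_contains[OF z, of j]
    unfolding CI_lower_def CI_upper_def Let_def j_def[symmetric] q_def[symmetric] by auto
qed

text \<open>Seven is the smallest offset for which the blocks five and six steps inward still lie
  strictly beyond the minimizer's block. At most one \<open>n\<close> qualifies on a given path, so
  the probabilities over all \<open>n\<close> sum to at most one.\<close>

definition first_off :: "real \<Rightarrow> (real \<Rightarrow> real) \<Rightarrow> nat \<Rightarrow> bool" where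
  "first_off z y n \<longleftrightarrow> 7 \<le> \<bar>offset z y n\<bar> \<and> (\<forall>m<n. \<bar>offset z y m\<bar> \<le> 6)"

text \<open>The interval misses \<open>z\<close> only if the offset at \<open>hat_j\<close> exceeds
  \<open>8 * 2 ^ K \<alpha> - 2\<close>. By \<open>offset_growth\<close> this takes more than
  \<open>K \<alpha>\<close> levels after the last one preceding the excursion, and no level before
  \<open>hat_j\<close> stops.\<close>

lemma not_covered:
  assumes z: "0 \<le> z" "z \<le> 1" and "z \<notin> {CI_lower \<alpha> \<epsilon> yl ys..CI_upper \<alpha> \<epsilon> yl ys}"
  shows "\<exists>n. first_off z yl n \<and> (\<forall>j\<in>{n..<n + K \<alpha>}. continues \<epsilon> yl ys j)"
proof -
  define J where "J = hat_j \<epsilon> yl ys"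
  have J: "8 * 2 ^ K \<alpha> - 2 < \<bar>offset z yl J\<bar>"
    using CI_contains[OF z] assms(3) unfolding J_def by force
  have "(1::int) \<le> 2 ^ K \<alpha>" by simp
  then have "7 \<le> \<bar>offset z yl J\<bar>" using J by linarith
  define n where "n = (LEAST n. 7 \<le> \<bar>offset z yl n\<bar>)"
  have n: "7 \<le> \<bar>offset z yl n\<bar>" unfolding n_def by (rule LeastI) fact
  have "\<bar>offset z yl m\<bar> \<le> 6" if "m < n" for m
    using not_less_Least[of m "\<lambda>n. 7 \<le> \<bar>offset z yl n\<bar>"] that by (simp add: n_def)
  with n have fo: "first_off z yl n" by (auto simp: first_off_def)
  have "n \<noteq> 0" using n offset_0[OF z, of yl] by (cases n) auto
  then obtain m where m: "n = Suc m" by (cases n) auto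
  have "n + K \<alpha> \<le> J"
  proof (rule ccontr)
    assume "\<not> n + K \<alpha> \<le> J"
    have "n \<le> J" unfolding n_def by (rule Least_le) fact
    \<comment> \<open>Growth is counted from \<open>m = n - 1\<close>, where the offset is still at
      most 6; this makes a full \<open>K \<alpha>\<close> continuing levels available from
      \<open>n\<close> on.\<close>
    define k where "k = J - m"
    have k: "J = m + k" "k \<le> K \<alpha>"
      using \<open>\<not> n + K \<alpha> \<le> J\<close> \<open>n \<le> J\<close> m by (auto simp: k_def)
    have "\<bar>offset z yl (m + k)\<bar> \<le> 8 * 2 ^ k - 2"
      using fo m by (intro offset_growth z) (auto simp: first_off_def)
    also have "(8 * 2 ^ k - 2 :: int) \<le> 8 * 2 ^ K \<alpha> - 2" using k by simp
    finally show False using J k by simp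
  qed
  then show ?thesis using fo before_hat_j_continues[of _ \<epsilon> yl ys] by (auto simp: J_def)
qed

section \<open>Measurability of the procedure\<close>

lemma measurable_increment:
  assumes "\<And>t. t \<in> {0..1} \<Longrightarrow> (\<lambda>x. y x t) \<in> borel_measurable N"
  shows "(\<lambda>x. increment (y x) j i) \<in> borel_measurable N"
proof (cases "i \<in> {1..2 ^ j}")
  case True
  then have "grid j i \<in> {0..1}" "grid j (i - 1) \<in> {0..1}" by (intro grid_mem; simp)+
  then have [measurable]: "(\<lambda>x. y x (grid j i)) \<in> borel_measurable N" "(\<lambda>x. y x (grid j (i - 1))) \<in> borel_measurable N"
    using assms by blast+
  show ?thesis using True by (simp add: increment_def)
next
  case False
  then have "(\<lambda>x. increment (y x) j i) = (\<lambda>x. \<infinity>)" by (auto simp: increment_def fun_eq_iff)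
  then show ?thesis by simp
qed

text \<open>However \<open>SOME\<close> breaks ties, the result is a function of the set
  \<open>A x\<close> of all minimizers, and that set takes only finitely many values, each on a
  measurable event.\<close>

lemma measurable_arg_min_on:
  fixes g :: "'a \<Rightarrow> int \<Rightarrow> ereal"
  assumes "finite S" and g: "\<And>i. i \<in> S \<Longrightarrow> (\<lambda>x. g x i) \<in> borel_measurable N"
  shows "(\<lambda>x. arg_min_on (g x) S) \<in> measurable N (count_space UNIV)"
proof -
  define A where "A x = {i\<in>S. \<forall>k\<in>S. \<not> g x k < g x i}" for x
  have am: "arg_min_on (g x) S = (SOME i. i \<in> A x)" for x
    unfolding arg_min_on_def arg_min_def is_arg_min_def A_def by (intro arg_cong[where f=Eps]) auto
  have lt: "{x\<in>space N. \<not> g x k < g x i} \<in> sets N" if "k \<in> S" "i \<in> S" for k i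
  proof -
    note [measurable] = g[OF that(1)] g[OF that(2)]
    show ?thesis by measurable
  qed
  have mem: "{x\<in>space N. i \<in> A x} \<in> sets N" if "i \<in> S" for i
  proof -
    have "{x\<in>space N. i \<in> A x} = (\<Inter>k\<in>S. {x\<in>space N. \<not> g x k < g x i})"
      using that by (auto simp: A_def)
    then show ?thesis using lt that assms(1) by (auto intro!: sets.finite_INT)
  qed
  have "{x\<in>space N. A x = B} \<in> sets N" if "B \<subseteq> S" for B
  proof (cases "S = {}")
    case True then show ?thesis using that by (simp add: A_def)
  next
    case False
    have "{x\<in>space N. A x = B} = (\<Inter>i\<in>S. {x\<in>space N. i \<in> A x \<longleftrightarrow> i \<in> B})"
      using that False by (auto simp: A_def)
    moreover have "{x\<in>space N. i \<in> A x \<longleftrightarrow> i \<in> B} \<in> sets N" if "i \<in> S" for i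
      using mem[OF that] by (cases "i \<in> B") auto
    ultimately show ?thesis using assms(1) False by (auto intro!: sets.finite_INT)
  qed
  then have "(\<Union>B\<in>{B\<in>Pow S. (SOME i. i \<in> B) = v}. {x\<in>space N. A x = B}) \<in> sets N" for v
    using assms(1) by (intro sets.finite_UN) auto
  moreover have "(\<Union>B\<in>{B\<in>Pow S. (SOME i. i \<in> B) = v}. {x\<in>space N. A x = B})
      = (\<lambda>x. arg_min_on (g x) S) -` {v} \<inter> space N" for v
    by (auto simp: am) (auto simp: A_def)
  ultimately show ?thesis
    by (subst measurable_count_space_eq2_countable) auto
qed

lemma measurable_hat_i:
  assumes "\<And>t. t \<in> {0..1} \<Longrightarrow> (\<lambda>x. y x t) \<in> borel_measurable N"
  shows "(\<lambda>x. hat_i (y x) j) \<in> measurable N (count_space UNIV)"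
proof (induction j)
  case (Suc j)
  have "(\<lambda>x. arg_min_on (increment (y x) (Suc j)) {2 * h - 2..2 * h + 1}) \<in> measurable N (count_space UNIV)" for h
    by (intro measurable_arg_min_on measurable_increment assms) auto
  from measurable_compose_countable[OF this Suc] show ?case by simp
qed simp

lemma measurable_side_stat:
  assumes "\<And>t. t \<in> {0..1} \<Longrightarrow> (\<lambda>x. y x t) \<in> borel_measurable N"
    and h: "h \<in> measurable N (count_space UNIV)"
  shows "(\<lambda>x. side_stat (y x) j (h x) s) \<in> borel_measurable N"
  unfolding side_stat_def
  by (rule measurable_compose_countable[OF _ h])
     (intro borel_measurable_ereal_diff measurable_increment assms)

lemma pred_exceeds:
  assumes "\<And>t. t \<in> {0..1} \<Longrightarrow> (\<lambda>x. y x t) \<in> borel_measurable N"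
    and h: "h \<in> measurable N (count_space UNIV)"
  shows "Measurable.pred N (\<lambda>x. exceeds \<epsilon> (y x) j (h x) s)"
proof -
  note [measurable] = measurable_side_stat[OF assms]
  show ?thesis unfolding exceeds_def by measurable
qed

lemma pred_continues:
  assumes "0 < \<epsilon>" "\<And>t. t \<in> {0..1} \<Longrightarrow> (\<lambda>x. yl x t) \<in> borel_measurable N"
    and "\<And>t. t \<in> {0..1} \<Longrightarrow> (\<lambda>x. ys x t) \<in> borel_measurable N"
  shows "Measurable.pred N (\<lambda>x. continues \<epsilon> (yl x) (ys x) j)"
  unfolding continues_iff[OF assms(1)]
  by (intro pred_intros_logic pred_exceeds measurable_hat_i assms)

lemma measurable_hat_j:
  assumes "0 < \<epsilon>" "\<And>t. t \<in> {0..1} \<Longrightarrow> (\<lambda>x. yl x t) \<in> borel_measurable N"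
    and "\<And>t. t \<in> {0..1} \<Longrightarrow> (\<lambda>x. ys x t) \<in> borel_measurable N"
  shows "(\<lambda>x. hat_j \<epsilon> (yl x) (ys x)) \<in> measurable N (count_space UNIV)"
proof -
  have eq: "hat_j \<epsilon> (yl x) (ys x) = (LEAST j. \<not> continues \<epsilon> (yl x) (ys x) j)" for x
    by (simp add: hat_j_def continues_def)
  show ?thesis unfolding eq
    by (intro measurable_Least pred_intros_logic pred_continues assms)
qed

lemma measurable_CI:
  assumes "0 < \<epsilon>" "\<And>t. t \<in> {0..1} \<Longrightarrow> (\<lambda>x. yl x t) \<in> borel_measurable N"
    and "\<And>t. t \<in> {0..1} \<Longrightarrow> (\<lambda>x. ys x t) \<in> borel_measurable N"
  shows "(\<lambda>x. CI_lower \<alpha> \<epsilon> (yl x) (ys x)) \<in> borel_measurable N"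
    and "(\<lambda>x. CI_upper \<alpha> \<epsilon> (yl x) (ys x)) \<in> borel_measurable N"
proof -
  have [measurable]: "(\<lambda>x. hat_i (yl x) j) \<in> measurable N (count_space UNIV)" for j
    by (intro measurable_hat_i assms)
  have m: "(\<lambda>x. g j (hat_i (yl x) j)) \<in> borel_measurable N" for g :: "nat \<Rightarrow> int \<Rightarrow> real" and j
    by (rule measurable_compose[of _ _ "count_space UNIV"]) auto
  have c: "(\<lambda>x. g (hat_j \<epsilon> (yl x) (ys x)) (hat_i (yl x) (hat_j \<epsilon> (yl x) (ys x)))) \<in> borel_measurable N"
    for g :: "nat \<Rightarrow> int \<Rightarrow> real"
    by (rule measurable_compose_countable[OF m measurable_hat_j[OF assms]])
  show "(\<lambda>x. CI_lower \<alpha> \<epsilon> (yl x) (ys x)) \<in> borel_measurable N"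
    using c[of "\<lambda>j i. grid j (max 0 (i - 12 * 2 ^ K \<alpha> + 1))"] by (simp add: CI_lower_def Let_def)
  show "(\<lambda>x. CI_upper \<alpha> \<epsilon> (yl x) (ys x)) \<in> borel_measurable N"
    using c[of "\<lambda>j i. grid j (min (2 ^ j) (i + 12 * 2 ^ K \<alpha> - 2))"] by (simp add: CI_upper_def Let_def)
qed

section \<open>Gaussian facts\<close>

text \<open>The probability of a box factors first over the outer index, by independence of the
  bundles, then within each bundle. The lemma serves twice: for the increments of the three motions,
  and for the two split values of each cell.\<close>

lemma (in prob_space) indep_vars_Sigma:
  fixes X :: "'i \<times> 'j \<Rightarrow> 'a \<Rightarrow> real"
  assumes I: "finite I" "I \<noteq> {}" and J: "\<And>i. i \<in> I \<Longrightarrow> finite (J i)" "\<And>i. i \<in> I \<Longrightarrow> J i \<noteq> {}"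
    and outer: "indep_vars (\<lambda>i. \<Pi>\<^sub>M j\<in>J i. borel) (\<lambda>i \<omega>. \<lambda>j\<in>J i. X (i, j) \<omega>) I"
    and inner: "\<And>i. i \<in> I \<Longrightarrow> indep_vars (\<lambda>_. borel) (\<lambda>j. X (i, j)) (J i)"
  shows "indep_vars (\<lambda>_. borel) X (Sigma I J)"
proof -
  have rv: "random_variable borel (X p)" if "p \<in> Sigma I J" for p
    using inner that by (cases p) (auto simp: indep_vars_def)
  have "prob (\<Inter>p\<in>Sigma I J. X p -` A p \<inter> space M) = (\<Prod>p\<in>Sigma I J. prob (X p -` A p \<inter> space M))"
    if A: "\<And>p. p \<in> Sigma I J \<Longrightarrow> A p \<in> sets borel" for A
  proof -
    let ?Y = "\<lambda>i \<omega>. \<lambda>j\<in>J i. X (i, j) \<omega>"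
    let ?B = "\<lambda>i. Pi\<^sub>E (J i) (\<lambda>j. A (i, j))"
    have eq: "?Y i -` ?B i \<inter> space M = (\<Inter>j\<in>J i. X (i, j) -` A (i, j) \<inter> space M)" if "i \<in> I" for i
      using J(2)[OF that] by (auto simp: PiE_iff)
    have "(\<Inter>p\<in>Sigma I J. X p -` A p \<inter> space M) = (\<Inter>i\<in>I. ?Y i -` ?B i \<inter> space M)"
    proof -
      have "(\<Inter>p\<in>Sigma I J. X p -` A p \<inter> space M) = (\<Inter>i\<in>I. \<Inter>j\<in>J i. X (i, j) -` A (i, j) \<inter> space M)"
        by (rule set_eqI, simp only: INT_iff split_paired_Ball_Sigma)
      then show ?thesis using eq by simp
    qed
    also have "prob \<dots> = (\<Prod>i\<in>I. prob (?Y i -` ?B i \<inter> space M))"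
      using A J by (intro indep_varsD_finite[OF outer] I sets_PiM_I_finite) auto
    also have "\<dots> = (\<Prod>i\<in>I. \<Prod>j\<in>J i. prob (X (i, j) -` A (i, j) \<inter> space M))"
    proof (rule prod.cong)
      fix i assume i: "i \<in> I"
      show "prob (?Y i -` ?B i \<inter> space M) = (\<Prod>j\<in>J i. prob (X (i, j) -` A (i, j) \<inter> space M))"
        unfolding eq[OF i] using A J i by (intro indep_varsD_finite[OF inner]) auto
    qed simp
    also have "\<dots> = (\<Prod>p\<in>Sigma I J. prob (X p -` A p \<inter> space M))"
      using I J by (subst prod.Sigma) (auto simp: case_prod_beta)
    finally show ?thesis .
  qed
  moreover have "Sigma I J \<noteq> {}" "finite (Sigma I J)" using I J by auto
  ultimately show ?thesis
    using rv sets.sigma_sets_eq[of "borel :: real measure"]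
    by (subst indep_vars_finite[where E="\<lambda>_. sets borel"]) (auto simp: Int_stable_def Pi_iff)
qed

text \<open>Since \<open>(u + v)^2 + (u - v)^2 = 2 * (u^2 + v^2)\<close>, the exponents agree; the
  factor 2 is the Jacobian of the map taking \<open>(u, v)\<close> to
  \<open>(u + v, u - v)\<close>.\<close>

lemma normal_density_rotation:
  assumes "0 < \<tau>"
  shows "2 * (normal_density 0 (sqrt 2 * \<tau>) (u + v) * normal_density 0 (sqrt 2 * \<tau>) (u - v))
    = normal_density 0 \<tau> u * normal_density 0 \<tau> v"
proof -
  define c d where "c = 1 / sqrt (2 * pi * \<tau>\<^sup>2)" and "d = 1 / sqrt (2 * pi * (sqrt 2 * \<tau>)\<^sup>2)"
  have e: "- (u + v)\<^sup>2 / (2 * (sqrt 2 * \<tau>)\<^sup>2) + - (u - v)\<^sup>2 / (2 * (sqrt 2 * \<tau>)\<^sup>2)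
     = - u\<^sup>2 / (2 * \<tau>\<^sup>2) + - v\<^sup>2 / (2 * \<tau>\<^sup>2)"
    using assms by (simp add: power2_eq_square field_simps)
  have cc: "c * c = 1 / (2 * pi * \<tau>\<^sup>2)" "d * d = 1 / (2 * pi * (sqrt 2 * \<tau>)\<^sup>2)"
    unfolding c_def d_def by (simp_all flip: real_sqrt_mult)
  then have cd: "2 * (d * d) = c * c" using assms by (simp add: power_mult_distrib)
  have n: "normal_density 0 \<tau> x = c * exp (- x\<^sup>2 / (2 * \<tau>\<^sup>2))"
    "normal_density 0 (sqrt 2 * \<tau>) x = d * exp (- x\<^sup>2 / (2 * (sqrt 2 * \<tau>)\<^sup>2))" for x
    by (simp_all add: normal_density_def c_def d_def)
  have "2 * (d * exp a * (d * exp b)) = c * exp a' * (c * exp b')" if "a + b = a' + b'" for a b a' b'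
  proof -
    have "2 * (d * exp a * (d * exp b)) = 2 * (d * d) * exp (a + b)" by (simp add: exp_add)
    also have "\<dots> = c * c * exp (a' + b')" unfolding cd that ..
    finally show ?thesis by (simp add: exp_add)
  qed
  from this[OF e] show ?thesis unfolding n .
qed

text \<open>Rotation invariance of the planar Gaussian law, verified on rectangles by two affine
  substitutions. The equality of the variances is what makes the rotated density factor.\<close>

lemma (in prob_space) indep_sum_diff_normal:
  assumes indep: "indep_var borel U borel V" and "0 < \<tau>"
    and U: "distributed M lborel U (normal_density 0 \<tau>)"
    and V: "distributed M lborel V (normal_density 0 \<tau>)"
  shows "indep_var borel (\<lambda>\<omega>. U \<omega> + V \<omega>) borel (\<lambda>\<omega>. U \<omega> - V \<omega>)"
proof -
  let ?\<phi> = "normal_density 0 \<tau>" and ?\<psi> = "normal_density 0 (sqrt 2 * \<tau>)"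
  have [measurable]: "random_variable borel U" "random_variable borel V"
    using U V by (auto simp: distributed_def)
  have sq: "sqrt (\<tau>\<^sup>2 + \<tau>\<^sup>2) = sqrt 2 * \<tau>" 
    using \<open>0 < \<tau>\<close> unfolding mult_2[symmetric] by (simp add: real_sqrt_mult)
  have S: "distributed M lborel (\<lambda>\<omega>. U \<omega> + V \<omega>) ?\<psi>"
    using add_indep_normal[OF indep \<open>0 < \<tau>\<close> \<open>0 < \<tau>\<close> U V] unfolding sq by simp
  have D: "distributed M lborel (\<lambda>\<omega>. U \<omega> - V \<omega>) ?\<psi>"
    using diff_indep_normal[OF indep \<open>0 < \<tau>\<close> \<open>0 < \<tau>\<close> U V] unfolding sq by simp
  have [measurable]: "U \<in> borel_measurable M" "V \<in> borel_measurable M" by simp_all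
  have joint: "distributed M (lborel \<Otimes>\<^sub>M lborel) (\<lambda>\<omega>. (U \<omega>, V \<omega>)) (\<lambda>(x, y). ennreal (?\<phi> x) * ennreal (?\<phi> y))"
    using indep by (intro distributed_joint_indep U V lborel.sigma_finite_measure_axioms)
      (simp add: indep_var_eq)
  have "distr M borel (\<lambda>\<omega>. U \<omega> + V \<omega>) \<Otimes>\<^sub>M distr M borel (\<lambda>\<omega>. U \<omega> - V \<omega>) =
    distr M (borel \<Otimes>\<^sub>M borel) (\<lambda>\<omega>. (U \<omega> + V \<omega>, U \<omega> - V \<omega>))"
  proof (rule pair_measure_eqI)
    fix A B :: "real set"
    assume "A \<in> sets (distr M borel (\<lambda>\<omega>. U \<omega> + V \<omega>))" "B \<in> sets (distr M borel (\<lambda>\<omega>. U \<omega> - V \<omega>))"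
    then have [measurable]: "A \<in> sets borel" "B \<in> sets borel" by auto
    define p q where "p x = ennreal (?\<psi> x) * indicator A x" and "q x = ennreal (?\<psi> x) * indicator B x" for x
    have [measurable]: "p \<in> borel_measurable borel" "q \<in> borel_measurable borel"
      unfolding p_def q_def by measurable
    \<comment> \<open>The substitution \<open>b = 2 * u - a\<close> has Jacobian 2; together with
      \<open>a = u + v\<close> below it gives \<open>b = u - v\<close>.\<close>
    have shift: "(\<integral>\<^sup>+b. q b \<partial>lborel) = (\<integral>\<^sup>+u. 2 * q (- a + 2 * u) \<partial>lborel)" for a
      by (subst nn_integral_real_affine[where c=2 and t="- a"]) (auto simp: nn_integral_cmult)
    have "emeasure (distr M borel (\<lambda>\<omega>. U \<omega> + V \<omega>)) A * emeasure (distr M borel (\<lambda>\<omega>. U \<omega> - V \<omega>)) B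
       = (\<integral>\<^sup>+a. p a \<partial>lborel) * (\<integral>\<^sup>+b. q b \<partial>lborel)"
      using distributed_emeasure[OF S, of A] distributed_emeasure[OF D, of B]
      by (simp add: emeasure_distr p_def q_def)
    also have "\<dots> = (\<integral>\<^sup>+a. p a * (\<integral>\<^sup>+b. q b \<partial>lborel) \<partial>lborel)"
      by (simp add: nn_integral_multc)
    also have "\<dots> = (\<integral>\<^sup>+a. p a * (\<integral>\<^sup>+u. 2 * q (- a + 2 * u) \<partial>lborel) \<partial>lborel)"
      unfolding shift[symmetric] ..
    also have "\<dots> = (\<integral>\<^sup>+a. (\<integral>\<^sup>+u. p a * (2 * q (- a + 2 * u)) \<partial>lborel) \<partial>lborel)"
      by (simp add: nn_integral_cmult)
    also have "\<dots> = (\<integral>\<^sup>+u. (\<integral>\<^sup>+a. p a * (2 * q (- a + 2 * u)) \<partial>lborel) \<partial>lborel)"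
      by (rule lborel_pair.Fubini') measurable
    also have "\<dots> = (\<integral>\<^sup>+u. (\<integral>\<^sup>+v. p (u + v) * (2 * q (u - v)) \<partial>lborel) \<partial>lborel)"
    proof (rule nn_integral_cong)
      fix u :: real
      show "(\<integral>\<^sup>+a. p a * (2 * q (- a + 2 * u)) \<partial>lborel) = (\<integral>\<^sup>+v. p (u + v) * (2 * q (u - v)) \<partial>lborel)"
        by (subst nn_integral_real_affine[where c=1 and t=u]) (auto simp: algebra_simps)
    qed
    also have "\<dots> = (\<integral>\<^sup>+u. (\<integral>\<^sup>+v. ennreal (?\<phi> u) * ennreal (?\<phi> v) * indicator {(u, v). u + v \<in> A \<and> u - v \<in> B} (u, v) \<partial>lborel) \<partial>lborel)"
    proof (intro nn_integral_cong)
      fix u v :: real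
      have "ennreal (?\<phi> u) * ennreal (?\<phi> v) = ennreal (?\<psi> (u + v)) * (2 * ennreal (?\<psi> (u - v)))"
        unfolding ennreal_mult[symmetric, OF normal_density_nonneg normal_density_nonneg]
          normal_density_rotation[OF \<open>0 < \<tau>\<close>, symmetric]
        by (simp add: ennreal_mult ac_simps)
      then show "p (u + v) * (2 * q (u - v))
         = ennreal (?\<phi> u) * ennreal (?\<phi> v) * indicator {(u, v). u + v \<in> A \<and> u - v \<in> B} (u, v)"
        by (auto simp: indicator_def p_def q_def)
    qed
    also have "\<dots> = (\<integral>\<^sup>+x. (case x of (u, v) \<Rightarrow> ennreal (?\<phi> u) * ennreal (?\<phi> v)) * indicator {(u, v). u + v \<in> A \<and> u - v \<in> B} x \<partial>(lborel \<Otimes>\<^sub>M lborel))"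
      by (subst lborel.nn_integral_fst[symmetric]) (auto simp: borel_prod)
    also have "\<dots> = emeasure M ((\<lambda>\<omega>. (U \<omega>, V \<omega>)) -` {(u, v). u + v \<in> A \<and> u - v \<in> B} \<inter> space M)"
    proof (rule distributed_emeasure[OF joint, symmetric])
      have "{x \<in> space (borel \<Otimes>\<^sub>M borel). fst x + snd x \<in> A \<and> fst x - snd x \<in> B} \<in> sets (borel \<Otimes>\<^sub>M borel :: (real \<times> real) measure)"
        by measurable
      then show "{(u, v). u + v \<in> A \<and> u - v \<in> B} \<in> sets (lborel \<Otimes>\<^sub>M lborel)"
        by (simp add: space_pair_measure case_prod_beta' cong: sets_pair_measure_cong)
    qed
    also have "\<dots> = emeasure (distr M (borel \<Otimes>\<^sub>M borel) (\<lambda>\<omega>. (U \<omega> + V \<omega>, U \<omega> - V \<omega>))) (A \<times> B)"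
      by (subst emeasure_distr) (auto intro!: arg_cong[where f="emeasure M"])
    finally show "emeasure (distr M borel (\<lambda>\<omega>. U \<omega> + V \<omega>)) A * emeasure (distr M borel (\<lambda>\<omega>. U \<omega> - V \<omega>)) B =
       emeasure (distr M (borel \<Otimes>\<^sub>M borel) (\<lambda>\<omega>. (U \<omega> + V \<omega>, U \<omega> - V \<omega>))) (A \<times> B)" .
  next
    show "sigma_finite_measure (distr M borel (\<lambda>\<omega>. U \<omega> + V \<omega>))"
      "sigma_finite_measure (distr M borel (\<lambda>\<omega>. U \<omega> - V \<omega>))"
      by (auto intro!: prob_space_imp_sigma_finite prob_space_distr)
  qed simp
  then show ?thesis by (simp add: indep_var_distribution_eq)
qed

text \<open>Quadratic decay is enough for the length bound, because on coarse levels the squared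
  signal-to-noise ratio grows like the cube of the mesh.\<close>

lemma (in prob_space) normal_tail_Chebyshev:
  assumes D: "distributed M lborel D (normal_density \<mu> \<sigma>)" and "0 < \<sigma>" "0 < a"
  shows "prob {\<omega>\<in>space M. \<mu> + a * \<sigma> \<le> D \<omega>} \<le> 1 / a\<^sup>2"
    and "prob {\<omega>\<in>space M. D \<omega> \<le> \<mu> - a * \<sigma>} \<le> 1 / a\<^sup>2"
proof -
  have [measurable]: "random_variable borel D" using D by (auto simp: distributed_def)
  define E where "E \<omega> = (D \<omega> - \<mu>) / \<sigma>" for \<omega>
  have E: "distributed M lborel E std_normal_density"
    using normal_standard_normal_convert[OF \<open>0 < \<sigma>\<close>] D unfolding E_def by blast
  have ex: "expectation E = 0" by (rule standard_normal_distributed_expectation[OF E])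
  have var: "variance E = 1" by (rule standard_normal_distributed_variance[OF E])
  have int: "integrable M (\<lambda>\<omega>. (E \<omega>)\<^sup>2)"
    using distributed_integrable[OF E, of "\<lambda>x. x\<^sup>2"] integrable_std_normal_moment[of 2] by simp
  have [measurable]: "random_variable borel E" unfolding E_def by measurable
  have c: "prob {\<omega>\<in>space M. a \<le> \<bar>E \<omega>\<bar>} \<le> 1 / a\<^sup>2"
    using Chebyshev_inequality[of E a] int \<open>0 < a\<close> var unfolding ex by simp
  have "prob {\<omega>\<in>space M. \<mu> + a * \<sigma> \<le> D \<omega>} \<le> prob {\<omega>\<in>space M. a \<le> \<bar>E \<omega>\<bar>}"
    using assms by (intro finite_measure_mono) (auto simp: E_def field_simps abs_if)
  moreover have "prob {\<omega>\<in>space M. D \<omega> \<le> \<mu> - a * \<sigma>} \<le> prob {\<omega>\<in>space M. a \<le> \<bar>E \<omega>\<bar>}"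
    using assms by (intro finite_measure_mono) (auto simp: E_def field_simps abs_if)
  ultimately show "prob {\<omega>\<in>space M. \<mu> + a * \<sigma> \<le> D \<omega>} \<le> 1 / a\<^sup>2"
    "prob {\<omega>\<in>space M. D \<omega> \<le> \<mu> - a * \<sigma>} \<le> 1 / a\<^sup>2" using c by linarith+
qed

text \<open>With a nonpositive mean the standardized variable must exceed 2, and reflection turns
  this into the lower tail that \<open>Phi\<close> measures.\<close>

lemma (in prob_space) normal_upper_tail_Phi:
  assumes D: "distributed M lborel D (normal_density \<mu> \<sigma>)" and "0 < \<sigma>" "\<mu> \<le> 0"
  shows "prob {\<omega>\<in>space M. 2 * \<sigma> < D \<omega>} \<le> Phi (-2)"
proof -
  have [measurable]: "random_variable borel D" using D by (auto simp: distributed_def)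
  define E where "E \<omega> = (D \<omega> - \<mu>) / \<sigma>" for \<omega>
  have E: "distributed M lborel E std_normal_density"
    using normal_standard_normal_convert[OF \<open>0 < \<sigma>\<close>] D unfolding E_def by blast
  have F: "distributed M lborel (\<lambda>\<omega>. 0 + -1 * E \<omega>) (normal_density (0 + -1 * 0) (\<bar>-1\<bar> * 1))"
    by (rule normal_density_affine[OF E]) auto
  have [measurable]: "random_variable borel E" unfolding E_def by measurable
  have d: "distr M borel (\<lambda>\<omega>. - E \<omega>) = std_normal_distribution"
    using F by (simp add: distributed_def cong: distr_cong)
  have "prob {\<omega>\<in>space M. 2 * \<sigma> < D \<omega>} \<le> prob {\<omega>\<in>space M. - E \<omega> \<le> -2}"
    using assms by (intro finite_measure_mono) (auto simp: E_def field_simps)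
  also have "\<dots> = measure (distr M borel (\<lambda>\<omega>. - E \<omega>)) {..-2}"
    by (subst measure_distr) (auto intro!: arg_cong[where f=prob])
  also have "\<dots> = Phi (-2)" by (simp add: d Phi_def cdf_def)
  finally show ?thesis .
qed

text \<open>Together the bounds make \<open>ln (Phi (-2))\<close> negative, as \<open>K\<close>
  requires. The upper one is Chebyshev at two standard deviations; the lower one holds because the
  density is positive on \<open>{-3..-2}\<close>, a set of positive Lebesgue measure.\<close>

lemma Phi_bounds: "0 < Phi (-2)" "Phi (-2) \<le> 1/4"
proof -
  interpret N: prob_space std_normal_distribution
    by (simp add: prob_space_normal_density)
  have D: "distributed std_normal_distribution lborel (\<lambda>x. x) std_normal_density"
    by (auto simp: distributed_def intro!: distr_id2)
  show "Phi (-2) \<le> 1/4"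
    using N.normal_tail_Chebyshev(2)[OF D, of 2]
    by (simp add: Phi_def cdf_def space_density atMost_def)
  have "emeasure std_normal_distribution {..-2} \<noteq> 0"
  proof
    assume "emeasure std_normal_distribution {..-2::real} = 0"
    then have "{..-2} \<in> null_sets std_normal_distribution" by (intro null_setsI) auto
    then have "AE x in lborel. x \<in> {..-2::real} \<longrightarrow> ennreal (std_normal_density x) = 0"
      by (subst (asm) null_sets_density_iff) auto
    then have "AE x in lborel. x \<notin> {-3..-2::real}"
      by eventually_elim (use normal_density_pos[of 1 0] in \<open>auto simp: ennreal_eq_0_iff not_le not_less[symmetric]\<close>)
    then have "emeasure lborel {-3..-2::real} = 0"
      by (subst (asm) AE_iff_measurable[of "{-3..-2}"]) auto
    then show False by simp
  qed
  then show "0 < Phi (-2)"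
    by (simp add: Phi_def cdf_def N.emeasure_eq_measure zero_less_measure_iff)
qed

section \<open>Independent increments of the split paths\<close>

lemma brownian_motion_increment:
  assumes "brownian_motion M W" "0 \<le> s" "s < t" "t \<le> 1"
  shows "distributed M lborel (\<lambda>\<omega>. W t \<omega> - W s \<omega>) (normal_density 0 (sqrt (t - s)))"
  using assms unfolding brownian_motion_def by blast

lemma brownian_motion_indep_increments:
  fixes n :: nat
  assumes "brownian_motion M W" "\<And>k. k \<le> n \<Longrightarrow> \<tau> k \<in> {0..1}" "\<And>k. k < n \<Longrightarrow> \<tau> k \<le> \<tau> (Suc k)"
  shows "prob_space.indep_vars M (\<lambda>_. borel) (\<lambda>k \<omega>. W (\<tau> (Suc k)) \<omega> - W (\<tau> k) \<omega>) {..<n}"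
  using assms unfolding brownian_motion_def by blast

locale three_brownian_motions =
  fixes M :: "'a measure" and W B1 B2 :: "real \<Rightarrow> 'a \<Rightarrow> real"
  assumes ibm: "independent_brownian_motions M [W, B1, B2]"
begin

abbreviation "Ws \<equiv> [W, B1, B2]"

lemma brownian: "i < 3 \<Longrightarrow> brownian_motion M (Ws ! i)"
proof -
  assume "i < 3"
  then have "Ws ! i \<in> set Ws" by (intro nth_mem) simp
  then show ?thesis using ibm unfolding independent_brownian_motions_def by blast
qed

sublocale prob_space M
  using brownian[of 0] by (simp add: brownian_motion_def)

lemma measurable_Ws: 
  "t \<in> {0..1} \<Longrightarrow> random_variable borel (W t)"
  "t \<in> {0..1} \<Longrightarrow> random_variable borel (B1 t)"
  "t \<in> {0..1} \<Longrightarrow> random_variable borel (B2 t)"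
  using brownian[of 0] brownian[of 1] brownian[of 2] by (auto simp: brownian_motion_def)

text \<open>Increments of the three motions on the finest grid; cells are counted from 0 here,
  whereas the blocks of \<open>grid\<close> are counted from 1.\<close>

definition raw :: "nat \<Rightarrow> nat \<times> nat \<Rightarrow> 'a \<Rightarrow> real" where
  "raw J p \<omega> = (Ws ! fst p) (real (Suc (snd p)) / 2 ^ J) \<omega> - (Ws ! fst p) (real (snd p) / 2 ^ J) \<omega>"

lemma dyadic_mem: "k \<le> 2 ^ J \<Longrightarrow> real k / 2 ^ J \<in> {0..1}"
  by (simp add: divide_le_eq flip: of_nat_power[of 2, simplified])

text \<open>Between motions the independence is that of whole paths, within one motion that of
  successive increments; \<open>indep_vars_Sigma\<close> merges the two.\<close>

lemma raw_indep: "indep_vars (\<lambda>_. borel) (raw J) ({..<3} \<times> {..<2 ^ J})"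
proof (rule indep_vars_Sigma)
  let ?Y = "\<lambda>i (w :: real \<Rightarrow> real). \<lambda>k\<in>{..<2 ^ J :: nat}. w (real (Suc k) / 2 ^ J) - w (real k / 2 ^ J)"
  have "indep_vars (\<lambda>_. \<Pi>\<^sub>M t\<in>{0..1}. borel) (\<lambda>k \<omega>. \<lambda>t\<in>{0..1}. (Ws ! k) t \<omega>) {..<3}"
    using ibm by (simp add: independent_brownian_motions_def numeral_3_eq_3)
  then have "indep_vars (\<lambda>_. \<Pi>\<^sub>M k\<in>{..<2 ^ J}. borel) (\<lambda>i \<omega>. ?Y i (\<lambda>t\<in>{0..1}. (Ws ! i) t \<omega>)) {..<3}"
  proof (rule indep_vars_compose2)
    show "?Y i \<in> (\<Pi>\<^sub>M t\<in>{0..1}. borel) \<rightarrow>\<^sub>M (\<Pi>\<^sub>M k\<in>{..<2 ^ J}. borel)" for i :: nat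
    proof (rule measurable_restrict)
      have m: "(\<lambda>w. w t :: real) \<in> borel_measurable (\<Pi>\<^sub>M t\<in>{0..1}. borel)" if "t \<in> {0..1}" for t :: real
        by (rule measurable_component_singleton) fact
      fix k :: nat assume "k \<in> {..<2 ^ J}"
      then have t: "real k / 2 ^ J \<in> {0..1}" "real (Suc k) / 2 ^ J \<in> {0..1}"
        by (intro dyadic_mem; simp)+
      show "(\<lambda>w. w (real (Suc k) / 2 ^ J) - w (real k / 2 ^ J) :: real) \<in> borel_measurable (\<Pi>\<^sub>M t\<in>{0..1}. borel)"
        using borel_measurable_diff[OF m[OF t(2)] m[OF t(1)]] .
    qed
  qed
  also have "(\<lambda>i \<omega>. ?Y i (\<lambda>t\<in>{0..1}. (Ws ! i) t \<omega>)) = (\<lambda>i \<omega>. \<lambda>k\<in>{..<2 ^ J}. raw J (i, k) \<omega>)"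
  proof (intro ext)
    fix i \<omega> k
    show "?Y i (\<lambda>t\<in>{0..1}. (Ws ! i) t \<omega>) k = (\<lambda>k\<in>{..<2 ^ J}. raw J (i, k) \<omega>) k"
    proof (cases "k < 2 ^ J")
      case True
      then have "real k / 2 ^ J \<in> {0..1}" "real (Suc k) / 2 ^ J \<in> {0..1}"
        by (intro dyadic_mem; simp)+
      then show ?thesis using True unfolding raw_def fst_conv snd_conv restrict_def by simp
    qed simp
  qed
  finally show "indep_vars (\<lambda>_. \<Pi>\<^sub>M k\<in>{..<2 ^ J}. borel) (\<lambda>i \<omega>. \<lambda>k\<in>{..<2 ^ J}. raw J (i, k) \<omega>) {..<3}" .
  fix i :: nat assume i: "i \<in> {..<3}"
  have "indep_vars (\<lambda>_. borel) (\<lambda>k \<omega>. (Ws ! i) (real (Suc k) / 2 ^ J) \<omega> - (Ws ! i) (real k / 2 ^ J) \<omega>) {..<2 ^ J}"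
    using i dyadic_mem by (intro brownian_motion_indep_increments brownian) (auto simp: divide_right_mono)
  then show "indep_vars (\<lambda>_. borel) (\<lambda>k. raw J (i, k)) {..<2 ^ J}"
    unfolding raw_def[abs_def] fst_conv snd_conv .
qed (auto simp: lessThan_empty_iff)

lemma raw_normal:
  assumes "i < 3" "k < 2 ^ J"
  shows "distributed M lborel (raw J (i, k)) (normal_density 0 (sqrt (mesh J)))"
proof -
  let ?s = "real k / 2 ^ J" and ?t = "real (Suc k) / 2 ^ J"
  have "?t - ?s = mesh J" by (simp add: mesh_def field_simps)
  moreover have "?t \<le> 1" using dyadic_mem[of "Suc k" J] assms by simp
  moreover have "?s < ?t" by (simp add: divide_strict_right_mono)
  moreover have "0 \<le> ?s" by simp
  ultimately have "distributed M lborel (\<lambda>\<omega>. (Ws ! i) ?t \<omega> - (Ws ! i) ?s \<omega>) (normal_density 0 (sqrt (mesh J)))"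
    using brownian_motion_increment[OF brownian[OF assms(1)], of ?s ?t] by simp
  then show ?thesis by (simp add: raw_def[abs_def])
qed

text \<open>Up to the drift and the factor \<open>\<epsilon>\<close>, the paths \<open>Y\<^sub>l\<close> (for \<^const>\<open>True\<close>) and
  \<open>Y\<^sub>s\<close> (for \<^const>\<open>False\<close>).\<close>

definition noise :: "bool \<Rightarrow> real \<Rightarrow> 'a \<Rightarrow> real" where
  "noise p t \<omega> = W t \<omega> + sqrt 2 / 2 * B1 t \<omega> + (if p then 1 else -1) * (sqrt 6 / 2 * B2 t \<omega>)"

text \<open>All levels up to \<open>J\<close> are expressed through these finest increments, so that
  together they become functions of one finite independent family.\<close>

definition cell :: "nat \<Rightarrow> nat \<times> bool \<Rightarrow> 'a \<Rightarrow> real" where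
  "cell J p \<omega> = noise (snd p) (real (Suc (fst p)) / 2 ^ J) \<omega> - noise (snd p) (real (fst p) / 2 ^ J) \<omega>"

lemma cell_eq_raw:
  "cell J (k, p) \<omega> = (raw J (0, k) \<omega> + sqrt 2 / 2 * raw J (1, k) \<omega>) + (if p then 1 else -1) * (sqrt 6 / 2 * raw J (2, k) \<omega>)"
  by (simp add: cell_def noise_def raw_def algebra_simps)

text \<open>Per cell of mesh \<open>m\<close>, \<open>W + sqrt 2 / 2 * B1\<close> has variance
  \<open>m + m / 2\<close> and \<open>sqrt 6 / 2 * B2\<close> has \<open>3 / 2 * m\<close>. The two
  agree, so \<open>indep_sum_diff_normal\<close> applies to sum and difference, each of variance
  \<open>3 * m\<close>.\<close>

lemma cell_pair:
  assumes k: "k < 2 ^ J"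
  shows "indep_vars (\<lambda>_. borel) (\<lambda>p. cell J (k, p)) UNIV"
    and "distributed M lborel (cell J (k, p)) (normal_density 0 (sqrt (3 * mesh J)))"
proof -
  let ?m = "mesh J"
  let ?U = "\<lambda>\<omega>. raw J (0, k) \<omega> + sqrt 2 / 2 * raw J (1, k) \<omega>" and ?V = "\<lambda>\<omega>. sqrt 6 / 2 * raw J (2, k) \<omega>"
  have m: "0 < ?m" "0 < sqrt ?m" using mesh_pos[of J] by auto
  have ind: "indep_var (PiM A (\<lambda>_. borel)) (\<lambda>\<omega>. restrict (\<lambda>i. raw J i \<omega>) A)
       (PiM B (\<lambda>_. borel)) (\<lambda>\<omega>. restrict (\<lambda>i. raw J i \<omega>) B)"
    if "A \<inter> B = {}" "A \<subseteq> {..<3} \<times> {..<2 ^ J}" "B \<subseteq> {..<3} \<times> {..<2 ^ J}" for A B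
    using that by (intro indep_var_restrict[OF raw_indep]) auto
  have "indep_var borel ((\<lambda>g. g (0, k)) \<circ> (\<lambda>\<omega>. restrict (\<lambda>i. raw J i \<omega>) {(0, k)}))
     borel ((\<lambda>g. sqrt 2 / 2 * g (1, k)) \<circ> (\<lambda>\<omega>. restrict (\<lambda>i. raw J i \<omega>) {(1, k)}))"
    using k by (intro indep_var_compose[OF ind] borel_measurable_times borel_measurable_const
        measurable_component_singleton) auto
  then have i1: "indep_var borel (raw J (0, k)) borel (\<lambda>\<omega>. sqrt 2 / 2 * raw J (1, k) \<omega>)"
    by (simp add: comp_def)
  have "indep_var borel ((\<lambda>g. g (0, k) + sqrt 2 / 2 * g (1, k)) \<circ> (\<lambda>\<omega>. restrict (\<lambda>i. raw J i \<omega>) {(0, k), (1, k)}))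
     borel ((\<lambda>g. sqrt 6 / 2 * g (2, k)) \<circ> (\<lambda>\<omega>. restrict (\<lambda>i. raw J i \<omega>) {(2, k)}))"
    using k by (intro indep_var_compose[OF ind] borel_measurable_times borel_measurable_add borel_measurable_const
        measurable_component_singleton) auto
  then have i2: "indep_var borel ?U borel ?V" by (simp add: comp_def)
  have s2: "sqrt 2 / 2 * sqrt ?m = sqrt (?m / 2)"
    by (simp add: real_sqrt_divide real_sqrt_mult field_simps flip: real_sqrt_mult_self[of 2])
  have d1: "distributed M lborel (\<lambda>\<omega>. 0 + sqrt 2 / 2 * raw J (1, k) \<omega>) (normal_density (0 + sqrt 2 / 2 * 0) (\<bar>sqrt 2 / 2\<bar> * sqrt ?m))"
    using k m by (intro normal_density_affine raw_normal) auto
  then have d1: "distributed M lborel (\<lambda>\<omega>. sqrt 2 / 2 * raw J (1, k) \<omega>) (normal_density 0 (sqrt 2 / 2 * sqrt ?m))"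
    by simp
  have "distributed M lborel ?U (normal_density (0 + 0) (sqrt ((sqrt ?m)\<^sup>2 + (sqrt 2 / 2 * sqrt ?m)\<^sup>2)))"
    using k m by (intro add_indep_normal[OF i1 _ _ _ d1] raw_normal) auto
  moreover have "(sqrt ?m)\<^sup>2 + (sqrt 2 / 2 * sqrt ?m)\<^sup>2 = 3/2 * ?m"
    using m by (simp add: power_mult_distrib power_divide)
  ultimately have dU: "distributed M lborel ?U (normal_density 0 (sqrt (3/2 * ?m)))"
    by (simp only: add_0_right)
  have "distributed M lborel (\<lambda>\<omega>. 0 + sqrt 6 / 2 * raw J (2, k) \<omega>) (normal_density (0 + sqrt 6 / 2 * 0) (\<bar>sqrt 6 / 2\<bar> * sqrt ?m))"
    using k m by (intro normal_density_affine raw_normal) auto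
  moreover have "\<bar>sqrt 6 / 2\<bar> * sqrt ?m = sqrt (3/2 * ?m)"
  proof (rule real_sqrt_unique[symmetric])
    show "(\<bar>sqrt 6 / 2\<bar> * sqrt ?m)\<^sup>2 = 3/2 * ?m" using m by (simp add: power_mult_distrib power_divide)
  qed (use m in auto)
  ultimately have dV: "distributed M lborel ?V (normal_density 0 (sqrt (3/2 * ?m)))" by simp
  have pos: "0 < sqrt (3/2 * ?m)" using m by simp
  have "indep_var borel (\<lambda>\<omega>. ?U \<omega> + ?V \<omega>) borel (\<lambda>\<omega>. ?U \<omega> - ?V \<omega>)"
    by (rule indep_sum_diff_normal[OF i2 pos dU dV])
  then show "indep_vars (\<lambda>_. borel) (\<lambda>p. cell J (k, p)) UNIV"
    unfolding indep_var_def
    by (rule indep_vars_cong[THEN iffD1, rotated -1]) (auto simp: cell_eq_raw[abs_def] split: bool.split)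
  have sq: "sqrt ((sqrt (3/2 * ?m))\<^sup>2 + (sqrt (3/2 * ?m))\<^sup>2) = sqrt (3 * ?m)" using m by simp
  have "distributed M lborel (\<lambda>\<omega>. ?U \<omega> + ?V \<omega>) (normal_density 0 (sqrt (3 * ?m)))"
    "distributed M lborel (\<lambda>\<omega>. ?U \<omega> - ?V \<omega>) (normal_density 0 (sqrt (3 * ?m)))"
    using add_indep_normal[OF i2 pos pos dU dV] diff_indep_normal[OF i2 pos pos dU dV] unfolding sq by simp_all
  then show "distributed M lborel (cell J (k, p)) (normal_density 0 (sqrt (3 * mesh J)))"
    unfolding cell_eq_raw[abs_def] by (cases p) simp_all
qed

text \<open>Different cells use disjoint groups of \<open>raw\<close> increments; within one cell
  the two split values are independent by \<open>cell_pair\<close>.\<close>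

lemma cells_indep: "indep_vars (\<lambda>_. borel) (cell J) ({..<2 ^ J} \<times> UNIV)"
proof (rule indep_vars_Sigma)
  let ?K = "\<lambda>k. {..<3::nat} \<times> {k}"
  let ?Y = "\<lambda>k (g :: nat \<times> nat \<Rightarrow> real). \<lambda>p\<in>UNIV.
     (g (0, k) + sqrt 2 / 2 * g (1, k)) + (if p then 1 else -1) * (sqrt 6 / 2 * g (2, k))"
  have "indep_vars (\<lambda>k. PiM (?K k) (\<lambda>_. borel)) (\<lambda>k \<omega>. restrict (\<lambda>i. raw J i \<omega>) (?K k)) {..<2 ^ J}"
    by (intro indep_vars_restrict[OF raw_indep]) (auto simp: disjoint_family_on_def)
  then have "indep_vars (\<lambda>k. \<Pi>\<^sub>M p\<in>UNIV. borel) (\<lambda>k \<omega>. ?Y k (restrict (\<lambda>i. raw J i \<omega>) (?K k))) {..<2 ^ J}"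
    by (rule indep_vars_compose2)
      (intro measurable_restrict borel_measurable_times borel_measurable_add borel_measurable_const
        measurable_component_singleton; simp)
  then show "indep_vars (\<lambda>k. \<Pi>\<^sub>M p\<in>UNIV. borel) (\<lambda>k \<omega>. \<lambda>p\<in>UNIV. cell J (k, p) \<omega>) {..<2 ^ J}"
    by (simp add: cell_eq_raw)
qed (use cell_pair(1) in \<open>auto simp: lessThan_empty_iff\<close>)

definition obs :: "(real \<Rightarrow> real) \<Rightarrow> real \<Rightarrow> bool \<Rightarrow> 'a \<Rightarrow> real \<Rightarrow> real" where
  "obs F \<epsilon> p \<omega> t = F t + \<epsilon> * noise p t \<omega>"

lemma measurable_obs: "t \<in> {0..1} \<Longrightarrow> (\<lambda>\<omega>. obs F \<epsilon> p \<omega> t) \<in> borel_measurable M"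
  unfolding obs_def noise_def by (intro borel_measurable_add borel_measurable_times borel_measurable_const measurable_Ws)

definition cells :: "nat \<Rightarrow> nat \<Rightarrow> int \<Rightarrow> nat set" where
  "cells J j i = {nat (i - 1) * 2 ^ (J - j)..<nat i * 2 ^ (J - j)}"

text \<open>When \<open>g\<close> holds the cells of an observed path, this step path has the same
  increments on all grids up to level \<open>J\<close>. It exhibits the selected indices as
  functions of the cells alone.\<close>

definition cell_path :: "(real \<Rightarrow> real) \<Rightarrow> real \<Rightarrow> nat \<Rightarrow> (nat \<Rightarrow> real) \<Rightarrow> real \<Rightarrow> real" where
  "cell_path F \<epsilon> J g t = F t + \<epsilon> * (\<Sum>k<nat \<lfloor>t * 2 ^ J\<rfloor>. g k)"

lemma grid_scaled: 
  assumes "j \<le> J" "0 \<le> i" shows "grid j i = real (nat i * 2 ^ (J - j)) / 2 ^ J"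
proof -
  have "(2::real) ^ J = 2 ^ j * 2 ^ (J - j)" using assms by (simp flip: power_add)
  then show ?thesis using assms by (simp add: grid_def mesh_def)
qed

lemma cells_subset: "j \<le> J \<Longrightarrow> i \<in> {1..2 ^ j} \<Longrightarrow> cells J j i \<subseteq> {..<2 ^ J}"
proof -
  assume "j \<le> J" "i \<in> {1..2 ^ j}"
  then have "nat i * 2 ^ (J - j) \<le> 2 ^ j * 2 ^ (J - j)" by (intro mult_right_mono) (auto simp: nat_le_iff)
  also have "\<dots> = 2 ^ J" using \<open>j \<le> J\<close> by (simp flip: power_add)
  finally show ?thesis by (auto simp: cells_def)
qed

lemma obs_increment:
  assumes "j \<le> J" "i \<in> {1..2 ^ j}"
  shows "obs F \<epsilon> p \<omega> (grid j i) - obs F \<epsilon> p \<omega> (grid j (i - 1))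
     = F (grid j i) - F (grid j (i - 1)) + \<epsilon> * (\<Sum>k\<in>cells J j i. cell J (k, p) \<omega>)"
proof -
  let ?a = "nat (i - 1) * 2 ^ (J - j)" and ?b = "nat i * 2 ^ (J - j)"
  have "?a \<le> ?b" by (intro mult_right_mono) auto
  then have "(\<Sum>k\<in>cells J j i. cell J (k, p) \<omega>) = noise p (real ?b / 2 ^ J) \<omega> - noise p (real ?a / 2 ^ J) \<omega>"
    unfolding cells_def cell_def fst_conv snd_conv
    by (rule sum_Suc_diff'[where f="\<lambda>k. noise p (real k / 2 ^ J) \<omega>"])
  moreover have "grid j i = real ?b / 2 ^ J" "grid j (i - 1) = real ?a / 2 ^ J"
    using assms by (intro grid_scaled; simp)+
  ultimately have "(\<Sum>k\<in>cells J j i. cell J (k, p) \<omega>) = noise p (grid j i) \<omega> - noise p (grid j (i - 1)) \<omega>"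
    by (simp only:)
  then show ?thesis unfolding obs_def by (simp only:) (simp add: algebra_simps)
qed

lemma cell_path_increment:
  assumes "j \<le> J" "i \<in> {1..2 ^ j}"
  shows "cell_path F \<epsilon> J g (grid j i) - cell_path F \<epsilon> J g (grid j (i - 1))
     = F (grid j i) - F (grid j (i - 1)) + \<epsilon> * (\<Sum>k\<in>cells J j i. g k)"
proof -
  let ?a = "nat (i - 1) * 2 ^ (J - j)" and ?b = "nat i * 2 ^ (J - j)"
  have ab: "?a \<le> ?b" by (intro mult_right_mono) auto
  have e: "nat \<lfloor>real n / 2 ^ J * 2 ^ J\<rfloor> = n" for n by simp
  have "{..<b} = {..<a} \<union> {a..<b} \<and> {..<a} \<inter> {a..<b} = {}" if "a \<le> b" for a b :: nat
    using that by auto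
  from this[OF ab] have "{..<?b} = {..<?a} \<union> cells J j i" "{..<?a} \<inter> cells J j i = {}"
    unfolding cells_def by blast+
  then have "(\<Sum>k<?b. g k) = (\<Sum>k<?a. g k) + (\<Sum>k\<in>cells J j i. g k)"
    by (simp add: sum.union_disjoint cells_def)
  then show ?thesis using grid_scaled[OF assms(1), of i] grid_scaled[OF assms(1), of "i - 1"] assms(2) e[of ?a] e[of ?b]
    by (simp add: cell_path_def algebra_simps del: of_nat_mult)
qed

text \<open>Applied to the drift it is the mean of a comparison of two blocks, applied to an
  observed path the comparison itself.\<close>

definition contrast :: "(real \<Rightarrow> real) \<Rightarrow> nat \<Rightarrow> int \<Rightarrow> int \<Rightarrow> real" where
  "contrast F j i k = (F (grid j i) - F (grid j (i - 1))) - (F (grid j k) - F (grid j (k - 1)))"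

lemma exceeds_iff:
  assumes "i + 6 * s \<in> {1..2 ^ j}" "i + 5 * s \<in> {1..2 ^ j}"
  shows "exceeds \<epsilon> y j i s \<longleftrightarrow> 2 * noise_sd \<epsilon> j < contrast y j (i + 6 * s) (i + 5 * s)"
  using assms by (simp add: exceeds_def side_stat_def increment_def contrast_def)

lemma contrast_obs:
  assumes "j \<le> J" "i \<in> {1..2 ^ j}" "k \<in> {1..2 ^ j}"
  shows "contrast (obs F \<epsilon> p \<omega>) j i k = contrast F j i k
     + \<epsilon> * ((\<Sum>n\<in>cells J j i. cell J (n, p) \<omega>) - (\<Sum>n\<in>cells J j k. cell J (n, p) \<omega>))"
  unfolding contrast_def obs_increment[OF assms(1,2)] obs_increment[OF assms(1,3)]
  by (simp add: algebra_simps)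

lemma contrast_normal:
  assumes "0 < \<epsilon>" "i \<in> {1..2 ^ j}" "k \<in> {1..2 ^ j}" "i \<noteq> k"
  shows "distributed M lborel (\<lambda>\<omega>. contrast (obs F \<epsilon> p \<omega>) j i k) (normal_density (contrast F j i k) (noise_sd \<epsilon> j))"
proof -
  let ?a = "nat (i - 1)" and ?b = "nat (k - 1)"
  have ab: "?a < 2 ^ j" "?b < 2 ^ j" "?a \<noteq> ?b" using assms by (auto simp: nat_less_iff)
  \<comment> \<open>Taking the level itself as the finest one makes each block a single
    cell.\<close>
  have c: "cells j j i = {?a}" "cells j j k = {?b}" using assms by (auto simp: cells_def)
  have "indep_var (PiM {(?a, p)} (\<lambda>_. borel)) (\<lambda>\<omega>. restrict (\<lambda>i. cell j i \<omega>) {(?a, p)})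
       (PiM {(?b, p)} (\<lambda>_. borel)) (\<lambda>\<omega>. restrict (\<lambda>i. cell j i \<omega>) {(?b, p)})"
    using ab by (intro indep_var_restrict[OF cells_indep]) auto
  then have "indep_var borel ((\<lambda>g. g (?a, p)) \<circ> (\<lambda>\<omega>. restrict (\<lambda>i. cell j i \<omega>) {(?a, p)}))
     borel ((\<lambda>g. g (?b, p)) \<circ> (\<lambda>\<omega>. restrict (\<lambda>i. cell j i \<omega>) {(?b, p)}))"
    by (rule indep_var_compose) (intro measurable_component_singleton; simp)+
  then have ind: "indep_var borel (cell j (?a, p)) borel (cell j (?b, p))" by (simp add: comp_def)
  have m: "0 < sqrt (3 * mesh j)" using mesh_pos[of j] by simp
  have "distributed M lborel (\<lambda>\<omega>. cell j (?a, p) \<omega> - cell j (?b, p) \<omega>)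
     (normal_density (0 - 0) (sqrt ((sqrt (3 * mesh j))\<^sup>2 + (sqrt (3 * mesh j))\<^sup>2)))"
    by (intro diff_indep_normal ind m cell_pair(2) ab)
  moreover have s: "(sqrt (3 * mesh j))\<^sup>2 + (sqrt (3 * mesh j))\<^sup>2 = 6 * mesh j" using mesh_pos[of j] by simp
  ultimately have "distributed M lborel (\<lambda>\<omega>. cell j (?a, p) \<omega> - cell j (?b, p) \<omega>) (normal_density 0 (sqrt (6 * mesh j)))"
    unfolding s by simp
  then have "distributed M lborel (\<lambda>\<omega>. contrast F j i k + \<epsilon> * (cell j (?a, p) \<omega> - cell j (?b, p) \<omega>))
     (normal_density (contrast F j i k + \<epsilon> * 0) (\<bar>\<epsilon>\<bar> * sqrt (6 * mesh j)))"
    using assms(1) mesh_pos[of j] by (intro normal_density_affine) auto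
  moreover have "\<bar>\<epsilon>\<bar> * sqrt (6 * mesh j) = noise_sd \<epsilon> j"
    using assms(1) by (simp add: noise_sd_def real_sqrt_mult)
  ultimately show ?thesis
    using contrast_obs[of j j i k F \<epsilon> p] assms c by simp
qed

text \<open>The blocks entering the stopping statistic on one side form, over all levels, a family with
  disjoint supports, because neighbouring candidates move the index by at most two.\<close>

definition admissible :: "nat \<Rightarrow> (nat \<Rightarrow> int) \<Rightarrow> bool" where
  "admissible J h \<longleftrightarrow> (\<forall>j\<le>J. h j \<in> {1..2 ^ j}) \<and> (\<forall>j<J. h (Suc j) \<in> {2 * h j - 2..2 * h j + 1})"

definition support :: "nat \<Rightarrow> (nat \<Rightarrow> int) \<Rightarrow> int \<Rightarrow> nat \<Rightarrow> nat set" where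
  "support J h s j = cells J j (h j + 6 * s) \<union> cells J j (h j + 5 * s)"

lemma support_disjoint:
  assumes h: "admissible J h" and s: "s = 1 \<or> s = -1" and "j0 \<le> i" "i < j" "j \<le> J"
    and r: "\<And>j. j \<in> {j0..J} \<Longrightarrow> h j + 6 * s \<in> {1..2 ^ j} \<and> h j + 5 * s \<in> {1..2 ^ j}"
  shows "support J h s i \<inter> support J h s j = {}"
proof -
  define lo where "lo j = (if s = 1 then h j + 4 else h j - 7) * 2 ^ (J - j)" for j
  define hi where "hi j = (if s = 1 then h j + 6 else h j - 5) * 2 ^ (J - j)" for j
  have sup: "lo j \<le> int k \<and> int k < hi j" if "k \<in> support J h s j" "j0 \<le> j" "j \<le> J" for k j
  proof -
    have eq: "int (nat x * 2 ^ n) = x * 2 ^ n" if "0 \<le> x" for x n using that by simp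
    have "h j + 5 * s - 1 \<ge> 0" "h j + 6 * s - 1 \<ge> 0" "h j + 5 * s \<ge> 0" "h j + 6 * s \<ge> 0"
      using r[of j] that by auto
    note e = eq[OF this(1)] eq[OF this(2)] eq[OF this(3)] eq[OF this(4)]
    obtain P :: int where P: "2 ^ (J - j) = P" "0 \<le> P" by simp
    have "((h j + 6 * s - 1) * 2 ^ (J - j) \<le> int k \<and> int k < (h j + 6 * s) * 2 ^ (J - j)) \<or>
      ((h j + 5 * s - 1) * 2 ^ (J - j) \<le> int k \<and> int k < (h j + 5 * s) * 2 ^ (J - j))"
      using that(1) unfolding support_def cells_def Un_iff atLeastLessThan_iff
        of_nat_le_iff[where 'a=int, symmetric] of_nat_less_iff[where 'a=int, symmetric] e by blast
    then show ?thesis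
      using s P(2) unfolding lo_def hi_def P(1) by (elim disjE; simp add: algebra_simps)
  qed
  have pw: "2 ^ (J - j) = 2 * (2::int) ^ (J - Suc j)" if "j < J" for j
    using that by (simp add: Suc_diff_Suc flip: power_Suc)
  have le: "lo j \<le> hi j" for j unfolding lo_def hi_def by (auto intro: mult_right_mono)
  \<comment> \<open>For \<open>s = 1\<close>,
    \<open>h (Suc j) + 6 \<le> 2 * h j + 7 \<le> 2 * (h j + 4)\<close>: in position, the finer pair
    ends before the coarser one begins. For \<open>s = -1\<close>,
    \<open>h (Suc j) - 7 \<ge> 2 * h j - 9 \<ge> 2 * (h j - 5)\<close> is the mirror image.\<close>
  have step: "(s = 1 \<longrightarrow> hi (Suc j) \<le> lo j) \<and> (s = -1 \<longrightarrow> hi j \<le> lo (Suc j))" if "j < J" for j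
  proof -
    have hh: "h (Suc j) \<in> {2 * h j - 2..2 * h j + 1}" using h that by (simp add: admissible_def)
    have "(h (Suc j) + 6) * 2 ^ (J - Suc j) \<le> ((h j + 4) * 2) * 2 ^ (J - Suc j)"
      "((h j - 5) * 2) * 2 ^ (J - Suc j) \<le> (h (Suc j) - 7) * 2 ^ (J - Suc j)"
      using hh by (intro mult_right_mono; simp)+
    then show ?thesis unfolding lo_def hi_def pw[OF that] by (auto simp: mult.assoc)
  qed
  have "(s = 1 \<longrightarrow> hi j \<le> lo i) \<and> (s = -1 \<longrightarrow> hi i \<le> lo j)"
    using \<open>i < j\<close> \<open>j \<le> J\<close>
  proof (induction j)
    case (Suc j)
    show ?case
    proof (cases "i = j")
      case True then show ?thesis using step[of j] Suc by simp
    next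
      case False
      then show ?thesis using step[of j] le[of j] Suc by force
    qed
  qed simp
  then show ?thesis using s sup[of _ i] sup[of _ j] assms(3-5) by force
qed

lemma measurable_hat_path:
  assumes "j \<le> J"
  shows "(\<lambda>g. hat_i (cell_path F \<epsilon> J (\<lambda>k. g (k, p))) j) \<in> measurable (PiM ({..<2 ^ J} \<times> {p}) (\<lambda>_. borel)) (count_space UNIV)"
proof (rule measurable_hat_i)
  fix t :: real assume t: "t \<in> {0..1}"
  have "k < 2 ^ J" if "k < nat \<lfloor>t * 2 ^ J\<rfloor>" for k
  proof -
    have "t * 2 ^ J \<le> 1 * 2 ^ J" using t by (intro mult_right_mono) auto
    then have "\<lfloor>t * 2 ^ J\<rfloor> \<le> \<lfloor>real_of_int (2 ^ J)\<rfloor>" by (intro floor_mono) simp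
    then have "\<lfloor>t * 2 ^ J\<rfloor> \<le> int (2 ^ J)" unfolding floor_of_int by simp
    then have "nat \<lfloor>t * 2 ^ J\<rfloor> \<le> 2 ^ J" by (simp only: nat_le_iff)
    then show ?thesis using that by linarith
  qed
  then show "(\<lambda>g. cell_path F \<epsilon> J (\<lambda>k. g (k, p)) t) \<in> borel_measurable (PiM ({..<2 ^ J} \<times> {p}) (\<lambda>_. borel))"
    unfolding cell_path_def
    by (intro borel_measurable_add borel_measurable_times borel_measurable_sum borel_measurable_const
        measurable_component_singleton) auto
qed

text \<open>Cut off at \<open>J\<close> and extensional, so that it takes finitely many values;
  summing over them replaces conditioning on \<open>Y_l\<close>.\<close>

definition path_upto :: "(real \<Rightarrow> real) \<Rightarrow> real \<Rightarrow> nat \<Rightarrow> 'a \<Rightarrow> nat \<Rightarrow> int" where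
  "path_upto F \<epsilon> J \<omega> = (\<lambda>j\<in>{..J}. hat_i (obs F \<epsilon> True \<omega>) j)"

lemma path_upto_admissible: "admissible J (path_upto F \<epsilon> J \<omega>)"
  using hat_i_range[of "obs F \<epsilon> True \<omega>"] hat_i_candidate[of "obs F \<epsilon> True \<omega>"]
  by (simp add: admissible_def path_upto_def del: hat_i.simps atLeastAtMost_iff)

lemma sets_path_upto: "{\<omega>\<in>space M. path_upto F \<epsilon> J \<omega> = h} \<in> sets M"
proof -
  have [measurable]: "(\<lambda>\<omega>. hat_i (obs F \<epsilon> True \<omega>) j) \<in> measurable M (count_space UNIV)" for j
    by (intro measurable_hat_i measurable_obs)
  have "{\<omega>\<in>space M. path_upto F \<epsilon> J \<omega> = h} =
    (if h \<in> extensional {..J} then {\<omega>\<in>space M. \<forall>j\<in>{..J}. hat_i (obs F \<epsilon> True \<omega>) j = h j} else {})"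
    by (auto simp: path_upto_def fun_eq_iff extensional_def)
  then show ?thesis by simp
qed

lemma measurable_exceeds: "{\<omega>\<in>space M. exceeds \<epsilon> (obs F e p \<omega>) j i s} \<in> sets M"
proof -
  have "Measurable.pred M (\<lambda>\<omega>. exceeds \<epsilon> (obs F e p \<omega>) j i s)"
    by (intro pred_exceeds measurable_obs) auto
  then show ?thesis by simp
qed

text \<open>For a fixed index path \<open>h\<close> the statistics no longer involve random indices.
  The event that \<open>h\<close> occurs uses only the cells of \<open>Y_l\<close>, the statistic of
  each level only its own group of cells of \<open>Y_s\<close>; these groups are disjoint by
  \<open>support_disjoint\<close>.\<close>

lemma chain_fixed_path:
  assumes h: "admissible J h" "h \<in> extensional {..J}" and s: "s = 1 \<or> s = -1" and n: "j0 + n \<le> Suc J"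
    and r: "\<And>j. j \<in> {j0..J} \<Longrightarrow> h j + 6 * s \<in> {1..2 ^ j} \<and> h j + 5 * s \<in> {1..2 ^ j}"
  shows "prob {\<omega>\<in>space M. path_upto F \<epsilon> J \<omega> = h \<and> (\<forall>j\<in>{j0..<j0 + n}. exceeds \<epsilon> (obs F \<epsilon> False \<omega>) j (h j) s)}
    = prob {\<omega>\<in>space M. path_upto F \<epsilon> J \<omega> = h} *
       (\<Prod>j\<in>{j0..<j0 + n}. prob {\<omega>\<in>space M. exceeds \<epsilon> (obs F \<epsilon> False \<omega>) j (h j) s})"
proof -
  \<comment> \<open>\<open>None\<close> labels the event that the selected path is \<open>h\<close>,
    \<open>Some j\<close> the exceedance at level \<open>j\<close>.\<close>
  define L where "L = insert None (Some ` {j0..<j0 + n})"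
  define A where "A l = (case l of None \<Rightarrow> {..<2 ^ J} \<times> {True} | Some j \<Rightarrow> support J h s j \<times> {False})" for l
  define D where "D j g = contrast F j (h j + 6 * s) (h j + 5 * s) + \<epsilon> *
     ((\<Sum>k\<in>cells J j (h j + 6 * s). g (k, False)) - (\<Sum>k\<in>cells J j (h j + 5 * s). g (k, False)))" for j and g :: "nat \<times> bool \<Rightarrow> real"
  define Y where "Y l g = (case l of
      None \<Rightarrow> (\<forall>j\<in>{..J}. hat_i (cell_path F \<epsilon> J (\<lambda>k. g (k, True))) j = h j)
    | Some j \<Rightarrow> 2 * noise_sd \<epsilon> j < D j g)" for l and g :: "nat \<times> bool \<Rightarrow> real"
  have sub: "A l \<subseteq> {..<2 ^ J} \<times> UNIV" if "l \<in> L" for l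
  proof (cases l)
    case (Some j)
    then have "j \<le> J" "j \<in> {j0..J}" using that n by (auto simp: L_def)
    then have "support J h s j \<subseteq> {..<2 ^ J}"
      using cells_subset[of j J] r[of j] unfolding support_def by blast
    then show ?thesis by (auto simp: A_def Some)
  qed (auto simp: A_def)
  have disj: "disjoint_family_on A L"
    unfolding disjoint_family_on_def
  proof (intro ballI impI)
    fix l l' assume l: "l \<in> L" "l' \<in> L" "l \<noteq> l'"
    have sd: "support J h s i \<inter> support J h s j = {}" if "i \<in> {j0..<j0 + n}" "j \<in> {j0..<j0 + n}" "i \<noteq> j" for i j
    proof -
      have "support J h s i \<inter> support J h s j = {}" if "i \<in> {j0..<j0 + n}" "j \<in> {j0..<j0 + n}" "i < j" for i j
        by (rule support_disjoint[OF h(1) s _ that(3), of j0]) (use that n r in auto)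
      from this[of i j] this[of j i] that show ?thesis by (cases "i < j") (auto simp: Int_commute)
    qed
    show "A l \<inter> A l' = {}"
      using l sd unfolding A_def L_def by (auto split: option.splits) (metis disjoint_iff)
  qed
  have "indep_vars (\<lambda>l. PiM (A l) (\<lambda>_. borel)) (\<lambda>l \<omega>. restrict (\<lambda>i. cell J i \<omega>) (A l)) L"
    using sub disj by (intro indep_vars_restrict[OF cells_indep])
  then have ind: "indep_vars (\<lambda>_. count_space UNIV) (\<lambda>l \<omega>. Y l (restrict (\<lambda>i. cell J i \<omega>) (A l))) L"
  proof (rule indep_vars_compose2)
    fix l assume l: "l \<in> L"
    show "Y l \<in> measurable (PiM (A l) (\<lambda>_. borel)) (count_space UNIV)"
    proof (cases l)
      case None
      have [measurable]: "(\<lambda>g. hat_i (cell_path F \<epsilon> J (\<lambda>k. g (k, True))) j) \<in> measurable (PiM (A l) (\<lambda>_. borel)) (count_space UNIV)" if "j \<in> {..J}" for j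
        using measurable_hat_path[of j J F \<epsilon> True] that by (simp add: A_def None)
      have "Measurable.pred (PiM (A l) (\<lambda>_. borel)) (\<lambda>g. \<forall>j\<in>{..J}. hat_i (cell_path F \<epsilon> J (\<lambda>k. g (k, True))) j = h j)"
        by (intro pred_intros_finite) (auto intro!: pred_count_space_const1)
      then show ?thesis by (simp add: Y_def[abs_def] None)
    next
      case (Some j)
      have [measurable]: "D j \<in> borel_measurable (PiM (A l) (\<lambda>_. borel))"
        unfolding D_def[abs_def]
        by (intro borel_measurable_add borel_measurable_times borel_measurable_diff borel_measurable_sum borel_measurable_const
          measurable_component_singleton) (auto simp: A_def Some support_def)
      have "Measurable.pred (PiM (A l) (\<lambda>_. borel)) (\<lambda>g. 2 * noise_sd \<epsilon> j < D j g)" by measurable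
      then show ?thesis by (simp add: Y_def[abs_def] Some)
    qed
  qed
  let ?E = "\<lambda>l. {\<omega>\<in>space M. Y l (restrict (\<lambda>i. cell J i \<omega>) (A l))}"
  have E: "(\<lambda>\<omega>. Y l (restrict (\<lambda>i. cell J i \<omega>) (A l))) -` {True} \<inter> space M = ?E l" for l by auto
  have "prob (\<Inter>l\<in>L. ?E l) = (\<Prod>l\<in>L. prob (?E l))"
    using indep_varsD_finite[OF ind, of "\<lambda>_. {True}"] unfolding E by (simp add: L_def)
  also have "\<dots> = prob (?E None) * (\<Prod>j\<in>{j0..<j0 + n}. prob (?E (Some j)))"
    unfolding L_def by (subst prod.insert) (auto simp: prod.reindex)
  finally have prod: "prob (\<Inter>l\<in>L. ?E l) = prob (?E None) * (\<Prod>j\<in>{j0..<j0 + n}. prob (?E (Some j)))" .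
  \<comment> \<open>Rebuilding the path from its cells preserves the increments up to level
    \<open>J\<close>, hence the selected indices.\<close>
  have EN: "?E None = {\<omega>\<in>space M. path_upto F \<epsilon> J \<omega> = h}"
  proof -
    have "hat_i (cell_path F \<epsilon> J (\<lambda>k. restrict (\<lambda>i. cell J i \<omega>) ({..<2 ^ J} \<times> {True}) (k, True))) j = hat_i (obs F \<epsilon> True \<omega>) j" if "j \<le> J" for j \<omega>
      using that
    proof (rule hat_i_cong[rotated])
      fix j i assume j: "j \<le> J"
      show "increment (cell_path F \<epsilon> J (\<lambda>k. restrict (\<lambda>i. cell J i \<omega>) ({..<2 ^ J} \<times> {True}) (k, True))) j i
        = increment (obs F \<epsilon> True \<omega>) j i"
      proof (cases "i \<in> {1..2 ^ j}")
        case True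
        have "(\<Sum>k\<in>cells J j i. restrict (\<lambda>i. cell J i \<omega>) ({..<2 ^ J} \<times> {True}) (k, True)) = (\<Sum>k\<in>cells J j i. cell J (k, True) \<omega>)"
          using cells_subset[OF j True] by (intro sum.cong) auto
        then show ?thesis
          unfolding increment_def cell_path_increment[OF j True] obs_increment[OF j True] by simp
      qed (auto simp: increment_def)
    qed
    then show ?thesis using h(2)
      by (auto simp: Y_def A_def path_upto_def fun_eq_iff extensional_def)
  qed
  have ES: "?E (Some j) = {\<omega>\<in>space M. exceeds \<epsilon> (obs F \<epsilon> False \<omega>) j (h j) s}" if j: "j \<in> {j0..<j0 + n}" for j
  proof -
    have j': "j \<le> J" "j \<in> {j0..J}" using j n by auto
    note rj = r[OF j'(2)]
    have sums: "(\<Sum>k\<in>cells J j (h j + c * s). restrict (\<lambda>i. cell J i \<omega>) (A (Some j)) (k, False)) = (\<Sum>k\<in>cells J j (h j + c * s). cell J (k, False) \<omega>)"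
      if "c = 5 \<or> c = 6" for \<omega> c
      using that by (intro sum.cong) (auto simp: A_def support_def)
    have "D j (restrict (\<lambda>i. cell J i \<omega>) (A (Some j))) = contrast (obs F \<epsilon> False \<omega>) j (h j + 6 * s) (h j + 5 * s)" for \<omega>
      unfolding D_def contrast_obs[OF j'(1) conjunct1[OF rj] conjunct2[OF rj]]
        sums[OF disjI1[OF refl]] sums[OF disjI2[OF refl]] ..
    then show ?thesis
      unfolding exceeds_iff[OF conjunct1[OF rj] conjunct2[OF rj]] by (simp add: Y_def)
  qed
  have "(\<Inter>l\<in>L. ?E l) = {\<omega>\<in>space M. path_upto F \<epsilon> J \<omega> = h \<and> (\<forall>j\<in>{j0..<j0 + n}. exceeds \<epsilon> (obs F \<epsilon> False \<omega>) j (h j) s)}"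
  proof -
    have "(\<Inter>l\<in>L. ?E l) = ?E None \<inter> (\<Inter>j\<in>{j0..<j0 + n}. ?E (Some j))" unfolding L_def by blast
    then show ?thesis unfolding EN using ES by blast
  qed
  then show ?thesis using prod unfolding EN using ES by simp
qed

text \<open>The law of total probability over the finitely many admissible index paths with property
  \<open>R\<close>. The bound \<open>p\<close> is checked on fixed paths, where every mean is
  deterministic.\<close>

lemma chain:
  fixes R :: "(nat \<Rightarrow> int) \<Rightarrow> bool"
  assumes s: "s = 1 \<or> s = -1"
    and r: "\<And>h j. R h \<Longrightarrow> admissible (j0 + n) h \<Longrightarrow> j \<in> {j0..j0 + n} \<Longrightarrow>
        h j + 6 * s \<in> {1..2 ^ j} \<and> h j + 5 * s \<in> {1..2 ^ j}"
    and p: "\<And>h j. R h \<Longrightarrow> admissible (j0 + n) h \<Longrightarrow> j \<in> {j0..<j0 + n} \<Longrightarrow>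
        prob {\<omega>\<in>space M. exceeds \<epsilon> (obs F \<epsilon> False \<omega>) j (h j) s} \<le> p"
  shows "{\<omega>\<in>space M. R (path_upto F \<epsilon> (j0 + n) \<omega>)} \<in> sets M"
    and "prob {\<omega>\<in>space M. R (path_upto F \<epsilon> (j0 + n) \<omega>) \<and>
        (\<forall>j\<in>{j0..<j0 + n}. exceeds \<epsilon> (obs F \<epsilon> False \<omega>) j (hat_i (obs F \<epsilon> True \<omega>) j) s)}
      \<le> prob {\<omega>\<in>space M. R (path_upto F \<epsilon> (j0 + n) \<omega>)} * p ^ n"
proof -
  let ?J = "j0 + n"
  define H where "H = {h \<in> Pi\<^sub>E {..?J} (\<lambda>j. {1..2 ^ j}). admissible ?J h \<and> R h}"
  have fin: "finite H" unfolding H_def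
    by (rule finite_subset[of _ "Pi\<^sub>E {..?J} (\<lambda>j. {1..2 ^ j})"]) (auto intro!: finite_PiE)
  have mem: "path_upto F \<epsilon> ?J \<omega> \<in> H \<longleftrightarrow> R (path_upto F \<epsilon> ?J \<omega>)" for \<omega>
    using path_upto_admissible[of ?J F \<epsilon> \<omega>] unfolding H_def admissible_def PiE_iff
    by (auto simp: path_upto_def simp del: hat_i.simps)
  let ?P = "\<lambda>h. {\<omega>\<in>space M. path_upto F \<epsilon> ?J \<omega> = h}"
  let ?X = "\<lambda>h \<omega>. \<forall>j\<in>{j0..<j0 + n}. exceeds \<epsilon> (obs F \<epsilon> False \<omega>) j (h j) s"
  have R_eq: "{\<omega>\<in>space M. R (path_upto F \<epsilon> ?J \<omega>)} = (\<Union>h\<in>H. ?P h)"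
    using mem by auto
  then show "{\<omega>\<in>space M. R (path_upto F \<epsilon> ?J \<omega>)} \<in> sets M"
    using fin sets_path_upto by auto
  have sX: "{\<omega>\<in>space M. path_upto F \<epsilon> ?J \<omega> = h \<and> ?X h \<omega>} \<in> sets M" for h
  proof -
    have "{\<omega>\<in>space M. path_upto F \<epsilon> ?J \<omega> = h \<and> ?X h \<omega>}
      = ?P h \<inter> {\<omega>\<in>space M. \<forall>j\<in>{j0..<j0 + n}. exceeds \<epsilon> (obs F \<epsilon> False \<omega>) j (h j) s}" by auto
    moreover have "{\<omega>\<in>space M. \<forall>j\<in>{j0..<j0 + n}. exceeds \<epsilon> (obs F \<epsilon> False \<omega>) j (h j) s} \<in> sets M"
      by (intro sets.sets_Collect_finite_All) (auto intro: measurable_exceeds)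
    ultimately show ?thesis using sets_path_upto by auto
  qed
  have path_eq: "hat_i (obs F \<epsilon> True \<omega>) j = path_upto F \<epsilon> ?J \<omega> j" if "j \<in> {j0..<j0 + n}" for j \<omega>
    using that by (simp add: path_upto_def)
  let ?L = "{\<omega>\<in>space M. R (path_upto F \<epsilon> ?J \<omega>) \<and> ?X (hat_i (obs F \<epsilon> True \<omega>)) \<omega>}"
  have L_eq: "?L = (\<Union>h\<in>H. {\<omega>\<in>space M. path_upto F \<epsilon> ?J \<omega> = h \<and> ?X h \<omega>})"
    using mem path_eq by auto
  have "prob ?L = (\<Sum>h\<in>H. prob {\<omega>\<in>space M. path_upto F \<epsilon> ?J \<omega> = h \<and> ?X h \<omega>})"
    unfolding L_eq using fin sX by (intro finite_measure_finite_Union) (auto simp: disjoint_family_on_def)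
  also have "\<dots> \<le> (\<Sum>h\<in>H. prob (?P h) * p ^ n)"
  proof (rule sum_mono)
    fix h assume h: "h \<in> H"
    have "prob {\<omega>\<in>space M. path_upto F \<epsilon> ?J \<omega> = h \<and> ?X h \<omega>}
      = prob (?P h) * (\<Prod>j\<in>{j0..<j0 + n}. prob {\<omega>\<in>space M. exceeds \<epsilon> (obs F \<epsilon> False \<omega>) j (h j) s})"
      using h by (intro chain_fixed_path s r) (auto simp: H_def PiE_def)
    also have "\<dots> \<le> prob (?P h) * (\<Prod>j\<in>{j0..<j0 + n}. p)"
      using h by (intro mult_left_mono prod_mono conjI p) (auto simp: H_def)
    finally show "prob {\<omega>\<in>space M. path_upto F \<epsilon> ?J \<omega> = h \<and> ?X h \<omega>} \<le> prob (?P h) * p ^ n" by simp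
  qed
  also have "\<dots> = prob (\<Union>h\<in>H. ?P h) * p ^ n"
    using fin sets_path_upto
    by (subst finite_measure_finite_Union) (auto simp: disjoint_family_on_def sum_distrib_right)
  finally show "prob ?L \<le> prob {\<omega>\<in>space M. R (path_upto F \<epsilon> ?J \<omega>)} * p ^ n" unfolding R_eq .
qed

end

section \<open>Coverage and expected length\<close>

lemma (in prob_space) prob_UN_le_sum:
  assumes "finite I" "\<And>i. i \<in> I \<Longrightarrow> A i \<in> sets M"
  shows "prob (\<Union>i\<in>I. A i) \<le> (\<Sum>i\<in>I. prob (A i))"
  using assms by (intro finite_measure_subadditive_finite) auto

lemma (in prob_space) prob_UN_le_card:
  assumes "finite I" "\<And>i. i \<in> I \<Longrightarrow> A i \<in> sets M" "\<And>i. i \<in> I \<Longrightarrow> prob (A i) \<le> c"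
  shows "prob (\<Union>i\<in>I. A i) \<le> real (card I) * c"
proof -
  have "(\<Sum>i\<in>I. prob (A i)) \<le> real (card I) * c" using assms(3) by (rule sum_bounded_above)
  with prob_UN_le_sum[OF assms(1,2)] show ?thesis by (rule order_trans)
qed

locale white_noise_experiment = three_brownian_motions M W B1 B2 + convex_signal_noise f \<epsilon>
  for M :: "'a measure" and W B1 B2 f \<epsilon>
begin

abbreviation "F \<equiv> drift f"
abbreviation "yl \<equiv> obs F \<epsilon> True"
abbreviation "ys \<equiv> obs F \<epsilon> False"
abbreviation "zb \<equiv> block Z"
abbreviation "sd \<equiv> noise_sd \<epsilon>"

section \<open>Means of block comparisons, and coverage\<close>

lemma zb_range: "zb j \<in> {1..2 ^ j}"
  by (rule block_range[OF minimizer_ge_0 minimizer_le_1])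

lemma contrast_antisym: "contrast G j i k = - contrast G j k i"
  by (simp add: contrast_def)

lemma increasing_away:
  assumes "t \<in> {0..1}" "t + h \<in> {0..1}" "(Z \<le> t \<and> 0 \<le> h) \<or> (t \<le> Z \<and> h \<le> 0)"
  shows "f t \<le> f (t + h)"
proof (cases "t + h = Z")
  case True
  then have "h = 0" using assms by auto
  then show ?thesis by simp
next
  case False
  define \<theta> where "\<theta> = (t - Z) / (t + h - Z)"
  have th: "0 \<le> \<theta>" "\<theta> \<le> 1" using assms False by (auto simp: \<theta>_def divide_le_eq zero_le_divide_iff)
  have "Z + \<theta> * (t + h - Z) = t" using False by (simp add: \<theta>_def)
  then have "f t \<le> mn + \<theta> * (f (t + h) - mn)" using towards_minimizer[of "t + h" \<theta>] assms th by simp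
  also have "\<dots> \<le> mn + 1 * (f (t + h) - mn)"
    using th minimum_le[OF assms(2)] by (intro add_left_mono mult_right_mono) auto
  finally show ?thesis by simp
qed

text \<open>Block \<open>i\<close> is the translate of block \<open>k\<close> by \<open>h\<close>,
  and both lie beyond the minimizer's block on the same side, so passing from \<open>t\<close> to
  \<open>t + h\<close> moves away from \<open>Z\<close>. Once the mesh exceeds \<open>rz\<close>,
  \<open>slope_away\<close> sharpens monotonicity to a rate.\<close>

lemma contrast_drift_ge:
  assumes "i \<in> {1..2 ^ j}" "k \<in> {1..2 ^ j}" "(zb j < k \<and> k < i) \<or> (i < k \<and> k < zb j)"
  shows "0 \<le> contrast F j i k"
    and "rz < mesh j \<Longrightarrow> mesh j * (mesh j * rm / rz) \<le> contrast F j i k"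
proof -
  define h where "h = of_int (i - k) * mesh j"
  have g: "grid j i = grid j k + h" "grid j (i - 1) = grid j (k - 1) + h"
    by (simp_all add: grid_def h_def algebra_simps)
  have hm: "mesh j \<le> \<bar>h\<bar>"
  proof -
    have "1 * mesh j \<le> \<bar>of_int (i - k)\<bar> * mesh j" using assms(3) mesh_pos[of j] by (intro mult_right_mono) auto
    then show ?thesis using mesh_pos[of j] by (simp add: h_def abs_mult)
  qed
  have mem: "grid j k \<in> {0..1}" "grid j (k - 1) \<in> {0..1}" "grid j i \<in> {0..1}" "grid j (i - 1) \<in> {0..1}"
    using assms by (intro grid_mem; auto)+
  have len: "grid j k - grid j (k - 1) = mesh j" by (simp add: grid_diff)
  have side: "(Z \<le> t \<and> 0 \<le> h) \<or> (t \<le> Z \<and> h \<le> 0)" if t: "t \<in> {grid j (k - 1)<..grid j k}" for t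
    using assms(3)
  proof
    assume a: "zb j < k \<and> k < i"
    then have "grid j (zb j) \<le> grid j (k - 1)" by (intro grid_mono) simp
    then show ?thesis using block_contains(2)[OF minimizer_ge_0 minimizer_le_1, of j] t a mesh_pos[of j]
      by (auto simp: h_def)
  next
    assume a: "i < k \<and> k < zb j"
    then have "grid j k \<le> grid j (zb j - 1)" by (intro grid_mono) simp
    then show ?thesis using block_contains(1)[OF minimizer_ge_0 minimizer_le_1, of j] t a mesh_pos[of j]
      by (auto simp: h_def mult_le_0_iff)
  qed
  have tm: "t \<in> {0..1}" "t + h \<in> {0..1}" if t: "t \<in> {grid j (k - 1)<..grid j k}" for t
    using t mem unfolding g by auto
  have "c * mesh j \<le> contrast F j i k" if "\<And>t. t \<in> {grid j (k - 1)<..grid j k} \<Longrightarrow> c \<le> f (t + h) - f t" for c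
    using drift_second_difference[of "grid j (k - 1)" "grid j k" h c] that mem len mesh_pos[of j]
    unfolding contrast_def g by simp
  note main = this
  show "0 \<le> contrast F j i k" using main[of 0] increasing_away[OF tm side] by simp
  assume rz: "rz < mesh j"
  show "mesh j * (mesh j * rm / rz) \<le> contrast F j i k"
  proof (subst mult.commute, rule main)
    fix t assume t: "t \<in> {grid j (k - 1)<..grid j k}"
    have "mesh j * rm / rz \<le> \<bar>h\<bar> * rm / rz"
      using hm rho_m_pos rho_z_pos by (intro divide_right_mono mult_right_mono) auto
    also have "\<dots> \<le> f (t + h) - f t" using hm rz by (intro slope_away tm side t) auto
    finally show "mesh j * rm / rz \<le> f (t + h) - f t" .
  qed
qed

text \<open>The mean of a comparison is of order \<open>mesh j\<close>, its standard deviation of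
  order \<open>sqrt (mesh j)\<close>; on fine levels the noise dominates, which forces
  stopping.\<close>

lemma contrast_drift_le:
  assumes "i \<in> {1..2 ^ j}" "k \<in> {1..2 ^ j}"
  shows "contrast F j i k \<le> (top_value - mn) * mesh j"
proof -
  have "grid j i - grid j (i - 1) = mesh j" "grid j k - grid j (k - 1) = mesh j" by (simp_all add: grid_diff)
  moreover have "grid j k \<in> {0..1}" "grid j (k - 1) \<in> {0..1}" "grid j i \<in> {0..1}" "grid j (i - 1) \<in> {0..1}"
    using assms by (intro grid_mem; auto)+
  ultimately show ?thesis
    using drift_increment_bounds(2)[of "grid j (i - 1)" "grid j i"] drift_increment_bounds(1)[of "grid j (k - 1)" "grid j k"]
      mesh_pos[of j] by (simp add: contrast_def left_diff_distrib)
qed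

lemma prob_exceeds_Phi:
  assumes "i + 6 * s \<in> {1..2 ^ j}" "i + 5 * s \<in> {1..2 ^ j}" "s \<noteq> 0" "contrast F j (i + 6 * s) (i + 5 * s) \<le> 0"
  shows "prob {\<omega>\<in>space M. exceeds \<epsilon> (ys \<omega>) j i s} \<le> Phi (-2)"
  unfolding exceeds_iff[OF assms(1,2)]
  using assms by (intro normal_upper_tail_Phi[OF contrast_normal] noise_sd_pos eps) auto

text \<open>\<open>ln (Phi (-2))\<close> is negative, so multiplying the lower bound on the ceiling
  by it reverses the inequality.\<close>

lemma Phi_power_K: 
  assumes "0 < \<alpha>" "\<alpha> < 1" shows "Phi (-2) ^ K \<alpha> \<le> \<alpha>"
proof -
  have ln: "ln (Phi (-2)) < 0" using Phi_bounds by simp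
  have "ln \<alpha> / ln (Phi (-2)) \<le> of_int \<lceil>ln \<alpha> / ln (Phi (-2))\<rceil>" by simp
  also have "\<dots> \<le> real (K \<alpha>)" unfolding K_def by simp
  finally have "real (K \<alpha>) * ln (Phi (-2)) \<le> ln \<alpha>" using ln by (simp add: neg_divide_le_eq)
  then have "ln (Phi (-2) ^ K \<alpha>) \<le> ln \<alpha>" using Phi_bounds by (simp add: ln_realpow)
  then show ?thesis using Phi_bounds assms by (subst (asm) ln_le_cancel_iff) auto
qed

lemma admissible_Suc: "admissible J h \<Longrightarrow> j < J \<Longrightarrow> h (Suc j) \<in> {2 * h j - 2..2 * h j + 1}"
  by (simp add: admissible_def)

lemma admissible_range: "admissible J h \<Longrightarrow> j \<le> J \<Longrightarrow> h j \<in> {1..2 ^ j}"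
  by (simp add: admissible_def)

text \<open>The sign \<open>s\<close> points from the selected block back to the minimizer. A
  distance of at least 7 becomes at least \<open>2 * 7 - 2 = 12\<close> at the next level, on the
  same side.\<close>

lemma admissible_stays_off:
  assumes h: "admissible J h" and s: "s = 1 \<or> s = -1" and "7 \<le> - s * (h n - zb n)" "n \<le> j" "j \<le> J"
  shows "7 \<le> - s * (h j - zb j)"
  using assms(4,5)
proof (induction j rule: dec_induct)
  case (step j)
  then show ?case
    using admissible_Suc[OF h, of j] block_Suc[OF minimizer_ge_0, of j] s by auto
qed (use assms in simp)

text \<open>Both blocks lie strictly between the selected block and the minimizer's block, so they
  are in range; the one six steps away is nearer to the minimizer and its mean is no larger.\<close>

lemma off_range:
  assumes h: "admissible J h" and s: "s = 1 \<or> s = -1" and off: "7 \<le> - s * (h j - zb j)" and "j \<le> J"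
  shows "h j + 6 * s \<in> {1..2 ^ j} \<and> h j + 5 * s \<in> {1..2 ^ j}" "contrast F j (h j + 6 * s) (h j + 5 * s) \<le> 0"
proof -
  show r: "h j + 6 * s \<in> {1..2 ^ j} \<and> h j + 5 * s \<in> {1..2 ^ j}"
    using admissible_range[OF h \<open>j \<le> J\<close>] zb_range[of j] s off by auto
  have "0 \<le> contrast F j (h j + 5 * s) (h j + 6 * s)"
    using r s off by (intro contrast_drift_ge) auto
  then show "contrast F j (h j + 6 * s) (h j + 5 * s) \<le> 0"
    using contrast_antisym[of F j "h j + 5 * s" "h j + 6 * s"] by simp
qed

definition off_side :: "nat \<Rightarrow> int \<Rightarrow> (nat \<Rightarrow> int) \<Rightarrow> bool" where
  "off_side n s h \<longleftrightarrow> 7 \<le> - s * (h n - zb n) \<and> (\<forall>m<n. \<bar>h m - zb m\<bar> \<le> 6)"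

lemma first_off_iff: 
  "first_off Z (yl \<omega>) n \<longleftrightarrow> off_side n 1 (path_upto F \<epsilon> (n + k) \<omega>) \<or> off_side n (-1) (path_upto F \<epsilon> (n + k) \<omega>)"
  by (auto simp: first_off_def off_side_def offset_def path_upto_def abs_if)

text \<open>Continuing requires an exceedance on the inner side, where the mean is nonpositive from
  level \<open>n\<close> on; \<open>chain\<close> with \<open>p = Phi (-2)\<close> over
  \<open>K \<alpha>\<close> levels gives the factor \<open>\<alpha>\<close>.\<close>

lemma prob_first_off:
  assumes \<alpha>: "0 < \<alpha>" "\<alpha> < 1"
  shows "{\<omega>\<in>space M. first_off Z (yl \<omega>) n} \<in> sets M"
    and "prob {\<omega>\<in>space M. first_off Z (yl \<omega>) n \<and> (\<forall>j\<in>{n..<n + K \<alpha>}. continues \<epsilon> (yl \<omega>) (ys \<omega>) j)}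
       \<le> \<alpha> * prob {\<omega>\<in>space M. first_off Z (yl \<omega>) n}"
proof -
  let ?k = "K \<alpha>"
  let ?R = "\<lambda>s. {\<omega>\<in>space M. off_side n s (path_upto F \<epsilon> (n + ?k) \<omega>)}"
  let ?X = "\<lambda>s. {\<omega>\<in>space M. off_side n s (path_upto F \<epsilon> (n + ?k) \<omega>) \<and>
        (\<forall>j\<in>{n..<n + ?k}. exceeds \<epsilon> (ys \<omega>) j (hat_i (yl \<omega>) j) s)}"
  have c: "?R s \<in> sets M" "prob (?X s) \<le> prob (?R s) * Phi (-2) ^ ?k" if s: "s = 1 \<or> s = -1" for s
  proof -
    have off: "7 \<le> - s * (h j - zb j)" if "off_side n s h" "admissible (n + ?k) h" "j \<in> {n..n + ?k}" for h j
    proof -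
      have a: "7 \<le> - s * (h n - zb n)" using that(1) unfolding off_side_def by (rule conjunct1)
      have b: "n \<le> j" "j \<le> n + ?k" using that(3) by simp_all
      show ?thesis by (rule admissible_stays_off[OF that(2) s a b])
    qed
    have r: "h j + 6 * s \<in> {1..2 ^ j} \<and> h j + 5 * s \<in> {1..2 ^ j}"
      if "off_side n s h" "admissible (n + ?k) h" "j \<in> {n..n + ?k}" for h j
      using off_range(1)[OF that(2) s off[OF that]] that by simp
    have p: "prob {\<omega>\<in>space M. exceeds \<epsilon> (ys \<omega>) j (h j) s} \<le> Phi (-2)"
      if "off_side n s h" "admissible (n + ?k) h" "j \<in> {n..<n + ?k}" for h j
    proof -
      have j: "j \<in> {n..n + ?k}" "j \<le> n + ?k" using that by auto
      note off_range[OF that(2) s off[OF that(1,2) j(1)] j(2)]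
      then show ?thesis using s by (intro prob_exceeds_Phi) auto
    qed
    show "?R s \<in> sets M" by (rule chain(1)[where R="off_side n s" and n="?k" and ?j0.0=n and p="Phi (-2)" and F=F and \<epsilon>=\<epsilon>, OF s]; (erule (2) r | erule (2) p))
    show "prob (?X s) \<le> prob (?R s) * Phi (-2) ^ ?k" by (rule chain(2)[where R="off_side n s" and n="?k" and ?j0.0=n and p="Phi (-2)" and F=F and \<epsilon>=\<epsilon>, OF s]; (erule (2) r | erule (2) p))
  qed
  have sub: "prob (?X s) \<le> \<alpha> * prob (?R s)" if s: "s = 1 \<or> s = -1" for s
  proof -
    have "prob (?R s) * Phi (-2) ^ ?k \<le> prob (?R s) * \<alpha>"
      by (intro mult_left_mono Phi_power_K \<alpha>) auto
    with c(2)[OF s] show ?thesis by (simp add: mult.commute)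
  qed
  have R: "{\<omega>\<in>space M. first_off Z (yl \<omega>) n} = ?R 1 \<union> ?R (-1)"
    unfolding first_off_iff[where k="?k"] by blast
  then show "{\<omega>\<in>space M. first_off Z (yl \<omega>) n} \<in> sets M" using c(1) by auto
  have Xsets: "?X s \<in> sets M" if s: "s = 1 \<or> s = -1" for s
  proof -
    have "Measurable.pred M (\<lambda>\<omega>. exceeds \<epsilon> (ys \<omega>) j (hat_i (yl \<omega>) j) s)" for j
      by (intro pred_exceeds measurable_hat_i measurable_obs)
    then have "{\<omega>\<in>space M. \<forall>j\<in>{n..<n + ?k}. exceeds \<epsilon> (ys \<omega>) j (hat_i (yl \<omega>) j) s} \<in> sets M"
      by (intro sets.sets_Collect_finite_All) auto
    moreover have "?X s = ?R s \<inter> {\<omega>\<in>space M. \<forall>j\<in>{n..<n + ?k}. exceeds \<epsilon> (ys \<omega>) j (hat_i (yl \<omega>) j) s}" by blast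
    ultimately show ?thesis using c(1)[OF s] by simp
  qed
  have "prob {\<omega>\<in>space M. first_off Z (yl \<omega>) n \<and> (\<forall>j\<in>{n..<n + ?k}. continues \<epsilon> (yl \<omega>) (ys \<omega>) j)}
     \<le> prob (?X 1 \<union> ?X (-1))"
    using Xsets unfolding first_off_iff[where k="?k"] continues_iff[OF eps]
    by (intro finite_measure_mono) blast+
  also have "\<dots> \<le> prob (?X 1) + prob (?X (-1))" by (intro measure_Un_le Xsets) auto
  also have "\<dots> \<le> \<alpha> * prob (?R 1) + \<alpha> * prob (?R (-1))" by (intro add_mono sub) auto
  also have "\<dots> = \<alpha> * prob (?R 1 \<union> ?R (-1))"
  proof -
    \<comment> \<open>The first excursion is on one side only, so splitting by side costs no factor
      2.\<close>
    have "?R 1 \<inter> ?R (-1) = {}" by (auto simp: off_side_def)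
    then have "prob (?R 1 \<union> ?R (-1)) = prob (?R 1) + prob (?R (-1))"
      by (rule finite_measure_Union[OF c(1)[OF disjI1[OF refl]] c(1)[OF disjI2[OF refl]]])
    then show ?thesis by (simp only: distrib_left)
  qed
  finally show "prob {\<omega>\<in>space M. first_off Z (yl \<omega>) n \<and> (\<forall>j\<in>{n..<n + ?k}. continues \<epsilon> (yl \<omega>) (ys \<omega>) j)}
       \<le> \<alpha> * prob {\<omega>\<in>space M. first_off Z (yl \<omega>) n}" unfolding R .
qed

lemma pred_continues_obs: "Measurable.pred M (\<lambda>\<omega>. continues \<epsilon> (yl \<omega>) (ys \<omega>) j)"
  by (intro pred_continues measurable_obs eps)

text \<open>Non-coverage lies in the union of the \<open>B n\<close>, each of probability at most
  \<open>\<alpha>\<close> times that of \<open>A n\<close>. The \<open>A n\<close> are disjoint, so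
  the sum over all \<open>n\<close> stays below \<open>\<alpha>\<close>.\<close>

lemma coverage:
  assumes \<alpha>: "0 < \<alpha>" "\<alpha> < 1"
  shows "confidence_interval M \<alpha> Z (\<lambda>\<omega>. CI_lower \<alpha> \<epsilon> (yl \<omega>) (ys \<omega>)) (\<lambda>\<omega>. CI_upper \<alpha> \<epsilon> (yl \<omega>) (ys \<omega>))"
proof -
  let ?lo = "\<lambda>\<omega>. CI_lower \<alpha> \<epsilon> (yl \<omega>) (ys \<omega>)" and ?hi = "\<lambda>\<omega>. CI_upper \<alpha> \<epsilon> (yl \<omega>) (ys \<omega>)"
  have [measurable]: "?lo \<in> borel_measurable M" "?hi \<in> borel_measurable M"
    by (intro measurable_CI measurable_obs eps; assumption)+
  let ?C = "{\<omega>\<in>space M. Z \<in> {?lo \<omega>..?hi \<omega>}}"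
  let ?N = "{\<omega>\<in>space M. Z \<notin> {?lo \<omega>..?hi \<omega>}}"
  have C: "?C \<in> sets M" and N: "?N \<in> sets M" unfolding atLeastAtMost_iff by measurable
  define A where "A n = {\<omega>\<in>space M. first_off Z (yl \<omega>) n}" for n
  define B where "B n = {\<omega>\<in>space M. first_off Z (yl \<omega>) n \<and> (\<forall>j\<in>{n..<n + K \<alpha>}. continues \<epsilon> (yl \<omega>) (ys \<omega>) j)}" for n
  have A: "A n \<in> sets M" for n unfolding A_def by (rule prob_first_off(1)[OF \<alpha>])
  have B: "B n \<in> sets M" for n
  proof -
    have "{\<omega>\<in>space M. \<forall>j\<in>{n..<n + K \<alpha>}. continues \<epsilon> (yl \<omega>) (ys \<omega>) j} \<in> sets M"
      using pred_continues_obs by (intro sets.sets_Collect_finite_All) auto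
    moreover have "B n = A n \<inter> {\<omega>\<in>space M. \<forall>j\<in>{n..<n + K \<alpha>}. continues \<epsilon> (yl \<omega>) (ys \<omega>) j}"
      unfolding A_def B_def by blast
    ultimately show ?thesis using A[of n] by simp
  qed
  have dA: "disjoint_family A"
    unfolding disjoint_family_on_def
  proof (intro ballI impI)
    fix m n :: nat assume "m \<noteq> n"
    then show "A m \<inter> A n = {}"
    proof (induction m n rule: linorder_wlog)
      case (le a b)
      then have "a < b" by simp
      then show ?case unfolding A_def first_off_def by fastforce
    qed (simp add: Int_commute)
  qed
  have "?N \<subseteq> (\<Union>n. B n)"
  proof
    fix \<omega> assume w: "\<omega> \<in> ?N"
    then have "\<omega> \<in> space M \<and> Z \<notin> {?lo \<omega>..?hi \<omega>}" unfolding mem_Collect_eq .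
    note conjunct2[OF this]
    from not_covered[OF minimizer_ge_0 minimizer_le_1 this]
    show "\<omega> \<in> (\<Union>n. B n)" using w unfolding B_def by blast
  qed
  then have "emeasure M ?N \<le> emeasure M (\<Union>n. B n)" using B by (intro emeasure_mono) auto
  also have "\<dots> \<le> (\<Sum>n. emeasure M (B n))" using B by (intro emeasure_subadditive_countably) auto
  also have "\<dots> \<le> (\<Sum>n. ennreal \<alpha> * emeasure M (A n))"
  proof (intro suminf_le)
    fix n
    have "ennreal (prob (B n)) \<le> ennreal (\<alpha> * prob (A n))"
      unfolding A_def B_def by (intro ennreal_leI prob_first_off(2) \<alpha>)
    then show "emeasure M (B n) \<le> ennreal \<alpha> * emeasure M (A n)"
      using \<alpha> by (simp add: emeasure_eq_measure ennreal_mult)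
  qed auto
  also have "\<dots> = ennreal \<alpha> * emeasure M (\<Union>n. A n)"
    unfolding ennreal_suminf_cmult using A dA by (subst suminf_emeasure) auto
  also have "\<dots> \<le> ennreal \<alpha> * 1" by (intro mult_left_mono measure_le_1) auto
  finally have "prob ?N \<le> \<alpha>" using \<alpha> by (simp add: emeasure_eq_measure)
  moreover have "?C = space M - ?N" by auto
  then have "prob ?C = 1 - prob ?N" using prob_compl[OF N] by simp
  ultimately show ?thesis
    unfolding confidence_interval_def using CI_lower_le_upper by auto
qed

section \<open>Almost sure stopping and expected length\<close>

lemma mesh_antimono: "i \<le> j \<Longrightarrow> mesh j \<le> mesh i"
  by (simp add: mesh_def field_simps power_increasing)

lemma ex_mesh_less: "0 < c \<Longrightarrow> \<exists>j. mesh j < c"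
  using real_arch_pow_inv[of c "1/2"] by (auto simp: mesh_def power_one_over)

text \<open>Six blocks of room on side \<open>s\<close> survive refinement:
  \<open>2 * h + 1 + 6 \<le> 2 * (h + 6)\<close> on the right and
  \<open>2 * h - 2 - 6 \<ge> 2 * (h - 6)\<close> on the left.\<close>

lemma side_persists:
  assumes h: "admissible J h" and s: "s = 1 \<or> s = -1" and "h n + 6 * s \<in> {1..2 ^ n}" "n \<le> j" "j \<le> J"
  shows "h j + 6 * s \<in> {1..2 ^ j}"
  using assms(4,5)
proof (induction j rule: dec_induct)
  case (step j)
  then show ?case
    using admissible_Suc[OF h, of j] admissible_range[OF h, of j] admissible_range[OF h, of "Suc j"] s by auto
qed (use assms in simp)

text \<open>\<open>hat_j\<close> is meaningful only if some level stops. On fine levels the mean is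
  at most half a standard deviation, so a finite side statistic exceeds two of them with probability
  at most \<open>1 / (3/2)^2 = 4/9\<close>, and \<open>chain\<close> gives \<open>(4/9)^n\<close>
  for \<open>n\<close> further levels. A missing side counts as infinite, hence a side with room is
  followed.\<close>

lemma AE_stops: "AE \<omega> in M. \<not> continues \<epsilon> (yl \<omega>) (ys \<omega>) (hat_j \<epsilon> (yl \<omega>) (ys \<omega>))"
proof -
  define V where "V = (top_value - mn)\<^sup>2 + 1"
  have V: "0 < V" "(top_value - mn)\<^sup>2 \<le> V" by (simp_all add: V_def add_nonneg_pos)
  \<comment> \<open>Chosen so that \<open>V * mesh^2\<close> stays below
    \<open>(sd / 2)^2 = 3/2 * \<epsilon>^2 * mesh\<close>.\<close>
  obtain J1 where J1: "mesh J1 < 3/2 * \<epsilon>\<^sup>2 / V" using ex_mesh_less[of "3/2 * \<epsilon>\<^sup>2 / V"] V eps by auto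
  define J where "J = max 4 J1"
  have small: "(top_value - mn) * mesh j \<le> 1/2 * sd j" if "J \<le> j" for j
  proof -
    have "mesh j < 3/2 * \<epsilon>\<^sup>2 / V" using mesh_antimono[of J1 j] that J1 by (simp add: J_def)
    then have "V * mesh j \<le> 3/2 * \<epsilon>\<^sup>2" using V by (simp add: field_simps)
    moreover have "(top_value - mn)\<^sup>2 * mesh j \<le> V * mesh j" using V mesh_pos[of j] by (intro mult_right_mono) auto
    ultimately have "(top_value - mn)\<^sup>2 * mesh j \<le> 3/2 * \<epsilon>\<^sup>2" by (rule order_trans[rotated])
    then have "(top_value - mn)\<^sup>2 * mesh j * mesh j \<le> 3/2 * \<epsilon>\<^sup>2 * mesh j" using mesh_pos[of j] by (intro mult_right_mono) auto
    moreover have "(top_value - mn)\<^sup>2 * mesh j * mesh j = ((top_value - mn) * mesh j)\<^sup>2"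
      by (simp only: power2_eq_square ac_simps)
    moreover have "(1/2 * sd j)\<^sup>2 = 3/2 * \<epsilon>\<^sup>2 * mesh j"
      using mesh_pos[of j] by (simp add: noise_sd_def power_mult_distrib power_divide)
    ultimately have "((top_value - mn) * mesh j)\<^sup>2 \<le> (1/2 * sd j)\<^sup>2"
      by (simp only:)
    then show ?thesis by (rule power2_le_imp_le) (use noise_sd_pos[OF eps, of j] in simp)
  qed
  have tail: "prob {\<omega>\<in>space M. exceeds \<epsilon> (ys \<omega>) j i s} \<le> 4/9"
    if r: "i + 6 * s \<in> {1..2 ^ j}" "i + 5 * s \<in> {1..2 ^ j}" and s: "s = 1 \<or> s = -1" and j: "J \<le> j" for i s j
  proof -
    let ?\<mu> = "contrast F j (i + 6 * s) (i + 5 * s)"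
    have ne: "i + 6 * s \<noteq> i + 5 * s" using s by auto
    note D = contrast_normal[OF eps r ne, of F False]
    have [measurable]: "(\<lambda>\<omega>. contrast (ys \<omega>) j (i + 6 * s) (i + 5 * s)) \<in> borel_measurable M"
      using D by (auto simp: distributed_def)
    have "?\<mu> + 3/2 * sd j \<le> 2 * sd j" using contrast_drift_le[OF r] small[OF j] by simp
    then have "prob {\<omega>\<in>space M. exceeds \<epsilon> (ys \<omega>) j i s} \<le> prob {\<omega>\<in>space M. ?\<mu> + 3/2 * sd j \<le> contrast (ys \<omega>) j (i + 6 * s) (i + 5 * s)}"
      unfolding exceeds_iff[OF r] by (intro finite_measure_mono) auto
    also have "\<dots> \<le> 1 / (3/2)\<^sup>2" by (intro normal_tail_Chebyshev(1)[OF D] noise_sd_pos eps) simp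
    finally show ?thesis by (simp add: power2_eq_square)
  qed
  let ?N = "{\<omega>\<in>space M. \<forall>j. continues \<epsilon> (yl \<omega>) (ys \<omega>) j}"
  have Ns: "?N \<in> sets M" using pred_continues_obs by (intro sets.sets_Collect_countable_All) auto
  have bound: "prob ?N \<le> 2 * (4/9) ^ n" for n
  proof -
    let ?X = "\<lambda>s. {\<omega>\<in>space M. path_upto F \<epsilon> (J + n) \<omega> J + 6 * s \<in> {1..2 ^ J} \<and>
        (\<forall>j\<in>{J..<J + n}. exceeds \<epsilon> (ys \<omega>) j (hat_i (yl \<omega>) j) s)}"
    let ?R = "\<lambda>s. {\<omega>\<in>space M. path_upto F \<epsilon> (J + n) \<omega> J + 6 * s \<in> {1..2 ^ J}}"
    have X: "?X s \<in> sets M \<and> prob (?X s) \<le> (4/9) ^ n" if s: "s = 1 \<or> s = -1" for s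
    proof
      have r: "h j + 6 * s \<in> {1..2 ^ j} \<and> h j + 5 * s \<in> {1..2 ^ j}"
        if "h J + 6 * s \<in> {1..2 ^ J}" "admissible (J + n) h" "j \<in> {J..J + n}" for h j
        using side_persists[OF that(2) s that(1), of j] admissible_range[OF that(2), of j] s that(3) by auto
      have t: "prob {\<omega>\<in>space M. exceeds \<epsilon> (ys \<omega>) j (h j) s} \<le> 4/9"
        if "h J + 6 * s \<in> {1..2 ^ J}" "admissible (J + n) h" "j \<in> {J..<J + n}" for h j
        using r[OF that(1,2), of j] that(3) by (intro tail s) auto
      have "prob (?X s) \<le> prob (?R s) * (4/9) ^ n"
        by (rule chain(2)[where R="\<lambda>h. h J + 6 * s \<in> {1..2 ^ J}" and n=n and ?j0.0=J and p="4/9" and F=F and \<epsilon>=\<epsilon>, OF s]; (erule (2) r | erule (2) t))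
      also have "\<dots> \<le> 1 * (4/9) ^ n" by (intro mult_right_mono) auto
      finally show "prob (?X s) \<le> (4/9) ^ n" by simp
      have R: "?R s \<in> sets M"
        by (rule chain(1)[where R="\<lambda>h. h J + 6 * s \<in> {1..2 ^ J}" and n=n and ?j0.0=J and p="4/9" and F=F and \<epsilon>=\<epsilon>, OF s]; (erule (2) r | erule (2) t))
      have "Measurable.pred M (\<lambda>\<omega>. exceeds \<epsilon> (ys \<omega>) j (hat_i (yl \<omega>) j) s)" for j
        by (intro pred_exceeds measurable_hat_i measurable_obs)
      then have "{\<omega>\<in>space M. \<forall>j\<in>{J..<J + n}. exceeds \<epsilon> (ys \<omega>) j (hat_i (yl \<omega>) j) s} \<in> sets M"
        by (intro sets.sets_Collect_finite_All) auto
      moreover have "?X s = ?R s \<inter> {\<omega>\<in>space M. \<forall>j\<in>{J..<J + n}. exceeds \<epsilon> (ys \<omega>) j (hat_i (yl \<omega>) j) s}" by blast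
      ultimately show "?X s \<in> sets M" using R by simp
    qed
    \<comment> \<open>With at least 16 blocks, every index has six further blocks on its right or on
      its left.\<close>
    have "(2::int) ^ 4 \<le> 2 ^ J" unfolding J_def by (intro power_increasing) auto
    then have ex: "h + 6 * 1 \<in> {1..2 ^ J} \<or> h + 6 * (-1) \<in> {1..2 ^ J}" if "h \<in> {1..2 ^ J}" for h :: int
      using that by auto
    have "?N \<subseteq> ?X 1 \<union> ?X (-1)"
    proof
      fix \<omega> assume w: "\<omega> \<in> ?N"
      have "path_upto F \<epsilon> (J + n) \<omega> J = hat_i (yl \<omega>) J" by (simp add: path_upto_def)
      then show "\<omega> \<in> ?X 1 \<union> ?X (-1)" using w ex[OF hat_i_range[of "yl \<omega>" J]] unfolding continues_iff[OF eps] by auto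
    qed
    note X1 = X[OF disjI1[OF refl]] and X2 = X[OF disjI2[OF refl]]
    have "prob ?N \<le> prob (?X 1 \<union> ?X (-1))"
      by (rule finite_measure_mono[OF \<open>?N \<subseteq> _\<close> sets.Un[OF conjunct1[OF X1] conjunct1[OF X2]]])
    also have "\<dots> \<le> prob (?X 1) + prob (?X (-1))" by (rule measure_Un_le[OF conjunct1[OF X1] conjunct1[OF X2]])
    also have "\<dots> \<le> (4/9) ^ n + (4/9) ^ n" by (rule add_mono[OF conjunct2[OF X1] conjunct2[OF X2]])
    finally show ?thesis by simp
  qed
  have "prob ?N \<le> 0"
  proof (rule LIMSEQ_le_const)
    show "(\<lambda>n. 2 * (4/9::real) ^ n) \<longlonglongrightarrow> 0"
      by (intro tendsto_mult_right_zero LIMSEQ_power_zero) simp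
  qed (use bound in auto)
  then have "prob ?N = 0" by (simp add: measure_le_0_iff)
  then have "AE \<omega> in M. \<not> (\<forall>j. continues \<epsilon> (yl \<omega>) (ys \<omega>) j)"
    using Ns by (subst AE_iff_measurable[OF Ns]) (auto simp: emeasure_eq_measure)
  then show ?thesis by eventually_elim (use hat_j_stops in blast)
qed

text \<open>\<open>a\<close> is the guaranteed mean in standard deviations. Its square is
  \<open>mesh^3 * rm^2 / (6 * rz^2 * \<epsilon>^2)\<close>, which \<open>rho_product_ge\<close>
  bounds below by \<open>mesh^3 / (16 * rz^3)\<close>.\<close>

lemma signal_ratio:
  assumes "8 * rz < mesh j"
  defines "a \<equiv> mesh j * (mesh j * rm / rz) / sd j"
  shows "16 * rz ^ 3 / mesh j ^ 3 \<ge> 1 / a\<^sup>2" "2 < a" "40 * rz ^ 3 / mesh j ^ 3 \<ge> 1 / (a - 2)\<^sup>2"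
proof -
  let ?m = "mesh j"
  have sd2: "(sd j)\<^sup>2 = 6 * ?m * \<epsilon>\<^sup>2" using mesh_pos[of j] by (simp add: noise_sd_def)
  have a0: "0 < a" unfolding a_def using mesh_pos[of j] rho_m_pos rho_z_pos noise_sd_pos[OF eps, of j] by simp
  have a2: "a\<^sup>2 = ?m ^ 3 * (rm\<^sup>2 / (6 * rz\<^sup>2 * \<epsilon>\<^sup>2))"
    unfolding a_def power_divide power_mult_distrib sd2 using mesh_pos[of j] rho_z_pos eps
    by (simp add: field_simps power2_eq_square power3_eq_cube)
  have "1 / (16 * rz ^ 3) \<le> rm\<^sup>2 / (6 * rz\<^sup>2 * \<epsilon>\<^sup>2)"
  proof -
    have "6 * \<epsilon>\<^sup>2 \<le> 16 * (rz * rm\<^sup>2)" using rho_product_ge by simp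
    then have "6 * \<epsilon>\<^sup>2 * rz\<^sup>2 \<le> 16 * (rz * rm\<^sup>2) * rz\<^sup>2" by (intro mult_right_mono) auto
    then show ?thesis using rho_z_pos eps by (simp add: divide_simps power2_eq_square power3_eq_cube mult_ac)
  qed
  then have "?m ^ 3 * (1 / (16 * rz ^ 3)) \<le> a\<^sup>2"
    unfolding a2 using mesh_pos[of j] by (intro mult_left_mono) auto
  then have A: "?m ^ 3 / (16 * rz ^ 3) \<le> a\<^sup>2" by simp
  have pos: "0 < ?m ^ 3 / (16 * rz ^ 3)" using mesh_pos[of j] rho_z_pos by simp
  show 1: "16 * rz ^ 3 / ?m ^ 3 \<ge> 1 / a\<^sup>2"
    using le_imp_inverse_le[OF A pos] by (simp add: field_simps)
  \<comment> \<open>\<open>8^3 / 16 = 32\<close> exceeds \<open>(28/5)^2 = 31.36\<close>, hence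
    \<open>a \<ge> 28/5\<close>.\<close>
  have "(8 * rz) ^ 3 \<le> ?m ^ 3" using assms(1) rho_z_pos by (intro power_mono) auto
  then have "32 \<le> ?m ^ 3 / (16 * rz ^ 3)" using rho_z_pos by (simp add: field_simps)
  then have "(28/5)\<^sup>2 \<le> a\<^sup>2" using A by (simp add: power2_eq_square)
  then have a: "28/5 \<le> a" using a0 by (intro power2_le_imp_le[of "28/5"]) auto
  then show "2 < a" by simp
  \<comment> \<open>Holds from \<open>a \<ge> 50/9\<close> on. As
    \<open>(16/25)^2 \<ge> 2/5\<close>, reserving two standard deviations for the stopping threshold
    costs a factor \<open>5/2\<close>: 40 instead of 16.\<close>
  have "16/25 * a \<le> a - 2" using a by simp
  then have "(16/25 * a)\<^sup>2 \<le> (a - 2)\<^sup>2" using a0 by (intro power_mono) auto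
  moreover have "2/5 * a\<^sup>2 \<le> (16/25 * a)\<^sup>2" by (simp add: power2_eq_square)
  ultimately have "2/5 * a\<^sup>2 \<le> (a - 2)\<^sup>2" by (rule order_trans[rotated])
  then have "1 / (a - 2)\<^sup>2 \<le> 1 / (2/5 * a\<^sup>2)" using a0 a by (intro divide_left_mono) auto
  also have "\<dots> = 5/2 * (1 / a\<^sup>2)" by simp
  also have "\<dots> \<le> 5/2 * (16 * rz ^ 3 / ?m ^ 3)" using 1 by (intro mult_left_mono) auto
  finally show "40 * rz ^ 3 / ?m ^ 3 \<ge> 1 / (a - 2)\<^sup>2" by simp
qed

text \<open>The threshold 0 governs the choice of the smallest increment, the threshold
  \<open>2 * sd j\<close> the stopping rule.\<close>

lemma prob_contrast_small:
  assumes m: "8 * rz < mesh j" and r: "i \<in> {1..2 ^ j}" "k \<in> {1..2 ^ j}" "(zb j < k \<and> k < i) \<or> (i < k \<and> k < zb j)"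
  shows "prob {\<omega>\<in>space M. contrast (obs F \<epsilon> p \<omega>) j i k \<le> 0} \<le> 16 * rz ^ 3 / mesh j ^ 3"
    and "prob {\<omega>\<in>space M. contrast (obs F \<epsilon> p \<omega>) j i k \<le> 2 * sd j} \<le> 40 * rz ^ 3 / mesh j ^ 3"
    and "(\<lambda>\<omega>. contrast (obs F \<epsilon> p \<omega>) j i k) \<in> borel_measurable M"
proof -
  define a where "a = mesh j * (mesh j * rm / rz) / sd j"
  let ?\<mu> = "contrast F j i k"
  have s: "0 < sd j" by (rule noise_sd_pos[OF eps])
  have "rz < mesh j" using m rho_z_pos by simp
  then have mu: "a * sd j \<le> ?\<mu>" using contrast_drift_ge(2)[OF r] s by (simp add: a_def)
  have ne: "i \<noteq> k" using r(3) by auto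
  note D = contrast_normal[OF eps r(1,2) ne, of F p]
  note R = signal_ratio[OF m, folded a_def]
  show [measurable]: "(\<lambda>\<omega>. contrast (obs F \<epsilon> p \<omega>) j i k) \<in> borel_measurable M"
    using D by (auto simp: distributed_def)
  have "prob {\<omega>\<in>space M. contrast (obs F \<epsilon> p \<omega>) j i k \<le> 0}
      \<le> prob {\<omega>\<in>space M. contrast (obs F \<epsilon> p \<omega>) j i k \<le> ?\<mu> - a * sd j}"
    using mu by (intro finite_measure_mono) auto
  also have "\<dots> \<le> 1 / a\<^sup>2" using R s by (intro normal_tail_Chebyshev(2)[OF D]) auto
  finally show "prob {\<omega>\<in>space M. contrast (obs F \<epsilon> p \<omega>) j i k \<le> 0} \<le> 16 * rz ^ 3 / mesh j ^ 3" using R by linarith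
  have "prob {\<omega>\<in>space M. contrast (obs F \<epsilon> p \<omega>) j i k \<le> 2 * sd j}
      \<le> prob {\<omega>\<in>space M. contrast (obs F \<epsilon> p \<omega>) j i k \<le> ?\<mu> - (a - 2) * sd j}"
    using mu by (intro finite_measure_mono) (auto simp: left_diff_distrib)
  also have "\<dots> \<le> 1 / (a - 2)\<^sup>2" using R s by (intro normal_tail_Chebyshev(2)[OF D]) auto
  finally show "prob {\<omega>\<in>space M. contrast (obs F \<epsilon> p \<omega>) j i k \<le> 2 * sd j} \<le> 40 * rz ^ 3 / mesh j ^ 3" using R by linarith
qed

lemma contrast_le_0:
  assumes "i \<in> {1..2 ^ j}" "k \<in> {1..2 ^ j}" "increment y j i \<le> increment y j k"
  shows "contrast y j i k \<le> 0"
  using assms by (simp add: contrast_def increment_def)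

text \<open>If the localization is off by at least two blocks, then at the first such level a block farther
  from the minimizer has beaten the neighbour of the minimizer's block on the same side.\<close>

definition mislocated :: "(real \<Rightarrow> real) \<Rightarrow> nat \<Rightarrow> int \<Rightarrow> int \<Rightarrow> bool" where
  "mislocated y i s d \<longleftrightarrow> zb i + s * d \<in> {1..2 ^ i} \<and> zb i + s \<in> {1..2 ^ i} \<and>
     contrast y i (zb i + s * d) (zb i + s) \<le> 0"

lemma ex_mislocated:
  "2 \<le> \<bar>offset Z y j\<bar> \<Longrightarrow> \<exists>i\<le>j. \<exists>s\<in>{1, -1}. \<exists>d\<in>{2, 3, 4}. mislocated y i s d"
proof (induction j)
  case 0
  then show ?case using offset_0[OF minimizer_ge_0 minimizer_le_1, of y] by simp
next
  case (Suc j)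
  show ?case
  proof (cases "2 \<le> \<bar>offset Z y j\<bar>")
    case True
    then show ?thesis using Suc.IH le_SucI by blast
  next
    case False
    \<comment> \<open>The previous offset was at most 1, so the new one is at most
      \<open>2 * 1 + 2 = 4\<close>, and the neighbour of the minimizer's block towards
      \<open>h\<close> is a candidate as well.\<close>
    define b h o' where "b = zb (Suc j)" and "h = hat_i y (Suc j)" and "o' = offset Z y (Suc j)"
    have hb: "h = b + o'" by (simp add: b_def h_def o'_def offset_def)
    have b: "b = 2 * zb j - 1 \<or> b = 2 * zb j" using block_Suc[OF minimizer_ge_0, of j] by (simp add: b_def)
    have hj: "\<bar>hat_i y j - zb j\<bar> \<le> 1" using False by (simp add: offset_def)
    have c: "h \<in> {2 * hat_i y j - 2..2 * hat_i y j + 1}" using hat_i_candidate[of y j] by (simp add: h_def)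
    have hr: "h \<in> {1..2 ^ Suc j}" using hat_i_range[of y "Suc j"] by (simp only: h_def)
    have br: "b \<in> {1..2 ^ Suc j}" using zb_range[of "Suc j"] by (simp only: b_def)
    have min: "increment y (Suc j) h \<le> increment y (Suc j) k" if "k \<in> {2 * hat_i y j - 2..2 * hat_i y j + 1}" for k
      unfolding h_def by (rule hat_i_minimal) fact
    have "2 \<le> o' \<or> o' \<le> -2" using Suc.prems by (auto simp: o'_def)
    then have "\<exists>s\<in>{1, -1}. \<exists>d\<in>{2, 3, 4}. mislocated y (Suc j) s d"
    proof
      assume o: "2 \<le> o'"
      then have o4: "o' \<in> {2, 3, 4}" using hb b hj c by auto
      have k: "b + 1 \<in> {2 * hat_i y j - 2..2 * hat_i y j + 1}" using o hb b hj c by auto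
      have kr: "b + 1 \<in> {1..2 ^ Suc j}" using o hb hr br by auto
      have "mislocated y (Suc j) 1 o'"
        unfolding mislocated_def b_def[symmetric]
        using hr kr contrast_le_0[OF hr kr min[OF k]] hb by simp
      then show ?thesis using o4 by blast
    next
      assume o: "o' \<le> -2"
      then have o4: "- o' \<in> {2, 3, 4}" using hb b hj c by auto
      have k: "b + -1 \<in> {2 * hat_i y j - 2..2 * hat_i y j + 1}" using o hb b hj c by auto
      have kr: "b + -1 \<in> {1..2 ^ Suc j}" using o hb hr br by auto
      have "mislocated y (Suc j) (-1) (- o')"
        unfolding mislocated_def b_def[symmetric]
        using hr kr contrast_le_0[OF hr kr min[OF k]] hb by simp
      then show ?thesis using o4 by blast
    qed
    then show ?thesis by blast
  qed
qed

text \<open>The random index is written as \<open>zb j + d\<close> with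
  \<open>\<bar>d\<bar> \<le> 1\<close>; a union bound over \<open>d\<close> then replaces
  conditioning on \<open>Y_l\<close>.\<close>

definition early :: "(real \<Rightarrow> real) \<Rightarrow> nat \<Rightarrow> int \<Rightarrow> int \<Rightarrow> bool" where
  "early y j s d \<longleftrightarrow> zb j + d + 6 * s \<in> {1..2 ^ j} \<and> zb j + d + 5 * s \<in> {1..2 ^ j} \<and>
     contrast y j (zb j + d + 6 * s) (zb j + d + 5 * s) \<le> 2 * sd j"

lemma ex_early:
  assumes "\<bar>offset Z (yl \<omega>) j\<bar> \<le> 1" "\<not> continues \<epsilon> (yl \<omega>) (ys \<omega>) j"
  shows "\<exists>s\<in>{1, -1}. \<exists>d\<in>{-1, 0, 1}. early (ys \<omega>) j s d"
proof -
  let ?h = "hat_i (yl \<omega>) j"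
  obtain s where s: "s \<in> {1, -1}" "\<not> exceeds \<epsilon> (ys \<omega>) j ?h s"
    using assms(2) unfolding continues_iff[OF eps] by auto
  \<comment> \<open>A missing block makes the statistic infinite, so a side that fails to exceed has
    both blocks in range.\<close>
  have r6: "?h + 6 * s \<in> {1..2 ^ j}"
  proof (rule ccontr)
    assume "?h + 6 * s \<notin> {1..2 ^ j}"
    then have "increment (ys \<omega>) j (?h + 6 * s) = \<infinity>" unfolding increment_def by (rule if_not_P)
    then show False using s(2) by (simp add: exceeds_def side_stat_def)
  qed
  then have r5: "?h + 5 * s \<in> {1..2 ^ j}" using hat_i_range[of "yl \<omega>" j] s(1) by auto
  have d: "offset Z (yl \<omega>) j \<in> {-1, 0, 1}" using assms(1) by auto
  have "?h = zb j + offset Z (yl \<omega>) j" by (simp add: offset_def)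
  then have "early (ys \<omega>) j s (offset Z (yl \<omega>) j)"
    using s(2) r6 r5 unfolding early_def exceeds_iff[OF r6 r5] by simp
  then show ?thesis using s(1) d by blast
qed

lemma prob_mislocated:
  assumes m: "8 * rz < mesh i" and "s \<in> {1, -1}" "d \<in> {2, 3, 4}"
  shows "{\<omega>\<in>space M. mislocated (yl \<omega>) i s d} \<in> sets M"
    and "prob {\<omega>\<in>space M. mislocated (yl \<omega>) i s d} \<le> 16 * rz ^ 3 / mesh i ^ 3"
proof -
  have "{\<omega>\<in>space M. mislocated (yl \<omega>) i s d} \<in> sets M \<and>
     prob {\<omega>\<in>space M. mislocated (yl \<omega>) i s d} \<le> 16 * rz ^ 3 / mesh i ^ 3"
  proof (cases "zb i + s * d \<in> {1..2 ^ i} \<and> zb i + s \<in> {1..2 ^ i}")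
    case True
    have "(zb i < zb i + s \<and> zb i + s < zb i + s * d) \<or> (zb i + s * d < zb i + s \<and> zb i + s < zb i)"
      using assms by auto
    note P = prob_contrast_small[OF m conjunct1[OF True] conjunct2[OF True] this, of True]
    note [measurable] = P(3)
    have "{\<omega>\<in>space M. contrast (yl \<omega>) i (zb i + s * d) (zb i + s) \<le> 0} \<in> sets M" by measurable
    then show ?thesis using True P(1) by (simp add: mislocated_def)
  next
    case False
    then have e: "{\<omega>\<in>space M. mislocated (yl \<omega>) i s d} = {}" unfolding mislocated_def by blast
    show ?thesis unfolding e using rho_z_pos mesh_pos[of i] by simp
  qed
  then show "{\<omega>\<in>space M. mislocated (yl \<omega>) i s d} \<in> sets M"
    "prob {\<omega>\<in>space M. mislocated (yl \<omega>) i s d} \<le> 16 * rz ^ 3 / mesh i ^ 3" by auto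
qed

lemma prob_early:
  assumes m: "8 * rz < mesh j" and "s \<in> {1, -1}" "d \<in> {-1, 0, 1}"
  shows "{\<omega>\<in>space M. early (ys \<omega>) j s d} \<in> sets M"
    and "prob {\<omega>\<in>space M. early (ys \<omega>) j s d} \<le> 40 * rz ^ 3 / mesh j ^ 3"
proof -
  have "{\<omega>\<in>space M. early (ys \<omega>) j s d} \<in> sets M \<and>
     prob {\<omega>\<in>space M. early (ys \<omega>) j s d} \<le> 40 * rz ^ 3 / mesh j ^ 3"
  proof (cases "zb j + d + 6 * s \<in> {1..2 ^ j} \<and> zb j + d + 5 * s \<in> {1..2 ^ j}")
    case True
    have "(zb j < zb j + d + 5 * s \<and> zb j + d + 5 * s < zb j + d + 6 * s) \<or> (zb j + d + 6 * s < zb j + d + 5 * s \<and> zb j + d + 5 * s < zb j)"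
      using assms by auto
    note P = prob_contrast_small[OF m conjunct1[OF True] conjunct2[OF True] this, of False]
    note [measurable] = P(3)
    have "{\<omega>\<in>space M. contrast (ys \<omega>) j (zb j + d + 6 * s) (zb j + d + 5 * s) \<le> 2 * sd j} \<in> sets M" by measurable
    then show ?thesis using True P(2) by (simp add: early_def)
  next
    case False
    then have e: "{\<omega>\<in>space M. early (ys \<omega>) j s d} = {}" unfolding early_def by blast
    show ?thesis unfolding e using rho_z_pos mesh_pos[of j] by simp
  qed
  then show "{\<omega>\<in>space M. early (ys \<omega>) j s d} \<in> sets M"
    "prob {\<omega>\<in>space M. early (ys \<omega>) j s d} \<le> 40 * rz ^ 3 / mesh j ^ 3" by auto
qed

text \<open>Stopping at a coarse level needs either a mislocation at some level up to
  \<open>j\<close> or a small statistic at an index within one of the right block. As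
  \<open>1 / mesh i ^ 3 = 8 ^ i\<close>, the sum over levels is dominated by the last one.\<close>

lemma prob_stop_coarse:
  assumes m: "8 * rz < mesh j"
  shows "prob {\<omega>\<in>space M. \<not> continues \<epsilon> (yl \<omega>) (ys \<omega>) j} \<le> 350 * rz ^ 3 * 8 ^ j"
proof -
  let ?I = "{1, -1 :: int} \<times> {2, 3, 4 :: int}" and ?L = "{1, -1 :: int} \<times> {-1, 0, 1 :: int}"
  let ?A = "\<lambda>i p. {\<omega>\<in>space M. mislocated (yl \<omega>) i (fst p) (snd p)}"
  let ?B = "\<lambda>p. {\<omega>\<in>space M. early (ys \<omega>) j (fst p) (snd p)}"
  have mi: "8 * rz < mesh i" if "i \<le> j" for i using mesh_antimono[OF that] m by simp
  have m3: "1 / mesh i ^ 3 = 8 ^ i" for i by (simp add: mesh_def power_divide flip: power_mult) (simp add: power_mult mult.commute[of i])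
  have e: "c * rz ^ 3 / mesh i ^ 3 = c * rz ^ 3 * 8 ^ i" for c i unfolding m3[symmetric] by simp
  have A: "?A i p \<in> sets M" "prob (?A i p) \<le> 16 * rz ^ 3 * 8 ^ i" if "i \<le> j" "p \<in> ?I" for i p
  proof -
    have "fst p \<in> {1, -1}" "snd p \<in> {2, 3, 4}" using that(2) by (simp_all only: mem_Times_iff)
    from prob_mislocated[OF mi[OF that(1)] this, unfolded e]
    show "?A i p \<in> sets M" "prob (?A i p) \<le> 16 * rz ^ 3 * 8 ^ i" .
  qed
  have B: "?B p \<in> sets M" "prob (?B p) \<le> 40 * rz ^ 3 * 8 ^ j" if "p \<in> ?L" for p
  proof -
    have "fst p \<in> {1, -1}" "snd p \<in> {-1, 0, 1}" using that by (simp_all only: mem_Times_iff)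
    from prob_early[OF m this, unfolded e]
    show "?B p \<in> sets M" "prob (?B p) \<le> 40 * rz ^ 3 * 8 ^ j" .
  qed
  have UA: "prob (\<Union>p\<in>?I. ?A i p) \<le> 96 * rz ^ 3 * 8 ^ i" if "i \<le> j" for i
  proof -
    have "prob (\<Union>p\<in>?I. ?A i p) \<le> real (card ?I) * (16 * rz ^ 3 * 8 ^ i)"
      by (rule prob_UN_le_card[OF _ A(1)[OF that] A(2)[OF that]]) simp
    then show ?thesis by (simp add: card_cartesian_product)
  qed
  have UB: "prob (\<Union>p\<in>?L. ?B p) \<le> 240 * rz ^ 3 * 8 ^ j"
  proof -
    have "prob (\<Union>p\<in>?L. ?B p) \<le> real (card ?L) * (40 * rz ^ 3 * 8 ^ j)"
      by (rule prob_UN_le_card[OF _ B]) simp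
    then show ?thesis by (simp add: card_cartesian_product)
  qed
  have sA: "(\<Union>p\<in>?I. ?A i p) \<in> sets M" if "i \<le> j" for i by (rule sets.finite_UN[OF _ A(1)[OF that]]) simp
  have sB: "(\<Union>p\<in>?L. ?B p) \<in> sets M" by (rule sets.finite_UN[OF _ B(1)]) simp
  have sUA: "(\<Union>i\<in>{..j}. \<Union>p\<in>?I. ?A i p) \<in> sets M" by (rule sets.finite_UN[OF _ sA]) simp_all
  have "{\<omega>\<in>space M. \<not> continues \<epsilon> (yl \<omega>) (ys \<omega>) j} \<subseteq> (\<Union>i\<in>{..j}. \<Union>p\<in>?I. ?A i p) \<union> (\<Union>p\<in>?L. ?B p)"
  proof
    fix \<omega> assume w: "\<omega> \<in> {\<omega>\<in>space M. \<not> continues \<epsilon> (yl \<omega>) (ys \<omega>) j}"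
    show "\<omega> \<in> (\<Union>i\<in>{..j}. \<Union>p\<in>?I. ?A i p) \<union> (\<Union>p\<in>?L. ?B p)"
    proof (cases "2 \<le> \<bar>offset Z (yl \<omega>) j\<bar>")
      case True
      then obtain i s d where "i \<le> j" "(s, d) \<in> ?I" "mislocated (yl \<omega>) i s d" using ex_mislocated[OF True] by blast
      then have "\<omega> \<in> ?A i (s, d)" "i \<in> {..j}" using w by simp_all
      then show ?thesis using \<open>(s, d) \<in> ?I\<close> by blast
    next
      case False
      then obtain s d where "(s, d) \<in> ?L" "early (ys \<omega>) j s d" using ex_early[of \<omega> j] w by force
      then have "\<omega> \<in> ?B (s, d)" using w by simp
      then show ?thesis using \<open>(s, d) \<in> ?L\<close> by blast
    qed
  qed
  then have "prob {\<omega>\<in>space M. \<not> continues \<epsilon> (yl \<omega>) (ys \<omega>) j} \<le> prob ((\<Union>i\<in>{..j}. \<Union>p\<in>?I. ?A i p) \<union> (\<Union>p\<in>?L. ?B p))"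
    by (rule finite_measure_mono[OF _ sets.Un[OF sUA sB]])
  also have "\<dots> \<le> prob (\<Union>i\<in>{..j}. \<Union>p\<in>?I. ?A i p) + prob (\<Union>p\<in>?L. ?B p)"
    by (rule measure_Un_le[OF sUA sB])
  also have "\<dots> \<le> (\<Sum>i\<le>j. prob (\<Union>p\<in>?I. ?A i p)) + 240 * rz ^ 3 * 8 ^ j"
    by (rule add_mono[OF prob_UN_le_sum[OF _ sA] UB]) simp_all
  also have "\<dots> \<le> (\<Sum>i\<le>j. 96 * rz ^ 3 * 8 ^ i) + 240 * rz ^ 3 * 8 ^ j"
    using UA by (intro add_mono sum_mono) auto
  also have "(\<Sum>i\<le>j. 96 * rz ^ 3 * 8 ^ i) = 96 * rz ^ 3 * (\<Sum>i\<le>j. 8 ^ i)" by (simp add: sum_distrib_left)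
  also have "\<dots> \<le> 96 * rz ^ 3 * (8 / 7 * 8 ^ j)"
  proof (intro mult_left_mono)
    show "(\<Sum>i\<le>j. 8 ^ i) \<le> 8 / 7 * (8 :: real) ^ j" by (induction j) auto
  qed (use rho_z_pos in auto)
  \<comment> \<open>96 counts two sides, three distances and the constant 16; 240 counts two sides,
    three offsets and the constant 40. The total \<open>2448 / 7\<close> is just below 350.\<close>
  also have "96 * rz ^ 3 * (8 / 7 * 8 ^ j) + 240 * rz ^ 3 * 8 ^ j = 2448 / 7 * (rz ^ 3 * 8 ^ j)" by simp
  also have "\<dots> \<le> 350 * (rz ^ 3 * 8 ^ j)" using rho_z_pos by (intro mult_right_mono) auto
  finally show ?thesis by simp
qed

text \<open>The mesh at the stopping level is at most \<open>8 * rz\<close>, or else it is a coarse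
  mesh, where stopping is rare: level \<open>j\<close> contributes at most
  \<open>mesh j * 350 * rz^3 * 8^j = 350 * rz^3 * 4^j\<close>. The finest coarse level governs this
  geometric sum.\<close>

lemma expected_length_le:
  "expected_length M (\<lambda>\<omega>. CI_lower \<alpha> \<epsilon> (yl \<omega>) (ys \<omega>)) (\<lambda>\<omega>. CI_upper \<alpha> \<epsilon> (yl \<omega>) (ys \<omega>))
    \<le> ennreal ((24 * 2 ^ K \<alpha> - 3) * 17.5 * rz)"
proof -
  define c :: real where "c = 24 * 2 ^ K \<alpha> - 3"
  have "(1::real) \<le> 2 ^ K \<alpha>" by simp
  then have c: "0 \<le> c" unfolding c_def by linarith
  define J where "J = (LEAST j. mesh j \<le> 8 * rz)"
  obtain j0 where "mesh j0 < 8 * rz" using ex_mesh_less[of "8 * rz"] rho_z_pos by auto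
  then have J: "mesh J \<le> 8 * rz" 
    using LeastI[of "\<lambda>j. mesh j \<le> 8 * rz" j0] unfolding J_def by simp
  have coarse: "8 * rz < mesh j" if "j < J" for j
    using not_less_Least[of j "\<lambda>j. mesh j \<le> 8 * rz"] that by (simp add: J_def)
  let ?S = "\<lambda>j. {\<omega>\<in>space M. \<not> continues \<epsilon> (yl \<omega>) (ys \<omega>) j}"
  have S: "?S j \<in> sets M" for j using pred_continues_obs by auto
  \<comment> \<open>A majorant of the mesh at the stopping level. The events \<open>?S j\<close>
    record any level whose criterion is met, not only the first, which can only enlarge the
    majorant.\<close>
  define g where "g \<omega> = 8 * rz + (\<Sum>j<J. mesh j * indicator (?S j) \<omega>)" for \<omega>
  have g0: "0 \<le> g \<omega>" for \<omega>
    unfolding g_def using rho_z_pos mesh_pos by (intro add_nonneg_nonneg sum_nonneg mult_nonneg_nonneg) (auto simp: less_imp_le)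
  have ind: "integrable M (indicator (?S j) :: 'a \<Rightarrow> real)" for j
    by (rule integrable_real_indicator[OF S]) (simp add: less_top[symmetric])
  then have sum_int: "integrable M (\<lambda>\<omega>. \<Sum>j<J. mesh j * indicator (?S j) \<omega>)"
    by (intro Bochner_Integration.integrable_sum integrable_mult_right)
  then have gi: "integrable M g"
    unfolding g_def[abs_def] by (rule Bochner_Integration.integrable_add[OF integrable_const])
  have "expected_length M (\<lambda>\<omega>. CI_lower \<alpha> \<epsilon> (yl \<omega>) (ys \<omega>)) (\<lambda>\<omega>. CI_upper \<alpha> \<epsilon> (yl \<omega>) (ys \<omega>))
      \<le> (\<integral>\<^sup>+\<omega>. ennreal (c * g \<omega>) \<partial>M)"
    unfolding expected_length_def
  proof (rule nn_integral_mono_AE)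
    show "AE \<omega> in M. ennreal (CI_upper \<alpha> \<epsilon> (yl \<omega>) (ys \<omega>) - CI_lower \<alpha> \<epsilon> (yl \<omega>) (ys \<omega>)) \<le> ennreal (c * g \<omega>)"
      using AE_stops AE_space
    proof eventually_elim
      case (elim \<omega>)
      let ?j = "hat_j \<epsilon> (yl \<omega>) (ys \<omega>)"
      have "mesh ?j \<le> g \<omega>"
      proof (cases "?j < J")
        case True
        then have "mesh ?j * indicator (?S ?j) \<omega> \<le> (\<Sum>j<J. mesh j * indicator (?S j) \<omega>)"
          using mesh_pos by (intro member_le_sum) (auto simp: less_imp_le)
        moreover have "indicator (?S ?j) \<omega> = (1::real)" using elim by simp
        ultimately show ?thesis using rho_z_pos by (simp add: g_def)
      next
        case False
        then have "mesh ?j \<le> 8 * rz" using mesh_antimono[of J ?j] J by simp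
        moreover have "0 \<le> (\<Sum>j<J. mesh j * indicator (?S j) \<omega>)"
          using mesh_pos by (intro sum_nonneg mult_nonneg_nonneg) (auto simp: less_imp_le)
        ultimately show ?thesis by (simp add: g_def)
      qed
      then have "c * mesh ?j \<le> c * g \<omega>" using c by (intro mult_left_mono)
      then show ?case using CI_length[of \<alpha> \<epsilon> "yl \<omega>" "ys \<omega>"] unfolding c_def by (intro ennreal_leI) linarith
    qed
  qed
  also have "\<dots> = ennreal (\<integral>\<omega>. c * g \<omega> \<partial>M)"
    using c g0 gi by (intro nn_integral_eq_integral) auto
  also have "(\<integral>\<omega>. c * g \<omega> \<partial>M) = c * (8 * rz + (\<Sum>j<J. mesh j * prob (?S j)))"
  proof -
    have "(\<integral>\<omega>. g \<omega> \<partial>M) = (\<integral>\<omega>. 8 * rz \<partial>M) + (\<integral>\<omega>. (\<Sum>j<J. mesh j * indicator (?S j) \<omega>) \<partial>M)"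
      unfolding g_def by (rule Bochner_Integration.integral_add[OF integrable_const sum_int])
    also have "(\<integral>\<omega>. (\<Sum>j<J. mesh j * indicator (?S j) \<omega>) \<partial>M) = (\<Sum>j<J. mesh j * prob (?S j))"
    proof -
      have "(\<integral>\<omega>. (\<Sum>j<J. mesh j * indicator (?S j) \<omega>) \<partial>M) = (\<Sum>j<J. (\<integral>\<omega>. mesh j * indicator (?S j) \<omega> \<partial>M))"
        by (rule Bochner_Integration.integral_sum[OF integrable_mult_right[OF ind]])
      also have "\<dots> = (\<Sum>j<J. mesh j * prob (?S j))"
        by (rule sum.cong[OF refl]) (simp only: integral_mult_right_zero Bochner_Integration.integral_indicator Int_absorb2[OF sets.sets_into_space[OF S]])
      finally show ?thesis .
    qed
    finally show ?thesis by (simp add: prob_space)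
  qed
  also have "c * (8 * rz + (\<Sum>j<J. mesh j * prob (?S j))) \<le> c * (35/2 * rz)"
  proof (intro mult_left_mono c)
    have "(\<Sum>j<J. mesh j * prob (?S j)) \<le> (\<Sum>j<J. 350 * rz ^ 3 * 4 ^ j)"
    proof (rule sum_mono)
      fix j assume "j \<in> {..<J}"
      then have "mesh j * prob (?S j) \<le> mesh j * (350 * rz ^ 3 * 8 ^ j)"
        using mesh_pos[of j] by (intro mult_left_mono prob_stop_coarse coarse) auto
      also have "\<dots> = 350 * rz ^ 3 * (8 / 2) ^ j" unfolding power_divide by (simp add: mesh_def)
      finally show "mesh j * prob (?S j) \<le> 350 * rz ^ 3 * 4 ^ j" by simp
    qed
    also have "\<dots> = 350 * rz ^ 3 * (\<Sum>j<J. 4 ^ j)" by (simp add: sum_distrib_left)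
    also have "\<dots> \<le> 19/2 * rz"
    proof (cases J)
      case 0 then show ?thesis using rho_z_pos by simp
    next
      case (Suc J')
      have "(\<Sum>j<J. 4 ^ j) \<le> 4 / 3 * (4::real) ^ J'" unfolding Suc by (induction J') auto
      then have "350 * rz ^ 3 * (\<Sum>j<J. 4 ^ j) \<le> 350 * rz ^ 3 * (4 / 3 * 4 ^ J')"
        using rho_z_pos by (intro mult_left_mono) auto
      \<comment> \<open>Level \<open>J' = J - 1\<close> is still coarse, so
        \<open>8 * rz * 2 ^ J' \<le> 1\<close>. The resulting factor \<open>350 * 4 / 3 / 64\<close>
        is about 7.3, within the 9.5 that 17.5 leaves after the 8 of the fine levels.\<close>
      also have "\<dots> = 350 * 4 / 3 / 64 * rz * (8 * rz * 2 ^ J')\<^sup>2"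
      proof -
        have "(2 * 2 :: real) ^ J' = (2 ^ J')\<^sup>2" unfolding power_mult_distrib power2_eq_square ..
        then show ?thesis by (simp add: power2_eq_square power3_eq_cube)
      qed
      also have "\<dots> \<le> 350 * 4 / 3 / 64 * rz * 1\<^sup>2"
      proof (intro mult_left_mono power_mono)
        show "8 * rz * 2 ^ J' \<le> 1" using coarse[of J'] Suc by (simp add: mesh_def field_simps)
      qed (use rho_z_pos in auto)
      also have "\<dots> \<le> 19/2 * rz" using rho_z_pos by simp
      finally show ?thesis .
    qed
    finally show "8 * rz + (\<Sum>j<J. mesh j * prob (?S j)) \<le> 35/2 * rz" by simp
  qed
  also have "c * (35/2 * rz) = (24 * 2 ^ K \<alpha> - 3) * 17.5 * rz" by (simp add: c_def)
  finally show ?thesis by (simp only: ennreal_leI)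
qed

end

section \<open>Shifted Gaussian laws\<close>

text \<open>Completing the square. Integrated over \<open>x\<close>, it says that the likelihood
  ratio of a shifted normal law has second moment
  \<open>exp (\<delta>^2 / \<sigma>^2)\<close>.\<close>

lemma normal_density_shift_square:
  assumes "0 < \<sigma>"
  shows "(normal_density (\<mu> + \<delta>) \<sigma> x / normal_density \<mu> \<sigma> x)\<^sup>2 * normal_density \<mu> \<sigma> x
     = exp (\<delta>\<^sup>2 / \<sigma>\<^sup>2) * normal_density (\<mu> + 2 * \<delta>) \<sigma> x"
proof -
  define c where "c = 1 / sqrt (2 * pi * \<sigma>\<^sup>2)"
  have c: "0 < c" using assms by (simp add: c_def)
  have n: "normal_density m \<sigma> x = c * exp (- (x - m)\<^sup>2 / (2 * \<sigma>\<^sup>2))" for m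
    by (simp add: normal_density_def c_def)
  have e: "- (x - (\<mu> + \<delta>))\<^sup>2 / (2 * \<sigma>\<^sup>2) + - (x - (\<mu> + \<delta>))\<^sup>2 / (2 * \<sigma>\<^sup>2) - - (x - \<mu>)\<^sup>2 / (2 * \<sigma>\<^sup>2)
     = \<delta>\<^sup>2 / \<sigma>\<^sup>2 + - (x - (\<mu> + 2 * \<delta>))\<^sup>2 / (2 * \<sigma>\<^sup>2)"
    using assms by (simp add: field_simps power2_eq_square)
  have "(c * exp a / (c * exp b))\<^sup>2 * (c * exp b) = exp a' * (c * exp b')" if "a + a - b = a' + b'" for a b a' b'
  proof -
    have "(c * exp a / (c * exp b))\<^sup>2 * (c * exp b) = c * (exp a * exp a / exp b)"
      using c by (simp add: power2_eq_square)
    also have "exp a * exp a / exp b = exp (a + a - b)" unfolding exp_diff exp_add ..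
    also have "\<dots> = exp a' * exp b'" unfolding that exp_add ..
    finally show ?thesis by simp
  qed
  from this[OF e] show ?thesis unfolding n .
qed

text \<open>Cauchy--Schwarz for the likelihood ratio \<open>\<Lambda>\<close> of the shifted law, linearized as
  \<open>\<Lambda> 1\<^sub>A \<le> 3/4 1\<^sub>A + \<Lambda>\<^sup>2/3\<close> so that it survives passage to limits and mixtures.\<close>

lemma (in prob_space) shifted_normals_bound:
  fixes X :: "nat \<Rightarrow> 'a \<Rightarrow> real"
  assumes I: "finite I" "I \<noteq> {}" and ind: "indep_vars (\<lambda>_. borel) X I" and \<sigma>: "\<And>k. 0 < \<sigma> k"
    and X: "\<And>k. k \<in> I \<Longrightarrow> distributed M lborel (X k) (normal_density (\<mu> k) (\<sigma> k))"
    and A: "A \<in> sets (PiM I (\<lambda>_. borel))"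
  shows "emeasure M {\<omega>\<in>space M. (\<lambda>k\<in>I. X k \<omega> + \<delta> k) \<in> A}
    \<le> ennreal (3/4) * emeasure M {\<omega>\<in>space M. (\<lambda>k\<in>I. X k \<omega>) \<in> A} + ennreal (1/3 * exp (\<Sum>k\<in>I. (\<delta> k)\<^sup>2 / (\<sigma> k)\<^sup>2))"
proof -
  define p q where "p k = normal_density (\<mu> k) (\<sigma> k)" and "q k = normal_density (\<mu> k + \<delta> k) (\<sigma> k)" for k
  let ?P = "\<lambda>k. density lborel (p k)" and ?Q = "\<lambda>k. density lborel (q k)"
  have [measurable]: "p k \<in> borel_measurable borel" "q k \<in> borel_measurable borel" for k
    by (simp_all add: p_def q_def)
  have p0: "0 < p k x" and q0: "0 < q k x" for k x using \<sigma> by (simp_all add: p_def q_def normal_density_pos)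
  interpret P: product_sigma_finite ?P
    by (intro product_sigma_finite.intro prob_space_imp_sigma_finite) (use \<sigma> in \<open>simp add: p_def prob_space_normal_density\<close>)
  interpret Q: product_sigma_finite ?Q
    by (intro product_sigma_finite.intro prob_space_imp_sigma_finite) (use \<sigma> in \<open>simp add: q_def prob_space_normal_density\<close>)
  have rv: "random_variable borel (X k)" if "k \<in> I" for k using X[OF that] by (auto simp: distributed_def)
  have dX: "distr M borel (X k) = ?P k" if "k \<in> I" for k
    using X[OF that] by (simp add: distributed_def p_def cong: distr_cong)
  have Y: "distributed M lborel (\<lambda>\<omega>. \<delta> k + 1 * X k \<omega>) (normal_density (\<delta> k + 1 * \<mu> k) (\<bar>1\<bar> * \<sigma> k))" if "k \<in> I" for k
    using \<sigma> by (intro normal_density_affine X that) auto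
  have dY: "distr M borel (\<lambda>\<omega>. X k \<omega> + \<delta> k) = ?Q k" if "k \<in> I" for k
    using Y[OF that] by (simp add: distributed_def q_def add.commute cong: distr_cong)
  have indY: "indep_vars (\<lambda>_. borel) (\<lambda>k \<omega>. X k \<omega> + \<delta> k) I"
    using indep_vars_compose2[OF ind, where Y="\<lambda>k x. x + \<delta> k" and N="\<lambda>_. borel"] by simp
  have rvY: "random_variable borel (\<lambda>\<omega>. X k \<omega> + \<delta> k)" if "k \<in> I" for k using rv[OF that] by simp
  have DX: "distr M (PiM I (\<lambda>_. borel)) (\<lambda>\<omega>. \<lambda>k\<in>I. X k \<omega>) = PiM I ?P"
    using indep_vars_iff_distr_eq_PiM'[where M'="\<lambda>_. borel" and X=X, OF I(2) rv] ind dX by (simp cong: PiM_cong)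
  have DY: "distr M (PiM I (\<lambda>_. borel)) (\<lambda>\<omega>. \<lambda>k\<in>I. X k \<omega> + \<delta> k) = PiM I ?Q"
    using indep_vars_iff_distr_eq_PiM'[where M'="\<lambda>_. borel" and X="\<lambda>k \<omega>. X k \<omega> + \<delta> k", OF I(2) rvY] indY dY by (simp cong: PiM_cong)
  have sP: "sets (PiM I ?P) = sets (PiM I (\<lambda>_. borel))" by (intro sets_PiM_cong) auto
  \<comment> \<open>\<open>r k\<close> is the likelihood ratio of one coordinate; by independence
    the product \<open>L\<close> is that of the whole vector.\<close>
  define r where "r k x = ennreal (q k x / p k x)" for k x
  have [measurable]: "r k \<in> borel_measurable borel" for k unfolding r_def by measurable
  define L where "L x = (\<Prod>k\<in>I. r k (x k))" for x
  have L[measurable]: "L \<in> borel_measurable (PiM I ?P)"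
    unfolding L_def by (intro borel_measurable_prod_ennreal measurable_compose[OF measurable_component_singleton]) auto
  have rp: "ennreal (p k x) * r k x = ennreal (q k x)" for k x
    using p0[of k x] q0[of k x] by (simp add: r_def ennreal_mult[symmetric])
  have "density (PiM I ?P) L = PiM I ?Q"
  proof (rule Q.PiM_eqI[OF I(1)])
    show "sets (density (PiM I ?P) L) = sets (PiM I ?Q)" by (simp add: sP) (intro sets_PiM_cong; simp)
    fix B assume "\<And>k. k \<in> I \<Longrightarrow> B k \<in> sets (?Q k)"
    then have B: "B k \<in> sets borel" if "k \<in> I" for k using that by simp
    have PB: "Pi\<^sub>E I B \<in> sets (PiM I ?P)" unfolding sP using I B by (intro sets_PiM_I_finite) auto
    have "emeasure (density (PiM I ?P) L) (Pi\<^sub>E I B) = (\<integral>\<^sup>+x. L x * indicator (Pi\<^sub>E I B) x \<partial>PiM I ?P)"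
      by (rule emeasure_density[OF L PB])
    also have "\<dots> = (\<integral>\<^sup>+x. (\<Prod>k\<in>I. r k (x k) * indicator (B k) (x k)) \<partial>PiM I ?P)"
    proof (rule nn_integral_cong)
      fix x assume x: "x \<in> space (PiM I ?P)"
      have "indicator (Pi\<^sub>E I B) x = (\<Prod>k\<in>I. indicator (B k) (x k) :: ennreal)"
        using x I(1) by (auto simp: indicator_def space_PiM PiE_iff prod_eq_1_iff)
      then show "L x * indicator (Pi\<^sub>E I B) x = (\<Prod>k\<in>I. r k (x k) * indicator (B k) (x k))"
        by (simp add: L_def prod.distrib)
    qed
    also have "\<dots> = (\<Prod>k\<in>I. \<integral>\<^sup>+x. r k x * indicator (B k) x \<partial>?P k)"
      using B by (intro P.product_nn_integral_prod I) auto
    also have "\<dots> = (\<Prod>k\<in>I. emeasure (?Q k) (B k))"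
    proof (rule prod.cong[OF refl])
      fix k assume "k \<in> I"
      note [measurable] = B[OF this]
      show "(\<integral>\<^sup>+x. r k x * indicator (B k) x \<partial>?P k) = emeasure (?Q k) (B k)"
        by (subst nn_integral_density) (auto simp: emeasure_density rp mult.assoc[symmetric])
    qed
    finally show "emeasure (density (PiM I ?P) L) (Pi\<^sub>E I B) = (\<Prod>k\<in>I. emeasure (?Q k) (B k))" .
  qed
  note dens = this
  have AP: "A \<in> sets (PiM I ?P)" using A by (simp only: sP)
  have mX: "(\<lambda>\<omega>. \<lambda>k\<in>I. X k \<omega>) \<in> measurable M (PiM I (\<lambda>_. borel))" using rv by (intro measurable_restrict)
  have mY: "(\<lambda>\<omega>. \<lambda>k\<in>I. X k \<omega> + \<delta> k) \<in> measurable M (PiM I (\<lambda>_. borel))" using rvY by (intro measurable_restrict)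
  have vimage: "{\<omega>\<in>space M. g \<omega> \<in> A} = g -` A \<inter> space M" for g by auto
  have eX: "emeasure M {\<omega>\<in>space M. (\<lambda>k\<in>I. X k \<omega>) \<in> A} = emeasure (PiM I ?P) A"
    unfolding DX[symmetric] vimage by (rule emeasure_distr[OF mX A, symmetric])
  have eY: "emeasure M {\<omega>\<in>space M. (\<lambda>k\<in>I. X k \<omega> + \<delta> k) \<in> A} = emeasure (PiM I ?Q) A"
    unfolding DY[symmetric] vimage by (rule emeasure_distr[OF mY A, symmetric])
  have "emeasure (PiM I ?Q) A = (\<integral>\<^sup>+x. L x * indicator A x \<partial>PiM I ?P)"
    unfolding dens[symmetric] by (rule emeasure_density[OF L AP])
  also have "\<dots> \<le> (\<integral>\<^sup>+x. ennreal (3/4) * indicator A x + ennreal (1/3) * (L x)\<^sup>2 \<partial>PiM I ?P)"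
  proof (rule nn_integral_mono)
    fix x
    define l where "l = (\<Prod>k\<in>I. q k (x k) / p k (x k))"
    have l0: "0 \<le> l" unfolding l_def using p0 q0 by (intro prod_nonneg) (auto simp: less_imp_le)
    have l: "L x = ennreal l"
      unfolding L_def l_def r_def using p0 q0 by (intro prod_ennreal) (auto simp: less_imp_le)
    \<comment> \<open>The parabola \<open>3/4 + l^2 / 3\<close> touches the diagonal at
      \<open>l = 3/2\<close>. The weights 3/4 and 1/3 leave enough slack for coverage levels above
      7/10 in the benchmark.\<close>
    have "0 \<le> (l - 3/2)\<^sup>2" by simp
    then have "l \<le> 3/4 + 1/3 * l\<^sup>2" by (simp add: power2_eq_square algebra_simps)
    then have "ennreal l \<le> ennreal (3/4) + ennreal (1/3) * (ennreal l)\<^sup>2"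
      using l0 by (simp add: ennreal_power flip: ennreal_mult ennreal_plus)
    then show "L x * indicator A x \<le> ennreal (3/4) * indicator A x + ennreal (1/3) * (L x)\<^sup>2"
      unfolding l by (auto simp: indicator_def)
  qed
  also have "\<dots> = ennreal (3/4) * emeasure (PiM I ?P) A + ennreal (1/3) * (\<integral>\<^sup>+x. (L x)\<^sup>2 \<partial>PiM I ?P)"
    using AP by (simp add: nn_integral_add nn_integral_cmult)
  also have "(\<integral>\<^sup>+x. (L x)\<^sup>2 \<partial>PiM I ?P) = (\<integral>\<^sup>+x. (\<Prod>k\<in>I. (r k (x k))\<^sup>2) \<partial>PiM I ?P)"
    by (simp add: L_def prod_power_distrib)
  also have "\<dots> = (\<Prod>k\<in>I. \<integral>\<^sup>+x. (r k x)\<^sup>2 \<partial>?P k)"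
    by (intro P.product_nn_integral_prod I) auto
  also have "\<dots> = (\<Prod>k\<in>I. ennreal (exp ((\<delta> k)\<^sup>2 / (\<sigma> k)\<^sup>2)))"
  proof (rule prod.cong[OF refl])
    fix k
    have "(\<integral>\<^sup>+x. (r k x)\<^sup>2 \<partial>?P k) = (\<integral>\<^sup>+x. ennreal (exp ((\<delta> k)\<^sup>2 / (\<sigma> k)\<^sup>2) * normal_density (\<mu> k + 2 * \<delta> k) (\<sigma> k) x) \<partial>lborel)"
    proof (subst nn_integral_density)
      show "(\<integral>\<^sup>+x. ennreal (p k x) * (r k x)\<^sup>2 \<partial>lborel) = (\<integral>\<^sup>+x. ennreal (exp ((\<delta> k)\<^sup>2 / (\<sigma> k)\<^sup>2) * normal_density (\<mu> k + 2 * \<delta> k) (\<sigma> k) x) \<partial>lborel)"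
      proof (rule nn_integral_cong)
        fix x
        have "ennreal (p k x) * (r k x)\<^sup>2 = ennreal ((q k x / p k x)\<^sup>2 * p k x)"
          using p0[of k x] q0[of k x] by (simp add: r_def ennreal_power ennreal_mult mult.commute)
        then show "ennreal (p k x) * (r k x)\<^sup>2 = ennreal (exp ((\<delta> k)\<^sup>2 / (\<sigma> k)\<^sup>2) * normal_density (\<mu> k + 2 * \<delta> k) (\<sigma> k) x)"
          unfolding p_def q_def normal_density_shift_square[OF \<sigma>] .
      qed
    qed auto
    also have "\<dots> = ennreal (exp ((\<delta> k)\<^sup>2 / (\<sigma> k)\<^sup>2)) * (\<integral>\<^sup>+x. ennreal (normal_density (\<mu> k + 2 * \<delta> k) (\<sigma> k) x) \<partial>lborel)"
      by (subst nn_integral_cmult[symmetric]) (auto simp: ennreal_mult)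
    also have "(\<integral>\<^sup>+x. ennreal (normal_density (\<mu> k + 2 * \<delta> k) (\<sigma> k) x) \<partial>lborel) = 1"
      using \<sigma>[of k] by (subst nn_integral_eq_integral) auto
    finally show "(\<integral>\<^sup>+x. (r k x)\<^sup>2 \<partial>?P k) = ennreal (exp ((\<delta> k)\<^sup>2 / (\<sigma> k)\<^sup>2))" by simp
  qed
  also have "\<dots> = ennreal (exp (\<Sum>k\<in>I. (\<delta> k)\<^sup>2 / (\<sigma> k)\<^sup>2))"
    by (simp add: prod_ennreal exp_sum I)
  also have "ennreal (1/3) * ennreal (exp (\<Sum>k\<in>I. (\<delta> k)\<^sup>2 / (\<sigma> k)\<^sup>2)) = ennreal (1/3 * exp (\<Sum>k\<in>I. (\<delta> k)\<^sup>2 / (\<sigma> k)\<^sup>2))"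
    by (rule ennreal_mult[symmetric]) auto
  finally show ?thesis unfolding eX eY .
qed

text \<open>Transfers bounds from cylinders to all measurable sets. Both one-sided differences are
  kept because complementation exchanges them, and one set serves both measures so that their bounds
  can be compared.\<close>

lemma approximation_by_algebra:
  assumes P: "prob_space P" and Q: "prob_space Q" and sets: "sets Q = sets P" "sets P = sigma_sets (space P) G"
    and G: "G \<subseteq> sets P" "\<And>A. A \<in> G \<Longrightarrow> space P - A \<in> G" "\<And>A B. A \<in> G \<Longrightarrow> B \<in> G \<Longrightarrow> A \<union> B \<in> G" "{} \<in> G"
    and "A \<in> sets P" "0 < (e::real)"
  shows "\<exists>B\<in>G. measure P (A - B) < e \<and> measure P (B - A) < e \<and> measure Q (A - B) < e \<and> measure Q (B - A) < e"
proof -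
  interpret P: prob_space P by fact
  interpret Q: prob_space Q by fact
  have sp: "space Q = space P" using sets(1) by (rule sets_eq_imp_space_eq)
  have Gs: "B \<in> sets P" "B \<in> sets Q" if "B \<in> G" for B using G(1) that sets(1) by auto
  have "A \<in> sigma_sets (space P) G" using assms by simp
  then show ?thesis using \<open>0 < e\<close>
  proof (induction arbitrary: e rule: sigma_sets.induct)
    case (Basic A)
    then show ?case by (intro bexI[of _ A]) auto
  next
    case Empty
    then show ?case using G(4) by (intro bexI[of _ "{}"]) auto
  next
    case (Compl A)
    then obtain B where B: "B \<in> G" "measure P (A - B) < e" "measure P (B - A) < e" "measure Q (A - B) < e" "measure Q (B - A) < e"
      by blast
    have "B \<subseteq> space P" "A \<subseteq> space P"
      using Gs(1)[OF B(1)] Compl.hyps sets(2) sets.sets_into_space by blast+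
    then have "(space P - A) - (space P - B) = B - A" "(space P - B) - (space P - A) = A - B" by auto
    then show ?case using B G(2) by (intro bexI[of _ "space P - B"]) auto
  next
    case (Union A)
    have A: "A i \<in> sets P" "A i \<in> sets Q" for i using Union.hyps sets by auto
    let ?U = "\<Union>i. A i"
    have ev: "\<exists>N0. \<forall>N\<ge>N0. measure R (?U - (\<Union>i<N. A i)) < e / 2"
      if R: "prob_space R" and AR: "\<And>i. A i \<in> sets R" for R
    proof -
      interpret R: prob_space R by fact
      have "(\<lambda>N. measure R (\<Union>i<N. A i)) \<longlonglongrightarrow> measure R (\<Union>N. \<Union>i<N. A i)"
        using AR by (intro R.finite_Lim_measure_incseq) (auto simp: incseq_def, fastforce)
      also have "(\<Union>N. \<Union>i<N. A i) = ?U" by auto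
      finally have "\<forall>\<^sub>F N in sequentially. dist (measure R (\<Union>i<N. A i)) (measure R ?U) < e / 2"
        using Union.prems by (intro tendstoD) auto
      then obtain N0 where N0: "\<And>N. N \<ge> N0 \<Longrightarrow> dist (measure R (\<Union>i<N. A i)) (measure R ?U) < e / 2"
        unfolding eventually_sequentially by blast
      have diff: "measure R (?U - (\<Union>i<N. A i)) = measure R ?U - measure R (\<Union>i<N. A i)" for N
        using AR by (intro R.finite_measure_Diff) auto
      have "measure R (?U - (\<Union>i<N. A i)) < e / 2" if "N \<ge> N0" for N
        using N0[OF that] diff[of N] unfolding dist_real_def by linarith
      then show ?thesis by blast
    qed
    obtain N1 N2 where N: "\<And>N. N \<ge> N1 \<Longrightarrow> measure P (?U - (\<Union>i<N. A i)) < e / 2"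
      "\<And>N. N \<ge> N2 \<Longrightarrow> measure Q (?U - (\<Union>i<N. A i)) < e / 2"
      using ev[OF P A(1)] ev[OF Q A(2)] by blast
    define N where "N = Suc (max N1 N2)"
    \<comment> \<open>Half of the error is spent on cutting the union off at \<open>N\<close>, the
      other half on the \<open>N\<close> approximations.\<close>
    have "0 < e / (2 * real N)" using Union.prems by (simp add: N_def)
    then have "\<forall>i. \<exists>B\<in>G. measure P (A i - B) < e / (2 * real N) \<and> measure P (B - A i) < e / (2 * real N) \<and>
       measure Q (A i - B) < e / (2 * real N) \<and> measure Q (B - A i) < e / (2 * real N)"
      using Union.IH by blast
    then obtain B where B: "\<And>i. B i \<in> G" "\<And>i. measure P (A i - B i) < e / (2 * real N)" "\<And>i. measure P (B i - A i) < e / (2 * real N)"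
       "\<And>i. measure Q (A i - B i) < e / (2 * real N)" "\<And>i. measure Q (B i - A i) < e / (2 * real N)"
      by metis
    let ?V = "\<Union>i<N. B i"
    have VG: "?V \<in> G"
    proof -
      have "(\<Union>i<n. B i) \<in> G" for n
        by (induction n) (auto simp: lessThan_Suc G(4) intro!: G(3) B(1))
      then show ?thesis .
    qed
    have main: "measure R (?U - ?V) < e \<and> measure R (?V - ?U) < e"
      if R: "prob_space R" and AR: "\<And>i. A i \<in> sets R" and BR: "\<And>i. B i \<in> sets R"
        and N: "measure R (?U - (\<Union>i<N. A i)) < e / 2"
        and b1: "\<And>i. measure R (A i - B i) < e / (2 * real N)" and b2: "\<And>i. measure R (B i - A i) < e / (2 * real N)" for R
    proof -
      interpret R: prob_space R by fact
      have half: "(\<Sum>i<N. e / (2 * real N)) = e / 2"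
      proof -
        have "0 < real N" by (simp add: N_def)
        then show ?thesis by (simp add: field_simps)
      qed
      have "measure R (\<Union>i<N. A i - B i) \<le> (\<Sum>i<N. measure R (A i - B i))"
        using AR BR by (intro R.finite_measure_subadditive_finite) auto
      also have "\<dots> \<le> (\<Sum>i<N. e / (2 * real N))" using b1 by (intro sum_mono less_imp_le)
      finally have 1: "measure R (\<Union>i<N. A i - B i) \<le> e / 2" using half by simp
      have "measure R (\<Union>i<N. B i - A i) \<le> (\<Sum>i<N. measure R (B i - A i))"
        using AR BR by (intro R.finite_measure_subadditive_finite) auto
      also have "\<dots> \<le> (\<Sum>i<N. e / (2 * real N))" using b2 by (intro sum_mono less_imp_le)
      finally have 2: "measure R (\<Union>i<N. B i - A i) \<le> e / 2" using half by simp
      have m: "?U - (\<Union>i<N. A i) \<in> sets R" "(\<Union>i<N. A i - B i) \<in> sets R" "(\<Union>i<N. B i - A i) \<in> sets R"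
        using AR BR by (intro sets.Diff sets.countable_UN sets.finite_UN; auto)+
      have "measure R (?U - ?V) \<le> measure R ((?U - (\<Union>i<N. A i)) \<union> (\<Union>i<N. A i - B i))"
        using m by (intro R.finite_measure_mono) auto
      also have "\<dots> \<le> measure R (?U - (\<Union>i<N. A i)) + measure R (\<Union>i<N. A i - B i)"
        using m by (intro measure_Un_le) auto
      finally have "measure R (?U - ?V) < e" using 1 N by linarith
      moreover have "measure R (?V - ?U) \<le> measure R (\<Union>i<N. B i - A i)"
        using m by (intro R.finite_measure_mono) auto
      ultimately show ?thesis using 2 Union.prems by linarith
    qed
    show ?case
      using main[OF P A(1) Gs(1)[OF B(1)] N(1) B(2,3)] main[OF Q A(2) Gs(2)[OF B(1)] N(2) B(4,5)]
      by (intro bexI[OF _ VG]) (auto simp: N_def)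
  qed
qed

section \<open>Wiener measure\<close>

lemma space_path_space: "space path_space = {w \<in> extensional {0..1}. continuous_on {0..1} w}"
  by (auto simp: path_space_def space_restrict_space space_PiM PiE_def)

lemma measurable_path_eval: "t \<in> {0..1} \<Longrightarrow> (\<lambda>w. w t) \<in> borel_measurable path_space"
  unfolding path_space_def
  by (intro measurable_restrict_space1 measurable_component_singleton)

lemma measurable_path_spaceI:
  assumes "\<And>t. t \<in> {0..1} \<Longrightarrow> (\<lambda>x. X x t) \<in> borel_measurable N"
    and "\<And>x. x \<in> space N \<Longrightarrow> continuous_on {0..1} (X x)"
  shows "(\<lambda>x. \<lambda>t\<in>{0..1}. X x t) \<in> measurable N path_space"
  unfolding path_space_def
proof (rule measurable_restrict_space2)
  show "(\<lambda>x. \<lambda>t\<in>{0..1}. X x t) \<in> space N \<rightarrow> {w. continuous_on {0..1} w}"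
    using assms(2) by (auto intro!: continuous_on_eq[OF assms(2)])
  show "(\<lambda>x. \<lambda>t\<in>{0..1}. X x t) \<in> measurable N (\<Pi>\<^sub>M t\<in>{0..1}. borel)"
    using assms(1) by (intro measurable_restrict)
qed

text \<open>Independence depends only on the joint law: \<open>N\<close> is the image of
  \<open>M\<close> under \<open>T\<close>, and each \<open>Y i\<close> composed with
  \<open>T\<close> is an almost sure version of \<open>X i\<close>.\<close>

lemma (in prob_space) indep_vars_cong_AE_distr:
  fixes X :: "'i \<Rightarrow> 'a \<Rightarrow> real"
  assumes N: "prob_space N" and T: "T \<in> measurable M N" "N = distr M N T"
    and X: "\<And>i. i \<in> I \<Longrightarrow> X i \<in> borel_measurable M" and Y: "\<And>i. i \<in> I \<Longrightarrow> Y i \<in> borel_measurable N"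
    and eq: "\<And>i. i \<in> I \<Longrightarrow> AE \<omega> in M. Y i (T \<omega>) = X i \<omega>" and "finite I"
    and ind: "indep_vars (\<lambda>_. borel) X I"
  shows "prob_space.indep_vars N (\<lambda>_. borel) Y I"
proof -
  interpret N: prob_space N by fact
  show ?thesis
  proof (cases "I = {}")
    case True then show ?thesis by (simp add: N.indep_vars_def N.indep_sets_def)
  next
    case False
    have mX: "(\<lambda>\<omega>. \<lambda>i\<in>I. X i \<omega>) \<in> measurable M (PiM I (\<lambda>_. borel))" using X by (intro measurable_restrict)
    have mY: "(\<lambda>w. \<lambda>i\<in>I. Y i w) \<in> measurable N (PiM I (\<lambda>_. borel))" using Y by (intro measurable_restrict)
    have 1: "distr N borel (Y i) = distr M borel (X i)" if i: "i \<in> I" for i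
    proof -
      have "distr N borel (Y i) = distr M borel (Y i \<circ> T)"
        by (subst T(2)) (rule distr_distr[OF Y[OF i] T(1)])
      also have "\<dots> = distr M borel (X i)"
        using eq[OF i] measurable_comp[OF T(1) Y[OF i]] X[OF i]
        by (intro distr_cong_AE) (auto simp: comp_def)
      finally show ?thesis .
    qed
    have "AE \<omega> in M. \<forall>i\<in>I. Y i (T \<omega>) = X i \<omega>" using eq \<open>finite I\<close> by (intro AE_finite_allI) auto
    then have AEeq: "AE \<omega> in M. (\<lambda>i\<in>I. Y i (T \<omega>)) = (\<lambda>i\<in>I. X i \<omega>)" by eventually_elim auto
    have "distr N (PiM I (\<lambda>_. borel)) (\<lambda>w. \<lambda>i\<in>I. Y i w) = distr M (PiM I (\<lambda>_. borel)) ((\<lambda>w. \<lambda>i\<in>I. Y i w) \<circ> T)"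
      by (subst T(2)) (rule distr_distr[OF mY T(1)])
    also have "\<dots> = distr M (PiM I (\<lambda>_. borel)) (\<lambda>\<omega>. \<lambda>i\<in>I. X i \<omega>)"
      using AEeq measurable_comp[OF T(1) mY] mX by (intro distr_cong_AE) (auto simp: comp_def)
    also have "\<dots> = PiM I (\<lambda>i. distr M borel (X i))"
      using indep_vars_iff_distr_eq_PiM'[where M'="\<lambda>_. borel" and X=X, OF False X] ind by simp
    also have "\<dots> = PiM I (\<lambda>i. distr N borel (Y i))" using 1 by (intro PiM_cong) auto
    finally show ?thesis
      using N.indep_vars_iff_distr_eq_PiM'[where M'="\<lambda>_. borel" and X=Y, OF False Y] by simp
  qed
qed

text \<open>\<open>wiener_measure\<close> is chosen by \<open>SOME\<close>, which needs a witness;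
  the law of \<open>W\<close> on the path space is one, so any space carrying a Brownian motion
  supplies it.\<close>

lemma wiener_measure:
  fixes M :: "'a measure"
  assumes W: "brownian_motion M W"
  shows "sets wiener_measure = sets path_space" "brownian_motion wiener_measure (\<lambda>t w. w t)"
proof -
  interpret prob_space M using W by (simp add: brownian_motion_def)
  have "AE \<omega> in M. continuous_on {0..1} (\<lambda>t. W t \<omega>)" using W by (simp add: brownian_motion_def)
  then obtain N where N: "N \<in> null_sets M" "{\<omega>\<in>space M. \<not> continuous_on {0..1} (\<lambda>t. W t \<omega>)} \<subseteq> N"
    by (auto elim!: AE_E simp: null_sets_def)
  have [measurable]: "N \<in> sets M" using N by auto
  define V where "V t \<omega> = (if \<omega> \<in> N then 0 else W t \<omega>)" for t \<omega>
  define T where "T \<omega> = (\<lambda>t\<in>{0..1}. V t \<omega>)" for \<omega>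
  have mW: "W t \<in> borel_measurable M" if "t \<in> {0..1}" for t using W that by (simp add: brownian_motion_def)
  have T: "T \<in> measurable M path_space"
    unfolding T_def
  proof (rule measurable_path_spaceI)
    fix t :: real assume "t \<in> {0..1}"
    note [measurable] = mW[OF this]
    show "(\<lambda>\<omega>. V t \<omega>) \<in> borel_measurable M" unfolding V_def by measurable
  next
    fix \<omega> assume "\<omega> \<in> space M"
    then show "continuous_on {0..1} (\<lambda>t. V t \<omega>)" using N(2) by (cases "\<omega> \<in> N") (auto simp: V_def)
  qed
  define P where "P = distr M path_space T"
  have P: "prob_space P" unfolding P_def by (rule prob_space_distr[OF T])
  have sP: "sets P = sets path_space" by (simp add: P_def)
  have TP: "T \<in> measurable M P" "P = distr M P T"
    using T by (simp_all add: P_def cong: measurable_cong_sets distr_cong)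
  have mP: "(\<lambda>w. w t) \<in> borel_measurable P" if "t \<in> {0..1}" for t
    using measurable_path_eval[OF that] by (simp add: P_def)
  have eq: "AE \<omega> in M. T \<omega> t = W t \<omega>" if "t \<in> {0..1}" for t
    using AE_not_in[OF N(1)] by eventually_elim (use that in \<open>simp add: T_def V_def\<close>)
  have eq2: "AE \<omega> in M. T \<omega> t - T \<omega> s = W t \<omega> - W s \<omega>" if "t \<in> {0..1}" "s \<in> {0..1}" for t s
    using eq[OF that(1)] eq[OF that(2)] by eventually_elim simp
  have "brownian_motion P (\<lambda>t w. w t)"
    unfolding brownian_motion_def
  proof (intro conjI ballI allI impI P)
    show "(\<lambda>w. w t) \<in> borel_measurable P" if "t \<in> {0..1}" for t by (rule mP[OF that])
    have "AE \<omega> in M. W 0 \<omega> = 0" using W by (simp add: brownian_motion_def)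
    then have "AE \<omega> in M. T \<omega> 0 = 0" using eq[of 0] by auto
    moreover have "{w \<in> space path_space. w 0 = 0} \<in> sets path_space"
    proof -
      have [measurable]: "(\<lambda>w. w 0) \<in> borel_measurable path_space" by (rule measurable_path_eval) simp
      show ?thesis by measurable
    qed
    ultimately show "AE w in P. w 0 = 0" unfolding P_def by (subst AE_distr_iff[OF T]) auto
    show "AE w in P. continuous_on {0..1} (\<lambda>t. w t)"
      by (rule AE_I2) (simp add: P_def space_path_space)
  next
    fix s t :: real assume st: "0 \<le> s \<and> s < t \<and> t \<le> 1"
    then have m: "(\<lambda>w. w t - w s) \<in> borel_measurable P" by (intro borel_measurable_diff mP) auto
    have D: "distributed M lborel (\<lambda>\<omega>. W t \<omega> - W s \<omega>) (normal_density 0 (sqrt (t - s)))"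
      using brownian_motion_increment[OF W] st by blast
    have "distr P lborel (\<lambda>w. w t - w s) = distr M lborel ((\<lambda>w. w t - w s) \<circ> T)"
      using m by (subst TP(2)) (rule distr_distr[OF _ TP(1)]; simp)
    also have "\<dots> = distr M lborel (\<lambda>\<omega>. W t \<omega> - W s \<omega>)"
      using eq2[of t s] st measurable_comp[OF TP(1) m] mW by (intro distr_cong_AE) (auto simp: comp_def)
    finally show "distributed P lborel (\<lambda>w. w t - w s) (normal_density 0 (sqrt (t - s)))"
      using D m by (simp add: distributed_def)
  next
    fix n :: nat and \<tau> :: "nat \<Rightarrow> real"
    assume "(\<forall>k\<le>n. \<tau> k \<in> {0..1}) \<and> (\<forall>k<n. \<tau> k \<le> \<tau> (Suc k))"
    then have \<tau>: "\<And>k. k \<le> n \<Longrightarrow> \<tau> k \<in> {0..1}" "\<And>k. k < n \<Longrightarrow> \<tau> k \<le> \<tau> (Suc k)" by auto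
    show "prob_space.indep_vars P (\<lambda>_. borel) (\<lambda>k w. w (\<tau> (Suc k)) - w (\<tau> k)) {..<n}"
    proof (rule indep_vars_cong_AE_distr[OF P TP])
      show "indep_vars (\<lambda>_. borel) (\<lambda>k \<omega>. W (\<tau> (Suc k)) \<omega> - W (\<tau> k) \<omega>) {..<n}"
        using brownian_motion_indep_increments[OF W, of n \<tau>] \<tau> by blast
    qed (use \<tau>(1) in \<open>auto intro!: borel_measurable_diff mP mW eq2\<close>)
  qed
  then have "sets wiener_measure = sets path_space \<and> brownian_motion wiener_measure (\<lambda>t w. w t)"
    unfolding wiener_measure_def by (intro someI[of "\<lambda>P. sets P = sets path_space \<and> brownian_motion P (\<lambda>t w. w t)" P]) (simp add: sP)
  then show "sets wiener_measure = sets path_space" "brownian_motion wiener_measure (\<lambda>t w. w t)" by auto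
qed

text \<open>Events that depend on finitely many times: the algebra on which two drifts can be
  compared by finite-dimensional Gaussian densities.\<close>

definition cylinders :: "(real \<Rightarrow> real) set set" where
  "cylinders = {{w \<in> space path_space. restrict w T \<in> A} | T A.
     finite T \<and> T \<subseteq> {0..1} \<and> A \<in> sets (PiM T (\<lambda>_. borel :: real measure))}"

lemma measurable_restrict_path: "T \<subseteq> {0..1} \<Longrightarrow> (\<lambda>w. restrict w T) \<in> measurable path_space (PiM T (\<lambda>_. borel))"
  by (intro measurable_restrict measurable_path_eval) auto

lemma cylinders_subset: "cylinders \<subseteq> sets path_space"
proof
  fix B assume "B \<in> cylinders"
  then obtain T A where B: "B = {w \<in> space path_space. restrict w T \<in> A}" and T: "T \<subseteq> {0..1}"
    and A: "A \<in> sets (PiM T (\<lambda>_. borel :: real measure))" by (auto simp: cylinders_def)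
  have "(\<lambda>w. restrict w T) -` A \<inter> space path_space \<in> sets path_space"
    by (rule measurable_sets[OF measurable_restrict_path[OF T] A])
  then show "B \<in> sets path_space" unfolding B by (simp add: vimage_def Int_def conj_commute)
qed

lemma cylinders_algebra:
  shows "A \<in> cylinders \<Longrightarrow> space path_space - A \<in> cylinders"
    and "A \<in> cylinders \<Longrightarrow> B \<in> cylinders \<Longrightarrow> A \<union> B \<in> cylinders"
    and "{} \<in> cylinders"
proof -
  assume "A \<in> cylinders"
  then obtain T S where A: "A = {w \<in> space path_space. restrict w T \<in> S}" "finite T" "T \<subseteq> {0..1}"
    "S \<in> sets (PiM T (\<lambda>_. borel :: real measure))" by (auto simp: cylinders_def)
  have "restrict w T \<in> space (PiM T (\<lambda>_. borel :: real measure))" for w by (simp add: space_PiM)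
  then have "space path_space - A = {w \<in> space path_space. restrict w T \<in> space (PiM T (\<lambda>_. borel)) - S}"
    unfolding A(1) by blast
  then show "space path_space - A \<in> cylinders"
    unfolding cylinders_def using A sets.compl_sets[OF A(4)] by blast
next
  assume "A \<in> cylinders" "B \<in> cylinders"
  then obtain T S T' S' where A: "A = {w \<in> space path_space. restrict w T \<in> S}" "finite T" "T \<subseteq> {0..1}"
    "S \<in> sets (PiM T (\<lambda>_. borel :: real measure))"
    and B: "B = {w \<in> space path_space. restrict w T' \<in> S'}" "finite T'" "T' \<subseteq> {0..1}"
    "S' \<in> sets (PiM T' (\<lambda>_. borel :: real measure))" unfolding cylinders_def by blast
  let ?P = "PiM (T \<union> T') (\<lambda>_. borel :: real measure)"
  define R where "R = ((\<lambda>x. restrict x T) -` S \<inter> space ?P) \<union> ((\<lambda>x. restrict x T') -` S' \<inter> space ?P)"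
  have R: "R \<in> sets ?P"
    unfolding R_def
    by (intro sets.Un measurable_sets[OF measurable_restrict_subset A(4)] measurable_sets[OF measurable_restrict_subset B(4)]) auto
  have "restrict w (T \<union> T') \<in> space ?P" for w by (simp add: space_PiM)
  moreover have "restrict (restrict w (T \<union> T')) T = restrict w T" "restrict (restrict w (T \<union> T')) T' = restrict w T'" for w :: "real \<Rightarrow> real"
    by auto
  ultimately have "A \<union> B = {w \<in> space path_space. restrict w (T \<union> T') \<in> R}"
    unfolding A(1) B(1) R_def by auto
  then show "A \<union> B \<in> cylinders" unfolding cylinders_def using A B R by blast
next
  have "{} = {w \<in> space path_space. restrict w {} \<in> {}}" by simp
  then show "{} \<in> cylinders" unfolding cylinders_def by blast
qed

lemma sets_path_space: "sets path_space = sigma_sets (space path_space) cylinders"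
proof
  have G: "cylinders \<subseteq> Pow (space path_space)" by (auto simp: cylinders_def)
  let ?S = "sigma (space path_space) cylinders"
  have "(\<lambda>w. w) \<in> measurable ?S path_space"
    unfolding path_space_def
  proof (rule measurable_restrict_space2)
    show "(\<lambda>w. w) \<in> space (sigma (space (restrict_space (\<Pi>\<^sub>M t\<in>{0..1}. borel) {w. continuous_on {0..1} w})) cylinders) \<rightarrow> {w. continuous_on {0..1} w}"
      unfolding path_space_def[symmetric] using G by (auto simp: space_measure_of space_path_space)
    show "(\<lambda>w. w) \<in> measurable (sigma (space (restrict_space (\<Pi>\<^sub>M t\<in>{0..1}. borel) {w. continuous_on {0..1} w})) cylinders) (\<Pi>\<^sub>M t\<in>{0..1}. borel)"
      unfolding path_space_def[symmetric]
    proof (rule measurable_PiM_single)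
      show "(\<lambda>w. w) \<in> space ?S \<rightarrow> (\<Pi>\<^sub>E t\<in>{0..1}. space borel)"
        using G by (auto simp: space_measure_of space_path_space PiE_iff)
      fix B :: "real set" and t :: real assume t: "t \<in> {0..1}" and B: "B \<in> sets borel"
      let ?A = "(\<lambda>x. x t) -` B \<inter> space (PiM {t} (\<lambda>_. borel :: real measure))"
      have "?A \<in> sets (PiM {t} (\<lambda>_. borel :: real measure))"
        using measurable_sets[OF _ B, of "\<lambda>x. x t" "PiM {t} (\<lambda>_. borel :: real measure)"]
          measurable_component_singleton[of t "{t}" "\<lambda>_. borel :: real measure"] by simp
      moreover have "{w \<in> space path_space. w t \<in> B} = {w \<in> space path_space. restrict w {t} \<in> ?A}"
        by (auto simp: space_PiM)
      ultimately have "{w \<in> space path_space. w t \<in> B} \<in> cylinders"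
        unfolding cylinders_def using t by blast
      then show "{w \<in> space ?S. w t \<in> B} \<in> sets ?S" using G by (simp add: space_measure_of sets_measure_of)
    qed
  qed
  note id = this
  show "sets path_space \<subseteq> sigma_sets (space path_space) cylinders"
  proof
    fix A assume A: "A \<in> sets path_space"
    have "(\<lambda>w. w) -` A \<inter> space ?S \<in> sets ?S" by (rule measurable_sets[OF id A])
    moreover have "(\<lambda>w. w) -` A \<inter> space ?S = A" using sets.sets_into_space[OF A] G by (auto simp: space_measure_of)
    ultimately show "A \<in> sigma_sets (space path_space) cylinders" using G by (simp add: sets_measure_of)
  qed
  show "sigma_sets (space path_space) cylinders \<subseteq> sets path_space"
    by (rule sets.sigma_sets_subset[OF cylinders_subset])
qed

section \<open>The benchmark\<close>

text \<open>\<open>f\<close> is bounded on the unit interval, so its integral is Lipschitz; the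
  observation then takes values in \<open>path_space\<close>.\<close>

lemma (in convex_signal) continuous_drift: "continuous_on {0..1} (drift f)"
proof -
  define C where "C = \<bar>mn\<bar> + \<bar>top_value\<bar>"
  have "\<bar>drift f y - drift f x\<bar> \<le> C * \<bar>y - x\<bar>" if "x \<in> {0..1}" "y \<in> {0..1}" for x y
    using that
  proof (induction x y rule: linorder_wlog)
    case (le a b)
    have "- C \<le> mn" "top_value \<le> C" by (auto simp: C_def)
    then have "- C * (b - a) \<le> mn * (b - a)" "top_value * (b - a) \<le> C * (b - a)"
      using le by (intro mult_right_mono; simp)+
    then show ?case using drift_increment_bounds[of a b] le by (simp add: abs_le_iff)
  qed (simp add: abs_minus_commute)
  then have "C-lipschitz_on {0..1} (drift f)"
    by (intro lipschitz_onI) (auto simp: dist_real_def abs_minus_commute C_def)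
  then show ?thesis by (rule lipschitz_on_continuous_on)
qed

lemma drift_0: "drift f 0 = 0"
  unfolding drift_def set_lebesgue_integral_def
  by (rule integral_eq_zero_AE, rule AE_mp[OF AE_lborel_singleton[of 0]]) (auto simp: indicator_def)

lemma white_noise_eq: "white_noise \<epsilon> f w t = drift f t + \<epsilon> * w t"
  by (simp add: white_noise_def drift_def)

lemma ennreal_affine:
  "0 \<le> x \<Longrightarrow> ennreal (3/4) * ennreal x + ennreal (1/3 * exp c) = ennreal (3/4 * x + 1/3 * exp c)"
proof -
  assume "0 \<le> x"
  then have "ennreal (3/4 * x) = ennreal (3/4) * ennreal x" by (intro ennreal_mult) auto
  moreover have "ennreal (3/4 * x + 1/3 * exp c) = ennreal (3/4 * x) + ennreal (1/3 * exp c)"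
    using \<open>0 \<le> x\<close> by (intro ennreal_plus) auto
  ultimately show ?thesis by (simp only:)
qed

locale wiener_space = 
  fixes P :: "(real \<Rightarrow> real) measure"
  assumes sets_P: "sets P = sets path_space" and brownian_P: "brownian_motion P (\<lambda>t w. w t)"
begin

sublocale prob_space P using brownian_P by (simp add: brownian_motion_def)

lemma space_P: "space P = space path_space"
  using sets_P by (rule sets_eq_imp_space_eq)

lemma measurable_eval: "t \<in> {0..1} \<Longrightarrow> (\<lambda>w. w t) \<in> borel_measurable P"
  using brownian_P by (simp add: brownian_motion_def)

lemma measurable_observation:
  assumes "f \<in> convex_class"
  shows "(\<lambda>w. \<lambda>t\<in>{0..1}. white_noise \<epsilon> f w t) \<in> measurable P path_space"
proof (rule measurable_path_spaceI)
  interpret convex_signal f by standard fact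
  show "(\<lambda>w. white_noise \<epsilon> f w t) \<in> borel_measurable P" if "t \<in> {0..1}" for t
    unfolding white_noise_eq using that
    by (intro borel_measurable_add borel_measurable_times borel_measurable_const measurable_eval)
  show "continuous_on {0..1} (white_noise \<epsilon> f w)" if "w \<in> space P" for w
    unfolding white_noise_eq[abs_def] using that
    by (intro continuous_intros continuous_drift) (simp add: space_P space_path_space)
qed

definition law :: "real \<Rightarrow> (real \<Rightarrow> real) \<Rightarrow> (real \<Rightarrow> real) measure" where
  "law \<epsilon> f = distr P path_space (\<lambda>w. \<lambda>t\<in>{0..1}. white_noise \<epsilon> f w t)"

lemma prob_space_law: "f \<in> convex_class \<Longrightarrow> prob_space (law \<epsilon> f)"
  unfolding law_def by (intro prob_space_distr measurable_observation)

lemma sets_law: "sets (law \<epsilon> f) = sets path_space"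
  by (simp add: law_def)

text \<open>Sorted observation times turn the cylinder into an event of independent normal
  increments, which under \<open>g\<close> are those under \<open>f\<close> shifted by
  \<open>\<delta>\<close>. Summing \<open>drift_difference_energy\<close> over the intervals bounds
  the exponent by the squared distance over \<open>\<epsilon>^2\<close>, hence by 1/25.\<close>

lemma cylinder_bound:
  assumes fg: "f \<in> convex_class" "g \<in> convex_class" and eps: "0 < \<epsilon>"
    and close: "(LINT t:{0..1}|lborel. (g t - f t)\<^sup>2) \<le> \<epsilon>\<^sup>2 / 25" and B: "B \<in> cylinders"
  shows "emeasure (law \<epsilon> g) B \<le> ennreal (3/4) * emeasure (law \<epsilon> f) B + ennreal (1/3 * exp (1/25))"
proof -
  obtain T A where Beq: "B = {w \<in> space path_space. restrict w T \<in> A}" and T: "finite T" "T \<subseteq> {0..1}"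
    and A: "A \<in> sets (PiM T (\<lambda>_. borel :: real measure))" using B by (auto simp: cylinders_def)
  \<comment> \<open>Time 0 anchors the partial sums, as \<open>w 0 = 0\<close> almost surely;
    together with time 1 it guarantees at least one increment.\<close>
  define S where "S = {0, 1} \<union> T"
  have S: "finite S" using T by (simp add: S_def)
  define L where "L = sorted_list_of_set S"
  define \<tau> where "\<tau> k = L ! k" for k
  define n where "n = length L - 1"
  have "set L = S" unfolding L_def by (rule set_sorted_list_of_set[OF S])
  then have setL: "set L = {0, 1} \<union> T" by (simp only: S_def)
  have "card {0, 1::real} \<le> card S" using S by (intro card_mono) (auto simp: S_def)
  moreover have "length L = card S" unfolding L_def by (rule length_sorted_list_of_set)
  ultimately have "2 \<le> length L" by simp
  then have n: "length L = Suc n" "0 < n" by (auto simp: n_def)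
  have \<tau>_mem: "\<tau> k \<in> {0..1}" if "k \<le> n" for k
  proof -
    have "\<tau> k \<in> set L" using that n by (auto simp: \<tau>_def)
    then show ?thesis using setL T by auto
  qed
  have srt: "sorted_wrt (<) L" unfolding L_def using strict_sorted_list_of_set by blast
  have \<tau>_less: "\<tau> k < \<tau> (Suc k)" if "k < n" for k
    unfolding \<tau>_def using that n by (intro sorted_wrt_nth_less[OF srt]) auto
  have ex: "\<exists>k\<le>n. \<tau> k = t" if "t \<in> set L" for t
    using that n unfolding in_set_conv_nth \<tau>_def by (metis less_Suc_eq_le)
  have \<tau>0: "\<tau> 0 = 0"
  proof -
    obtain k where k: "k \<le> n" "\<tau> k = 0" using ex[of 0] setL by auto
    have "\<tau> 0 \<le> \<tau> k"
    proof (cases "k = 0")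
      case False
      then have "\<tau> 0 < \<tau> k" unfolding \<tau>_def using k n by (intro sorted_wrt_nth_less[OF srt]) auto
      then show ?thesis by simp
    qed simp
    then show ?thesis using k \<tau>_mem[of 0] by auto
  qed
  have "\<forall>t\<in>T. \<exists>k\<le>n. \<tau> k = t" using ex setL by auto
  then obtain idx where idx: "\<And>t. t \<in> T \<Longrightarrow> idx t \<le> n" "\<And>t. t \<in> T \<Longrightarrow> \<tau> (idx t) = t" by metis
  let ?I = "{..<n}"
  define X where "X h k w = (drift h (\<tau> (Suc k)) - drift h (\<tau> k)) + \<epsilon> * (w (\<tau> (Suc k)) - w (\<tau> k))"
    for h :: "real \<Rightarrow> real" and k and w :: "real \<Rightarrow> real"
  define \<delta> where "\<delta> k = (drift g (\<tau> (Suc k)) - drift g (\<tau> k)) - (drift f (\<tau> (Suc k)) - drift f (\<tau> k))" for k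
  \<comment> \<open>The value 1 outside the range meets the demand of
    \<open>shifted_normals_bound\<close> that every \<open>\<sigma> k\<close> be positive.\<close>
  define \<sigma> where "\<sigma> k = (if k < n then \<epsilon> * sqrt (\<tau> (Suc k) - \<tau> k) else 1)" for k
  define H where "H x = (\<lambda>t\<in>T. \<Sum>k<idx t. x k)" for x :: "nat \<Rightarrow> real"
  have H: "H \<in> measurable (PiM ?I (\<lambda>_. borel)) (PiM T (\<lambda>_. borel))"
    unfolding H_def[abs_def]
  proof (rule measurable_restrict)
    fix t assume "t \<in> T"
    then have "k \<in> ?I" if "k \<in> {..<idx t}" for k using idx(1)[of t] that by simp
    then have "(\<lambda>x. x k) \<in> borel_measurable (PiM ?I (\<lambda>_. borel :: real measure))" if "k \<in> {..<idx t}" for k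
      using that by (intro measurable_component_singleton)
    then show "(\<lambda>x. \<Sum>k<idx t. x k :: real) \<in> borel_measurable (PiM ?I (\<lambda>_. borel))"
      by (rule borel_measurable_sum)
  qed
  define A' where "A' = H -` A \<inter> space (PiM ?I (\<lambda>_. borel :: real measure))"
  have A': "A' \<in> sets (PiM ?I (\<lambda>_. borel))" unfolding A'_def by (rule measurable_sets[OF H A])
  have mX: "X h k \<in> borel_measurable P" if "k < n" for h k
    unfolding X_def[abs_def] using that \<tau>_mem[of k] \<tau>_mem[of "Suc k"]
    by (intro borel_measurable_add borel_measurable_times borel_measurable_diff borel_measurable_const measurable_eval) auto
  have mXr: "(\<lambda>w. \<lambda>k\<in>?I. X h k w) \<in> measurable P (PiM ?I (\<lambda>_. borel))" for h
    using mX by (intro measurable_restrict) auto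
  have "AE w in P. w 0 = 0" using brownian_P by (simp add: brownian_motion_def)
  then have AE_eq: "AE w in P. restrict (\<lambda>t\<in>{0..1}. white_noise \<epsilon> h w t) T = H (\<lambda>k\<in>?I. X h k w)" for h
  proof eventually_elim
    case (elim w)
    have "white_noise \<epsilon> h w t = (\<Sum>k<idx t. X h k w)" if t: "t \<in> T" for t
    proof -
      let ?G = "\<lambda>k. drift h (\<tau> k) + \<epsilon> * w (\<tau> k)"
      have "(\<Sum>k<idx t. X h k w) = (\<Sum>k<idx t. ?G (Suc k) - ?G k)"
        by (simp add: X_def algebra_simps)
      also have "\<dots> = ?G (idx t) - ?G 0" by (rule sum_lessThan_telescope)
      finally show ?thesis using elim by (simp add: \<tau>0 idx(2)[OF t] drift_0 white_noise_eq)
    qed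
    moreover have "(\<Sum>k<idx t. (\<lambda>k\<in>?I. X h k w) k) = (\<Sum>k<idx t. X h k w)" if "t \<in> T" for t
      using idx(1)[OF that] by (intro sum.cong) auto
    ultimately show ?case unfolding H_def using T(2) by (intro restrict_ext) auto
  qed
  have law_eq: "emeasure (law \<epsilon> h) B = emeasure P {w \<in> space P. (\<lambda>k\<in>?I. X h k w) \<in> A'}" if h: "h \<in> convex_class" for h
  proof -
    note m = measurable_observation[OF h, of \<epsilon>]
    have Bs: "B \<in> sets path_space" using B cylinders_subset by auto
    have "emeasure (law \<epsilon> h) B = emeasure P ((\<lambda>w. \<lambda>t\<in>{0..1}. white_noise \<epsilon> h w t) -` B \<inter> space P)"
      unfolding law_def by (rule emeasure_distr[OF m Bs])
    also have "\<dots> = emeasure P {w \<in> space P. (\<lambda>k\<in>?I. X h k w) \<in> A'}"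
    proof (rule emeasure_eq_AE)
      show "(\<lambda>w. \<lambda>t\<in>{0..1}. white_noise \<epsilon> h w t) -` B \<inter> space P \<in> sets P" by (rule measurable_sets[OF m Bs])
      have "(\<lambda>w. \<lambda>k\<in>?I. X h k w) -` A' \<inter> space P \<in> sets P" by (rule measurable_sets[OF mXr A'])
      then show "{w \<in> space P. (\<lambda>k\<in>?I. X h k w) \<in> A'} \<in> sets P" by (simp add: vimage_def Int_def conj_commute)
      show "AE w in P. w \<in> (\<lambda>w. \<lambda>t\<in>{0..1}. white_noise \<epsilon> h w t) -` B \<inter> space P \<longleftrightarrow> w \<in> {w \<in> space P. (\<lambda>k\<in>?I. X h k w) \<in> A'}"
        using AE_eq[of h] AE_space
      proof eventually_elim
        case (elim w)
        have "(\<lambda>t\<in>{0..1}. white_noise \<epsilon> h w t) \<in> space path_space" using measurable_space[OF m] elim by simp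
        moreover have "(\<lambda>k\<in>?I. X h k w) \<in> space (PiM ?I (\<lambda>_. borel :: real measure))" by (simp add: space_PiM)
        ultimately show ?case using elim unfolding Beq A'_def by simp
      qed
    qed
    finally show ?thesis .
  qed
  have \<sigma>: "0 < \<sigma> k" for k using \<tau>_less[of k] eps by (simp add: \<sigma>_def)
  have "indep_vars (\<lambda>_. borel) (\<lambda>k w. w (\<tau> (Suc k)) - w (\<tau> k)) ?I"
    using \<tau>_mem \<tau>_less by (intro brownian_motion_indep_increments[OF brownian_P]) (auto simp: less_imp_le)
  then have ind: "indep_vars (\<lambda>_. borel) (X f) ?I"
    unfolding X_def[abs_def]
    by (rule indep_vars_compose2[where Y="\<lambda>k x. (drift f (\<tau> (Suc k)) - drift f (\<tau> k)) + \<epsilon> * x"]) simp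
  have nX: "distributed P lborel (X f k) (normal_density (drift f (\<tau> (Suc k)) - drift f (\<tau> k)) (\<sigma> k))" if k: "k \<in> ?I" for k
  proof -
    have k': "k < n" "0 \<le> \<tau> k" "\<tau> (Suc k) \<le> 1" using k \<tau>_mem[of k] \<tau>_mem[of "Suc k"] by auto
    have "distributed P lborel (\<lambda>w. w (\<tau> (Suc k)) - w (\<tau> k)) (normal_density 0 (sqrt (\<tau> (Suc k) - \<tau> k)))"
      by (rule brownian_motion_increment[OF brownian_P k'(2) \<tau>_less[OF k'(1)] k'(3)])
    then have "distributed P lborel (\<lambda>w. (drift f (\<tau> (Suc k)) - drift f (\<tau> k)) + \<epsilon> * (w (\<tau> (Suc k)) - w (\<tau> k)))
       (normal_density ((drift f (\<tau> (Suc k)) - drift f (\<tau> k)) + \<epsilon> * 0) (\<bar>\<epsilon>\<bar> * sqrt (\<tau> (Suc k) - \<tau> k)))"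
      using eps \<tau>_less[OF k'(1)] by (intro normal_density_affine) auto
    then show ?thesis using eps k' by (simp add: X_def[abs_def] \<sigma>_def)
  qed
  have Xg: "X g k w = X f k w + \<delta> k" for k w by (simp add: X_def \<delta>_def)
  have energy: "(\<Sum>k\<in>?I. (\<delta> k)\<^sup>2 / (\<sigma> k)\<^sup>2) \<le> 1/25"
  proof -
    let ?h = "\<lambda>t. (g t - f t)\<^sup>2"
    have int: "set_integrable lborel {0..1} ?h"
      using drift_difference_energy(2)[OF fg, of 0 1] by simp
    have le: "(\<delta> k)\<^sup>2 / (\<sigma> k)\<^sup>2 \<le> 1 / \<epsilon>\<^sup>2 * (LINT t:{\<tau> k<..\<tau> (Suc k)}|lborel. ?h t)" if k: "k \<in> ?I" for k
    proof -
      have k': "k < n" "0 \<le> \<tau> k" "\<tau> (Suc k) \<le> 1" using k \<tau>_mem[of k] \<tau>_mem[of "Suc k"] by auto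
      have "(\<delta> k)\<^sup>2 / (\<sigma> k)\<^sup>2 = 1 / \<epsilon>\<^sup>2 * ((\<delta> k)\<^sup>2 / (\<tau> (Suc k) - \<tau> k))"
        using k' \<tau>_less[OF k'(1)] by (simp add: \<sigma>_def power_mult_distrib)
      also have "\<dots> \<le> 1 / \<epsilon>\<^sup>2 * (LINT t:{\<tau> k<..\<tau> (Suc k)}|lborel. ?h t)"
        unfolding \<delta>_def
        by (intro mult_left_mono drift_difference_energy(1)[OF fg k'(2) \<tau>_less[OF k'(1)] k'(3)]) auto
      finally show ?thesis .
    qed
    have tel: "\<tau> 0 \<le> \<tau> m \<and> (\<Sum>k<m. (LINT t:{\<tau> k<..\<tau> (Suc k)}|lborel. ?h t)) = (LINT t:{\<tau> 0<..\<tau> m}|lborel. ?h t)" if "m \<le> n" for m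
      using that
    proof (induction m)
      case 0 then show ?case by (simp add: set_lebesgue_integral_def)
    next
      case (Suc m)
      have m: "\<tau> m \<in> {0..1}" "\<tau> (Suc m) \<in> {0..1}" "\<tau> m < \<tau> (Suc m)" "\<tau> 0 \<le> \<tau> m"
        using Suc \<tau>_mem[of m] \<tau>_mem[of "Suc m"] \<tau>_less[of m] by auto
      then have "{\<tau> 0<..\<tau> (Suc m)} = {\<tau> 0<..\<tau> m} \<union> {\<tau> m<..\<tau> (Suc m)}" "{\<tau> 0<..\<tau> m} \<inter> {\<tau> m<..\<tau> (Suc m)} = {}"
        by auto
      moreover have "set_integrable lborel {\<tau> 0<..\<tau> m} ?h" "set_integrable lborel {\<tau> m<..\<tau> (Suc m)} ?h"
        using m by (auto intro!: set_integrable_subset[OF int] simp: \<tau>0)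
      ultimately have "(LINT t:{\<tau> 0<..\<tau> (Suc m)}|lborel. ?h t) = (LINT t:{\<tau> 0<..\<tau> m}|lborel. ?h t) + (LINT t:{\<tau> m<..\<tau> (Suc m)}|lborel. ?h t)"
        by (simp add: set_integral_Un)
      then show ?case using Suc m by simp
    qed
    have "(\<Sum>k\<in>?I. (\<delta> k)\<^sup>2 / (\<sigma> k)\<^sup>2) \<le> (\<Sum>k\<in>?I. 1 / \<epsilon>\<^sup>2 * (LINT t:{\<tau> k<..\<tau> (Suc k)}|lborel. ?h t))"
      by (intro sum_mono le)
    also have "\<dots> = 1 / \<epsilon>\<^sup>2 * (LINT t:{\<tau> 0<..\<tau> n}|lborel. ?h t)"
      unfolding sum_distrib_left[symmetric] using tel[of n] by simp
    also have "\<dots> \<le> 1 / \<epsilon>\<^sup>2 * (LINT t:{0..1}|lborel. ?h t)"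
    proof (rule mult_left_mono)
      have s: "{\<tau> 0<..\<tau> n} \<subseteq> {0..1}" using \<tau>_mem[of n] \<tau>0 by auto
      have "set_integrable lborel {\<tau> 0<..\<tau> n} ?h" by (rule set_integrable_subset[OF int _ s]) simp
      then show "(LINT t:{\<tau> 0<..\<tau> n}|lborel. ?h t) \<le> (LINT t:{0..1}|lborel. ?h t)"
        unfolding set_lebesgue_integral_def using int s
        by (intro integral_mono) (auto simp: set_integrable_def indicator_def)
    qed simp
    also have "\<dots> \<le> 1 / \<epsilon>\<^sup>2 * (\<epsilon>\<^sup>2 / 25)" using close by (intro mult_left_mono) auto
    finally show ?thesis using eps by simp
  qed
  have "emeasure P {w\<in>space P. (\<lambda>k\<in>?I. X f k w + \<delta> k) \<in> A'}
    \<le> ennreal (3/4) * emeasure P {w\<in>space P. (\<lambda>k\<in>?I. X f k w) \<in> A'} + ennreal (1/3 * exp (\<Sum>k\<in>?I. (\<delta> k)\<^sup>2 / (\<sigma> k)\<^sup>2))"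
    by (rule shifted_normals_bound[OF _ _ ind \<sigma> nX A']) (use n in auto)
  also have "\<dots> \<le> ennreal (3/4) * emeasure P {w\<in>space P. (\<lambda>k\<in>?I. X f k w) \<in> A'} + ennreal (1/3 * exp (1/25))"
    using energy by (intro add_left_mono ennreal_leI) simp
  finally show ?thesis unfolding law_eq[OF fg(1)] law_eq[OF fg(2)] Xg .
qed

text \<open>Approximating \<open>A\<close> by a cylinder under both laws at once gives the estimate
  up to an arbitrary \<open>e\<close>; the differences cost at most \<open>3/4 * e / 2\<close> and
  \<open>e / 2\<close>.\<close>

lemma law_bound:
  assumes fg: "f \<in> convex_class" "g \<in> convex_class" and eps: "0 < \<epsilon>"
    and close: "(LINT t:{0..1}|lborel. (g t - f t)\<^sup>2) \<le> \<epsilon>\<^sup>2 / 25" and A: "A \<in> sets path_space"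
  shows "measure (law \<epsilon> g) A \<le> 3/4 * measure (law \<epsilon> f) A + 1/3 * exp (1/25)"
proof (rule field_le_epsilon)
  fix e :: real assume "0 < e"
  interpret F: prob_space "law \<epsilon> f" by (rule prob_space_law[OF fg(1)])
  interpret G: prob_space "law \<epsilon> g" by (rule prob_space_law[OF fg(2)])
  have sp: "space (law \<epsilon> f) = space path_space" by (simp add: law_def)
  obtain B where B: "B \<in> cylinders" "measure (law \<epsilon> f) (B - A) < e / 2" "measure (law \<epsilon> g) (A - B) < e / 2"
    using approximation_by_algebra[OF F.prob_space_axioms G.prob_space_axioms, of cylinders A "e / 2"]
      sets_path_space cylinders_subset cylinders_algebra A \<open>0 < e\<close> unfolding sets_law sp by auto
  have Bs: "B \<in> sets path_space" using B(1) cylinders_subset by auto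
  have "ennreal (measure (law \<epsilon> g) B) \<le> ennreal (3/4 * measure (law \<epsilon> f) B + 1/3 * exp (1/25))"
    using cylinder_bound[OF fg eps close B(1)]
    unfolding F.emeasure_eq_measure G.emeasure_eq_measure by (simp only: ennreal_affine measure_nonneg)
  then have 1: "measure (law \<epsilon> g) B \<le> 3/4 * measure (law \<epsilon> f) B + 1/3 * exp (1/25)"
    by (subst (asm) ennreal_le_iff) (auto intro!: add_nonneg_nonneg)
  have "measure (law \<epsilon> g) A \<le> measure (law \<epsilon> g) (B \<union> (A - B))"
    using A Bs by (intro G.finite_measure_mono) (auto simp: sets_law)
  also have "\<dots> \<le> measure (law \<epsilon> g) B + measure (law \<epsilon> g) (A - B)"
    using A Bs by (intro measure_Un_le) (auto simp: sets_law)
  finally have 2: "measure (law \<epsilon> g) A \<le> measure (law \<epsilon> g) B + e / 2" using B(3) by simp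
  have "measure (law \<epsilon> f) B \<le> measure (law \<epsilon> f) (A \<union> (B - A))"
    using A Bs by (intro F.finite_measure_mono) (auto simp: sets_law)
  also have "\<dots> \<le> measure (law \<epsilon> f) A + measure (law \<epsilon> f) (B - A)"
    using A Bs by (intro measure_Un_le) (auto simp: sets_law)
  finally have 3: "measure (law \<epsilon> f) B \<le> measure (law \<epsilon> f) A + e / 2" using B(2) by simp
  show "measure (law \<epsilon> g) A \<le> 3/4 * measure (law \<epsilon> f) A + 1/3 * exp (1/25) + e"
    using 1 2 3 \<open>0 < e\<close> by linarith
qed

end

text \<open>The auxiliary variable has the same law under both drifts, so the bound holds on each
  section and is then integrated; its linearity in the probability under \<open>f\<close> is what
  allows this.\<close>

lemma noise_experiment_bound:
  assumes P: "wiener_space wiener_measure"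
    and fg: "f \<in> convex_class" "g \<in> convex_class" and eps: "0 < \<epsilon>"
    and close: "(LINT t:{0..1}|lborel. (g t - f t)\<^sup>2) \<le> \<epsilon>\<^sup>2 / 25" and E: "E \<in> sets (noise_experiment \<epsilon> f)"
  shows "measure (noise_experiment \<epsilon> g) E \<le> 3/4 * measure (noise_experiment \<epsilon> f) E + 1/3 * exp (1/25)"
    and "prob_space (noise_experiment \<epsilon> f)" "prob_space (noise_experiment \<epsilon> g)"
    and "sets (noise_experiment \<epsilon> g) = sets (noise_experiment \<epsilon> f)"
proof -
  interpret P: wiener_space wiener_measure by fact
  define U where "U = (uniform_measure lborel {0..1} :: real measure)"
  have ne: "noise_experiment \<epsilon> h = P.law \<epsilon> h \<Otimes>\<^sub>M U" for h by (simp add: noise_experiment_def P.law_def U_def)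
  interpret U: prob_space U unfolding U_def by (intro prob_space_uniform_measure) auto
  interpret F: prob_space "P.law \<epsilon> f" by (rule P.prob_space_law[OF fg(1)])
  interpret G: prob_space "P.law \<epsilon> g" by (rule P.prob_space_law[OF fg(2)])
  interpret FU: pair_prob_space "P.law \<epsilon> f" U ..
  interpret GU: pair_prob_space "P.law \<epsilon> g" U ..
  show pf: "prob_space (noise_experiment \<epsilon> f)" unfolding ne by (rule FU.prob_space_axioms)
  show pg: "prob_space (noise_experiment \<epsilon> g)" unfolding ne by (rule GU.prob_space_axioms)
  have se: "sets (P.law \<epsilon> g \<Otimes>\<^sub>M U) = sets (P.law \<epsilon> f \<Otimes>\<^sub>M U)"
    by (intro sets_pair_measure_cong) (simp_all add: P.sets_law)
  then show "sets (noise_experiment \<epsilon> g) = sets (noise_experiment \<epsilon> f)" unfolding ne .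
  have Ef: "E \<in> sets (P.law \<epsilon> f \<Otimes>\<^sub>M U)" and Eg: "E \<in> sets (P.law \<epsilon> g \<Otimes>\<^sub>M U)" using E se by (simp_all add: ne)
  let ?E = "\<lambda>u. (\<lambda>x. (x, u)) -` E"
  have "emeasure (P.law \<epsilon> g \<Otimes>\<^sub>M U) E = (\<integral>\<^sup>+u. emeasure (P.law \<epsilon> g) (?E u) \<partial>U)"
    by (rule GU.emeasure_pair_measure_alt2[OF Eg])
  also have "\<dots> \<le> (\<integral>\<^sup>+u. ennreal (3/4) * emeasure (P.law \<epsilon> f) (?E u) + ennreal (1/3 * exp (1/25)) \<partial>U)"
  proof (rule nn_integral_mono)
    fix u
    have "?E u \<in> sets path_space" using sets_Pair2[OF Ef, of u] by (simp add: P.sets_law)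
    from ennreal_leI[OF P.law_bound[OF fg eps close this]]
    show "emeasure (P.law \<epsilon> g) (?E u) \<le> ennreal (3/4) * emeasure (P.law \<epsilon> f) (?E u) + ennreal (1/3 * exp (1/25))"
      unfolding F.emeasure_eq_measure G.emeasure_eq_measure
      by (simp only: ennreal_affine measure_nonneg)
  qed
  also have "\<dots> = ennreal (3/4) * (\<integral>\<^sup>+u. emeasure (P.law \<epsilon> f) (?E u) \<partial>U) + ennreal (1/3 * exp (1/25))"
    using FU.measurable_emeasure_Pair2[OF Ef]
    by (subst nn_integral_add) (auto simp: nn_integral_cmult U.emeasure_space_1)
  also have "(\<integral>\<^sup>+u. emeasure (P.law \<epsilon> f) (?E u) \<partial>U) = emeasure (P.law \<epsilon> f \<Otimes>\<^sub>M U) E"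
    by (rule FU.emeasure_pair_measure_alt2[OF Ef, symmetric])
  finally have "ennreal (measure (noise_experiment \<epsilon> g) E)
     \<le> ennreal (3/4 * measure (noise_experiment \<epsilon> f) E + 1/3 * exp (1/25))"
    unfolding ne FU.emeasure_eq_measure GU.emeasure_eq_measure by (simp only: ennreal_affine measure_nonneg)
  then show "measure (noise_experiment \<epsilon> g) E \<le> 3/4 * measure (noise_experiment \<epsilon> f) E + 1/3 * exp (1/25)"
    by (subst (asm) ennreal_le_iff) (auto intro!: add_nonneg_nonneg)
qed

context convex_signal_noise
begin

text \<open>An interval valid for both drifts must, under \<open>f\<close> alone, contain both
  minimizers with probability at least 1/10, and is then at least \<open>rz / 40\<close>
  long.\<close>

lemma benchmark_ge:
  assumes P: "wiener_space wiener_measure" and \<alpha>: "\<alpha> < 3/10"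
  shows "ennreal (rz / 400) \<le> benchmark \<alpha> \<epsilon> f"
proof -
  obtain g where g: "g \<in> convex_class" "rz / 40 \<le> \<bar>minimizer g - Z\<bar>"
    "(LINT t:{0..1}|lborel. (g t - f t)\<^sup>2) \<le> \<epsilon>\<^sup>2 / 25" using ex_alternative by blast
  \<comment> \<open>Gives \<open>1/3 * exp (1/25) \<le> 1.0416 / 3\<close>, just below 7/20.\<close>
  have "exp (1/25::real) \<le> 1 + 1/25 + (1/25)\<^sup>2" by (rule exp_bound) auto
  then have expb: "1/3 * exp (1/25::real) \<le> 7/20" by (simp add: power2_eq_square)
  have "ennreal (rz / 400) \<le> expected_length (noise_experiment \<epsilon> f) lo hi"
    if CI: "(lo, hi) \<in> CI_collection \<alpha> \<epsilon> {f, g}" for lo hi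
  proof -
    let ?R = "noise_experiment \<epsilon> f" and ?Q = "noise_experiment \<epsilon> g"
    let ?A = "{x \<in> space ?R. Z \<in> {lo x..hi x}}" and ?B = "{x \<in> space ?R. minimizer g \<in> {lo x..hi x}}"
    have cf: "confidence_interval ?R \<alpha> Z lo hi" and cg: "confidence_interval ?Q \<alpha> (minimizer g) lo hi"
      using CI by (auto simp: CI_collection_def)
    have [measurable]: "lo \<in> borel_measurable ?R" "hi \<in> borel_measurable ?R"
      using cf by (auto simp: confidence_interval_def)
    have A: "?A \<in> sets ?R" and B: "?B \<in> sets ?R" unfolding atLeastAtMost_iff by measurable
    note N = noise_experiment_bound[OF P in_class g(1) eps g(3)]
    interpret R: prob_space ?R by (rule N(2)[OF A])
    have sQ: "sets ?Q = sets ?R" by (rule N(4)[OF A])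
    have "space ?Q = space ?R" using sQ by (rule sets_eq_imp_space_eq)
    then have "1 - \<alpha> \<le> measure ?Q ?B" using cg by (simp add: confidence_interval_def)
    then have b: "1 - \<alpha> \<le> 3/4 * R.prob ?B + 7/20" using N(1)[OF B] expb by linarith
    have a: "1 - \<alpha> \<le> R.prob ?A" using cf by (simp add: confidence_interval_def)
    have "R.prob ?B \<le> R.prob ((?A \<inter> ?B) \<union> (space ?R - ?A))"
      using A B by (intro R.finite_measure_mono) auto
    also have "\<dots> \<le> R.prob (?A \<inter> ?B) + R.prob (space ?R - ?A)" using A B by (intro measure_Un_le) auto
    also have "R.prob (space ?R - ?A) = 1 - R.prob ?A" by (rule R.prob_compl[OF A])
    \<comment> \<open>From \<open>1 - \<alpha> > 7/10\<close>: under \<open>f\<close> the minimizer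
      of \<open>g\<close> is covered with probability above
      \<open>(7/10 - 7/20) / (3/4) = 7/15\<close>, and
      \<open>7/15 + 7/10 - 1 = 1/6 \<ge> 1/10\<close>.\<close>
    finally have AB: "1/10 \<le> R.prob (?A \<inter> ?B)" using a b \<alpha> by linarith
    have "ennreal (rz / 400) = ennreal (rz / 40) * ennreal (1/10)"
      using rho_z_pos by (simp flip: ennreal_mult)
    also have "\<dots> \<le> ennreal (rz / 40) * emeasure ?R (?A \<inter> ?B)"
      unfolding R.emeasure_eq_measure using AB by (intro mult_left_mono ennreal_leI) auto
    also have "\<dots> = (\<integral>\<^sup>+x. ennreal (rz / 40) * indicator (?A \<inter> ?B) x \<partial>?R)"
      using A B by (subst nn_integral_cmult_indicator) auto
    also have "\<dots> \<le> (\<integral>\<^sup>+x. ennreal (hi x - lo x) \<partial>?R)"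
    proof (rule nn_integral_mono)
      fix x
      show "ennreal (rz / 40) * indicator (?A \<inter> ?B) x \<le> ennreal (hi x - lo x)"
      proof (cases "x \<in> ?A \<inter> ?B")
        case True
        then have "rz / 40 \<le> hi x - lo x" using g(2) by (auto simp: abs_if split: if_splits)
        then show ?thesis using True by (simp add: ennreal_leI)
      next
        case False
        then have "indicator (?A \<inter> ?B) x = (0 :: ennreal)" by (rule indicator_simps(2))
        then show ?thesis by simp
      qed
    qed
    finally show ?thesis by (simp add: expected_length_def)
  qed
  then have "ennreal (rz / 400) \<le> (INF (lo, hi)\<in>CI_collection \<alpha> \<epsilon> {f, g}. expected_length (noise_experiment \<epsilon> f) lo hi)"
    by (intro INF_greatest) auto
  also have "\<dots> \<le> benchmark \<alpha> \<epsilon> f"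
    unfolding benchmark_def using g(1) by (rule SUP_upper)
  finally show ?thesis .
qed

end

theorem theorem3p2:
  fixes \<alpha> :: real
  assumes "0 < \<alpha>" and "\<alpha> < 0.3"
  shows "\<exists>C::real. \<forall>\<epsilon>>0. \<forall>(M :: 'a measure) W B1 B2.
    independent_brownian_motions M [W, B1, B2] \<longrightarrow>
    (\<forall>f\<in>convex_class.
      let Y = (\<lambda>\<omega>. white_noise \<epsilon> f (\<lambda>t. W t \<omega>));
          Yl = (\<lambda>\<omega>. split_l \<epsilon> (Y \<omega>) (\<lambda>t. B1 t \<omega>) (\<lambda>t. B2 t \<omega>));
          Ys = (\<lambda>\<omega>. split_s \<epsilon> (Y \<omega>) (\<lambda>t. B1 t \<omega>) (\<lambda>t. B2 t \<omega>));
          lo = (\<lambda>\<omega>. CI_lower \<alpha> \<epsilon> (Yl \<omega>) (Ys \<omega>));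
          hi = (\<lambda>\<omega>. CI_upper \<alpha> \<epsilon> (Yl \<omega>) (Ys \<omega>))
      in confidence_interval M \<alpha> (minimizer f) lo hi \<and>
         expected_length M lo hi \<le> ennreal ((24 * 2 ^ K \<alpha> - 3) * 17.5 * rho_z \<epsilon> f) \<and>
         ennreal ((24 * 2 ^ K \<alpha> - 3) * 17.5 * rho_z \<epsilon> f) \<le> ennreal C * benchmark \<alpha> \<epsilon> f)"
proof -
  define c :: real where "c = (24 * 2 ^ K \<alpha> - 3) * 17.5"
  have "(1::real) \<le> 2 ^ K \<alpha>" by simp
  then have c: "0 \<le> c" unfolding c_def by (intro mult_nonneg_nonneg) linarith+
  show ?thesis
  \<comment> \<open>400 compensates the benchmark bound \<open>rz / 400\<close>, and
    \<open>c\<close> depends on \<open>\<alpha>\<close> only.\<close>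
  proof (intro exI[of _ "c * 400"] allI impI ballI)
    fix \<epsilon> :: real and M :: "'a measure" and W B1 B2 f
    assume eps: "0 < \<epsilon>" and ibm: "independent_brownian_motions M [W, B1, B2]" and f: "f \<in> convex_class"
    interpret white_noise_experiment M W B1 B2 f \<epsilon>
      by standard (fact ibm, fact f, fact eps)
    have Wb: "brownian_motion M W" using ibm by (simp add: independent_brownian_motions_def)
    \<comment> \<open>The motion \<open>W\<close> at hand is the witness that makes the choice in
      \<open>wiener_measure\<close> meaningful.\<close>
    have P: "wiener_space wiener_measure" by standard (rule wiener_measure[OF Wb])+
    have yl: "split_l \<epsilon> (white_noise \<epsilon> f (\<lambda>t. W t \<omega>)) (\<lambda>t. B1 t \<omega>) (\<lambda>t. B2 t \<omega>) = obs (drift f) \<epsilon> True \<omega>" for \<omega>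
      by (simp add: fun_eq_iff split_l_def white_noise_eq obs_def noise_def algebra_simps)
    have ys: "split_s \<epsilon> (white_noise \<epsilon> f (\<lambda>t. W t \<omega>)) (\<lambda>t. B1 t \<omega>) (\<lambda>t. B2 t \<omega>) = obs (drift f) \<epsilon> False \<omega>" for \<omega>
      by (simp add: fun_eq_iff split_s_def white_noise_eq obs_def noise_def algebra_simps)
    have "ennreal (c * rz) = ennreal (c * 400) * ennreal (rz / 400)"
      using c rho_z_pos by (simp flip: ennreal_mult)
    also have "\<dots> \<le> ennreal (c * 400) * benchmark \<alpha> \<epsilon> f"
      using benchmark_ge[OF P, of \<alpha>] assms by (intro mult_left_mono) auto
    finally have low: "ennreal ((24 * 2 ^ K \<alpha> - 3) * 17.5 * rz) \<le> ennreal (c * 400) * benchmark \<alpha> \<epsilon> f"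
      by (simp only: c_def)
    show "let Y = (\<lambda>\<omega>. white_noise \<epsilon> f (\<lambda>t. W t \<omega>));
          Yl = (\<lambda>\<omega>. split_l \<epsilon> (Y \<omega>) (\<lambda>t. B1 t \<omega>) (\<lambda>t. B2 t \<omega>));
          Ys = (\<lambda>\<omega>. split_s \<epsilon> (Y \<omega>) (\<lambda>t. B1 t \<omega>) (\<lambda>t. B2 t \<omega>));
          lo = (\<lambda>\<omega>. CI_lower \<alpha> \<epsilon> (Yl \<omega>) (Ys \<omega>));
          hi = (\<lambda>\<omega>. CI_upper \<alpha> \<epsilon> (Yl \<omega>) (Ys \<omega>))
      in confidence_interval M \<alpha> (minimizer f) lo hi \<and>
         expected_length M lo hi \<le> ennreal ((24 * 2 ^ K \<alpha> - 3) * 17.5 * rho_z \<epsilon> f) \<and>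
         ennreal ((24 * 2 ^ K \<alpha> - 3) * 17.5 * rho_z \<epsilon> f) \<le> ennreal (c * 400) * benchmark \<alpha> \<epsilon> f"
      unfolding Let_def yl ys
      using coverage[of \<alpha>] expected_length_le[of \<alpha>] low assms by (intro conjI) auto
  qed
qed

end
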